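(* Let $u$ be a solution on $[0,T]$ of the incompressible Navier–Stokes equations $$u_t+u\cdot\nabla u-\nu\Delta u+\nabla p=f(x),\qquad\nabla\cdot u=0\ \text{ in }\Omega,\qquad u=0\ \text{ on }\partial\Omega,$$ and let $w$ be a strong solution on $[0,T]$ of the Corrected Smagorinsky Model $$w_t-\frac{C_s^4\delta^2}{\mu^{2}}\Delta w_t+w\cdot\nabla w-\nu\Delta w+\nabla q-\nabla\cdot\big((C_s\delta)^2|\nabla w|\nabla w\big)=f(x),\qquad \nabla\cdot w=0\ \text{ in }\Omega,\qquad w=0\ \text{ on }\partial\Omega,$$ with the same $\nu$ and $f$. Assume $\nabla u_t\in L^2(\Omega)$ and $\nabla w\in L^2(0,T;L^3(\Omega))$, and let $\phi=u-w$ be the modelling error. Then $$\frac12\Big(\|\phi(T)\|^2+\frac{C_s^4}{\mu^2}\delta^2\|\nabla\phi(T)\|^2\Big)+\int_0^T\Big(\frac{\nu}{2}\|\nabla\phi\|^2+\frac{C_1}{2}(C_s\delta)^2\|\nabla\phi\|_{L^3}^3\Big)dt$$ $$\le C^*\left\{\frac12\Big(\|\phi(0)\|^2+\frac{C_s^4}{\mu^2}\delta^2\|\nabla\phi(0)\|^2\Big)+\int_0^T\Big((C_s\delta)^2\|\nabla u\|_{L^3}^3+\frac{C_s^4}{\mu^2}\delta^2\|\nabla u_t\|^2\Big)dt\right\},$$ where the constant $C^*$ depends on $\nu$, $T$ and $\int_0^T\|\nabla w\|_{L^3}^2\,dt$.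
   Context: $\Omega\subset\mathbb{R}^d$ ($d=2$ or $3$) is a fixed regular bounded flow domain. $\nu>0$ is the kinematic viscosity, $C_s,\delta,\mu>0$ are constants, and $f=f(x)$ is a prescribed body force for which the pairings $(f,v)$ make sense. $\|\cdot\|$ and $(\cdot,\cdot)$ are the $L^2(\Omega)$ norm and inner product, $\|\cdot\|_{L^p}$ is the $L^p(\Omega)$ norm. $|\nabla w|$ is the Euclidean (Frobenius) norm of the velocity gradient. The solution $u$ is regular enough that the quantities in the estimate make sense. $C_1>0$ is the strong monotonicity constant: for all $u,w\in L^3(\Omega)$ with $\nabla u,\nabla w\in L^3(\Omega)$, $$\big(|\nabla u|\nabla u-|\nabla w|\nabla w,\nabla(u-w)\big)\ge C_1\|\nabla(u-w)\|_{L^3(\Omega)}^3 .$$ Spaces: $X=\{v\in L^3(\Omega):\nabla v\in L^3(\Omega),\ v=0\text{ on }\partial\Omega\}$ (vector fields), $Q=\{q\in L^2(\Omega):\int_\Omega q\,dx=0\}$. Weak form of the Corrected Smagorinsky Model: $(w,p)\in(X,Q)$ satisfies $$(w_t,v)+\tfrac{C_s^4}{\mu^2}\delta^2(\nabla w_t,\nabla v)+(w\cdot\nabla w,v)+\nu(\nabla w,\nabla v)-(p,\nabla\cdot v)+\big((C_s\delta)^2|\nabla w|\nabla w,\nabla v\big)=(f,v)\quad\forall v\in X,$$ $$(q,\nabla\cdot w)=0\quad\forall q\in Q .$$ Strong solution: $w$ is a strong solution (with initial value $w_0$) on $[0,T]$ if (1) $w\in L^\infty(0,T;H^1(\Omega))\cap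 L^2(0,T;W^{1,3}(\Omega))\cap L^2(0,T;L^6(\Omega))$; (2) $w(\cdot,t)\to w_0$ in $L^2(\Omega)$ as $t\to0$; (3) $w$ satisfies the weak form above for all $v\in L^\infty(0,T;H^1(\Omega))\cap L^2(0,T;W^{1,3}(\Omega))\cap L^2(0,T;L^6(\Omega))$ (vanishing on $\partial\Omega$). *)

theory Defs
  imports "HOL-Analysis.Analysis"
begin

section \<open>Spatial function spaces\<close>

text \<open>
  Bounded Lipschitz domain: near each boundary point the domain is the set lying strictly above
  the graph of a Lipschitz function \<open>g\<close> in some direction \<open>e\<close>; \<open>y - (y \<bullet> e) *\<^sub>R e\<close> is the
  projection of \<open>y\<close> to the hyperplane orthogonal to \<open>e\<close>.
\<close>

definition regular_domain :: "(real^'n) set \<Rightarrow> bool" where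
  "regular_domain \<Omega> \<longleftrightarrow>
     open \<Omega> \<and> connected \<Omega> \<and> bounded \<Omega> \<and> \<Omega> \<noteq> {} \<and>
     (\<forall>x\<in>frontier \<Omega>. \<exists>r>0. \<exists>e g L. norm e = 1 \<and> L-lipschitz_on UNIV (g :: real^'n \<Rightarrow> real) \<and>
        (\<forall>y\<in>ball x r. y \<in> \<Omega> \<longleftrightarrow> g (y - (y \<bullet> e) *\<^sub>R e) < y \<bullet> e))"

definition Lp :: "(real^'n) set \<Rightarrow> real \<Rightarrow> (real^'n \<Rightarrow> 'b::euclidean_space) set" where
  "Lp \<Omega> p = {g \<in> borel_measurable (lebesgue_on \<Omega>).
                integrable (lebesgue_on \<Omega>) (\<lambda>x. norm (g x) powr p)}"

text \<open>On \<open>real^'n^'n\<close> the library's \<open>norm\<close> and \<open>\<bullet>\<close> are the Frobenius norm and inner product.\<close>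

definition Lp_norm :: "(real^'n) set \<Rightarrow> real \<Rightarrow> (real^'n \<Rightarrow> 'b::euclidean_space) \<Rightarrow> real" where
  "Lp_norm \<Omega> p g = (LINT x|lebesgue_on \<Omega>. norm (g x) powr p) powr (1 / p)"

definition L2_inner :: "(real^'n) set \<Rightarrow> (real^'n \<Rightarrow> 'b::euclidean_space) \<Rightarrow> (real^'n \<Rightarrow> 'b) \<Rightarrow> real" where
  "L2_inner \<Omega> f g = (LINT x|lebesgue_on \<Omega>. f x \<bullet> g x)"

text \<open>
  Test functions are \<open>C\<^sup>1\<close> with compact support. Weak first derivatives and
  the closure \<open>W\<^sub>0\<close> below do not change if \<open>C\<^sup>\<infinity>\<close> is used instead; this is the convention of
  Gilbarg and Trudinger, Chapter 7.
\<close>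

definition C1c :: "(real^'n) set \<Rightarrow> (real^'n \<Rightarrow> 'b::real_normed_vector) set" where
  "C1c \<Omega> = {\<psi>. (\<forall>x. \<psi> differentiable (at x)) \<and>
               (\<forall>h. continuous_on UNIV (\<lambda>x. frechet_derivative \<psi> (at x) h)) \<and>
               compact (closure {x. \<psi> x \<noteq> 0}) \<and> closure {x. \<psi> x \<noteq> 0} \<subseteq> \<Omega>}"

definition locally_integrable :: "(real^'n) set \<Rightarrow> (real^'n \<Rightarrow> 'b::euclidean_space) \<Rightarrow> bool" where
  "locally_integrable \<Omega> g \<longleftrightarrow> (\<forall>K. compact K \<and> K \<subseteq> \<Omega> \<longrightarrow> g absolutely_integrable_on K)"

text \<open>Convention: \<open>G x $ i $ j\<close> is the derivative of the \<open>i\<close>-th component in direction \<open>j\<close>.\<close>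

definition has_weak_grad ::
    "(real^'n) set \<Rightarrow> (real^'n \<Rightarrow> real^'n) \<Rightarrow> (real^'n \<Rightarrow> real^'n^'n) \<Rightarrow> bool" where
  "has_weak_grad \<Omega> v G \<longleftrightarrow>
     locally_integrable \<Omega> v \<and> locally_integrable \<Omega> G \<and>
     (\<forall>\<psi>\<in>C1c \<Omega>. \<forall>i j.
        (LINT x|lebesgue_on \<Omega>. v x $ i * frechet_derivative \<psi> (at x) (axis j 1)) =
        - (LINT x|lebesgue_on \<Omega>. G x $ i $ j * (\<psi> x :: real)))"

text \<open>
  A representative of the weak gradient, which is unique up to null subsets of \<open>\<Omega>\<close>;
  meaningful only for \<open>v\<close> that has a weak gradient.
\<close>

definition wgrad :: "(real^'n) set \<Rightarrow> (real^'n \<Rightarrow> real^'n) \<Rightarrow> real^'n \<Rightarrow> real^'n^'n" where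
  "wgrad \<Omega> v = (SOME G. has_weak_grad \<Omega> v G)"

definition wdiv :: "(real^'n) set \<Rightarrow> (real^'n \<Rightarrow> real^'n) \<Rightarrow> real^'n \<Rightarrow> real" where
  "wdiv \<Omega> v x = trace (wgrad \<Omega> v x)"

text \<open>\<open>(w \<cdot> \<nabla>) w\<close>, whose \<open>i\<close>-th component is \<open>\<Sum>\<^sub>j w\<^sub>j \<partial>\<^sub>j w\<^sub>i\<close>.\<close>

definition convect :: "(real^'n) set \<Rightarrow> (real^'n \<Rightarrow> real^'n) \<Rightarrow> real^'n \<Rightarrow> real^'n" where
  "convect \<Omega> w x = wgrad \<Omega> w x *v w x"

definition smag :: "(real^'n) set \<Rightarrow> (real^'n \<Rightarrow> real^'n) \<Rightarrow> real^'n \<Rightarrow> real^'n^'n" where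
  "smag \<Omega> w x = norm (wgrad \<Omega> w x) *\<^sub>R wgrad \<Omega> w x"

definition W1p :: "(real^'n) set \<Rightarrow> real \<Rightarrow> (real^'n \<Rightarrow> real^'n) set" where
  "W1p \<Omega> p = {v \<in> Lp \<Omega> p. \<exists>G\<in>Lp \<Omega> p. has_weak_grad \<Omega> v G}"

definition W1p_norm :: "(real^'n) set \<Rightarrow> real \<Rightarrow> (real^'n \<Rightarrow> real^'n) \<Rightarrow> real" where
  "W1p_norm \<Omega> p v = Lp_norm \<Omega> p v + Lp_norm \<Omega> p (wgrad \<Omega> v)"

text \<open>
  The condition \<open>v = 0\<close> on \<open>\<partial>\<Omega>\<close> is expressed by \<open>W\<^sub>0\<close>, the \<open>W\<^sup>1\<^sup>,\<^sup>3\<close>-closure of the test fields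
  (for Lipschitz domains, the fields of zero trace).
\<close>

definition Xspace :: "(real^'n) set \<Rightarrow> (real^'n \<Rightarrow> real^'n) set" where
  "Xspace \<Omega> = {v \<in> W1p \<Omega> 3. \<exists>\<psi>::nat \<Rightarrow> real^'n \<Rightarrow> real^'n. (\<forall>k. \<psi> k \<in> C1c \<Omega>) \<and>
                 (\<lambda>k. W1p_norm \<Omega> 3 (\<lambda>x. \<psi> k x - v x)) \<longlonglongrightarrow> 0}"

definition Qspace :: "(real^'n) set \<Rightarrow> (real^'n \<Rightarrow> real) set" where
  "Qspace \<Omega> = {q \<in> Lp \<Omega> 2. (LINT x|lebesgue_on \<Omega>. q x) = 0}"

text \<open>
  The pairings \<open>(f, v)\<close> exist for all \<open>v \<in> X\<close> and \<open>f\<close> acts as an element of the dual of \<open>X\<close>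
  (the bound follows from the integrability by the closed graph theorem).
\<close>

definition body_force :: "(real^'n) set \<Rightarrow> (real^'n \<Rightarrow> real^'n) \<Rightarrow> bool" where
  "body_force \<Omega> f \<longleftrightarrow>
     (\<forall>v\<in>Xspace \<Omega>. integrable (lebesgue_on \<Omega>) (\<lambda>x. f x \<bullet> v x)) \<and>
     (\<exists>c. \<forall>v\<in>Xspace \<Omega>. \<bar>L2_inner \<Omega> f v\<bar> \<le> c * W1p_norm \<Omega> 3 v)"

definition strong_monotonicity :: "(real^'n) set \<Rightarrow> real \<Rightarrow> bool" where
  "strong_monotonicity \<Omega> C1 \<longleftrightarrow>
     (\<forall>u\<in>W1p \<Omega> 3. \<forall>w\<in>W1p \<Omega> 3.
        L2_inner \<Omega> (\<lambda>x. smag \<Omega> u x - smag \<Omega> w x) (wgrad \<Omega> (\<lambda>x. u x - w x))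
        \<ge> C1 * Lp_norm \<Omega> 3 (wgrad \<Omega> (\<lambda>x. u x - w x)) ^ 3)"

section \<open>Functions of time with values in a function space\<close>

text \<open>
  Bochner spaces over \<open>[0,T]\<close> for a function space \<open>B\<close> with norm \<open>N\<close>; the library's Bochner
  integral needs a Banach type, so strong measurability (almost everywhere limit of
  \<open>B\<close>-valued simple functions) is spelled out.
\<close>

definition strongly_measurable ::
    "('x \<Rightarrow> 'b::euclidean_space) set \<Rightarrow> (('x \<Rightarrow> 'b) \<Rightarrow> real) \<Rightarrow> real \<Rightarrow> (real \<Rightarrow> 'x \<Rightarrow> 'b) \<Rightarrow> bool" where
  "strongly_measurable B N T w \<longleftrightarrow>
     (AE t in lebesgue_on {0..T}. w t \<in> B) \<and>
     (\<exists>s::nat \<Rightarrow> real \<Rightarrow> 'x \<Rightarrow> 'b.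
        (\<forall>k. simple_function (lebesgue_on {0..T}) (s k) \<and> s k ` {0..T} \<subseteq> B) \<and>
        (AE t in lebesgue_on {0..T}. (\<lambda>k. N (\<lambda>x. s k t x - w t x)) \<longlonglongrightarrow> 0))"

definition bochner_Lp ::
    "real \<Rightarrow> real \<Rightarrow> ('x \<Rightarrow> 'b::euclidean_space) set \<Rightarrow> (('x \<Rightarrow> 'b) \<Rightarrow> real) \<Rightarrow> (real \<Rightarrow> 'x \<Rightarrow> 'b) set" where
  "bochner_Lp p T B N = {w. strongly_measurable B N T w \<and>
                            integrable (lebesgue_on {0..T}) (\<lambda>t. N (w t) powr p)}"

definition bochner_Linf ::
    "real \<Rightarrow> ('x \<Rightarrow> 'b::euclidean_space) set \<Rightarrow> (('x \<Rightarrow> 'b) \<Rightarrow> real) \<Rightarrow> (real \<Rightarrow> 'x \<Rightarrow> 'b) set" where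
  "bochner_Linf T B N = {w. strongly_measurable B N T w \<and>
                            (\<exists>C. AE t in lebesgue_on {0..T}. N (w t) \<le> C)}"

text \<open>\<open>L\<^sup>\<infinity>(0,T;H\<^sup>1) \<inter> L\<^sup>2(0,T;W\<^sup>1\<^sup>,\<^sup>3) \<inter> L\<^sup>2(0,T;L\<^sup>6)\<close>\<close>

definition strong_class :: "(real^'n) set \<Rightarrow> real \<Rightarrow> (real \<Rightarrow> real^'n \<Rightarrow> real^'n) set" where
  "strong_class \<Omega> T =
     bochner_Linf T (W1p \<Omega> 2) (W1p_norm \<Omega> 2) \<inter>
     bochner_Lp 2 T (W1p \<Omega> 3) (W1p_norm \<Omega> 3) \<inter>
     bochner_Lp 2 T (Lp \<Omega> 6) (Lp_norm \<Omega> 6)"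

text \<open>
  \<open>wt\<close> is the weak time derivative of \<open>w\<close> in \<open>H\<^sup>1\<close>: \<open>wt \<in> L\<^sup>1(0,T;H\<^sup>1)\<close> and
  \<open>w(t) = w(0) + \<integral>\<^sub>0\<^sup>t wt\<close> in \<open>H\<^sup>1\<close> for every \<open>t \<in> [0,T]\<close>. The \<open>H\<^sup>1\<close>-valued integral is identified
  by its pairings with \<open>L\<^sup>2\<close> fields: \<open>v \<mapsto> (v,g) + (\<nabla>v,G)\<close> are all bounded functionals on \<open>H\<^sup>1\<close>.
  In particular \<open>w\<close> is the continuous representative, so \<open>w(0)\<close> and \<open>w(T)\<close> are meaningful.
\<close>

definition H1_time_derivative ::
    "(real^'n) set \<Rightarrow> real \<Rightarrow> (real \<Rightarrow> real^'n \<Rightarrow> real^'n) \<Rightarrow> (real \<Rightarrow> real^'n \<Rightarrow> real^'n) \<Rightarrow> bool" where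
  "H1_time_derivative \<Omega> T w wt \<longleftrightarrow>
     (\<forall>t\<in>{0..T}. w t \<in> W1p \<Omega> 2) \<and>
     wt \<in> bochner_Lp 1 T (W1p \<Omega> 2) (W1p_norm \<Omega> 2) \<and>
     (\<forall>t\<in>{0..T}.
        (\<forall>g\<in>Lp \<Omega> 2. L2_inner \<Omega> (w t) g =
            L2_inner \<Omega> (w 0) g + (LINT s|lebesgue_on {0..t}. L2_inner \<Omega> (wt s) g)) \<and>
        (\<forall>G\<in>Lp \<Omega> 2. L2_inner \<Omega> (wgrad \<Omega> (w t)) G =
            L2_inner \<Omega> (wgrad \<Omega> (w 0)) G +
            (LINT s|lebesgue_on {0..t}. L2_inner \<Omega> (wgrad \<Omega> (wt s)) G)))"

section \<open>The two flow models\<close>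

text \<open>
  The momentum equation holds in the sense of distributions on \<open>\<Omega>\<close> for almost every \<open>t\<close>.
  The solution is regular enough that \<open>u - w\<close> is an admissible test function in the
  definition of a strong solution of the Corrected Smagorinsky Model.
\<close>

definition nse_solution ::
    "(real^'n) set \<Rightarrow> real \<Rightarrow> real \<Rightarrow> (real^'n \<Rightarrow> real^'n) \<Rightarrow>
     (real \<Rightarrow> real^'n \<Rightarrow> real^'n) \<Rightarrow> (real \<Rightarrow> real^'n \<Rightarrow> real^'n) \<Rightarrow> (real \<Rightarrow> real^'n \<Rightarrow> real) \<Rightarrow> bool" where
  "nse_solution \<Omega> T \<nu> f u ut p \<longleftrightarrow>
     u \<in> strong_class \<Omega> T \<and>
     H1_time_derivative \<Omega> T u ut \<and>
     (AE t in lebesgue_on {0..T}.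
        u t \<in> Xspace \<Omega> \<and> p t \<in> Lp \<Omega> 2 \<and>
        (\<forall>\<psi>\<in>C1c \<Omega>.
           L2_inner \<Omega> (ut t) \<psi> + L2_inner \<Omega> (convect \<Omega> (u t)) \<psi>
           + \<nu> * L2_inner \<Omega> (wgrad \<Omega> (u t)) (wgrad \<Omega> \<psi>) - L2_inner \<Omega> (p t) (wdiv \<Omega> \<psi>)
           = L2_inner \<Omega> f \<psi>) \<and>
        (AE x in lebesgue_on \<Omega>. wdiv \<Omega> (u t) x = 0))"

text \<open>Momentum equation of the weak form at a fixed time; \<open>w'\<close> stands for \<open>w\<^sub>t\<close>.\<close>

definition csm_weak_form ::
    "(real^'n) set \<Rightarrow> real \<Rightarrow> real \<Rightarrow> real \<Rightarrow> real \<Rightarrow> (real^'n \<Rightarrow> real^'n) \<Rightarrow>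
     (real^'n \<Rightarrow> real^'n) \<Rightarrow> (real^'n \<Rightarrow> real^'n) \<Rightarrow> (real^'n \<Rightarrow> real) \<Rightarrow> (real^'n \<Rightarrow> real^'n) \<Rightarrow> bool" where
  "csm_weak_form \<Omega> \<nu> Cs \<delta> \<mu> f w w' p v \<longleftrightarrow>
     L2_inner \<Omega> w' v
     + Cs^4 / \<mu>^2 * \<delta>^2 * L2_inner \<Omega> (wgrad \<Omega> w') (wgrad \<Omega> v)
     + L2_inner \<Omega> (convect \<Omega> w) v
     + \<nu> * L2_inner \<Omega> (wgrad \<Omega> w) (wgrad \<Omega> v)
     - L2_inner \<Omega> p (wdiv \<Omega> v)
     + L2_inner \<Omega> (\<lambda>x. (Cs * \<delta>)^2 *\<^sub>R smag \<Omega> w x) (wgrad \<Omega> v)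
     = L2_inner \<Omega> f v"

definition csm_strong_solution ::
    "(real^'n) set \<Rightarrow> real \<Rightarrow> real \<Rightarrow> real \<Rightarrow> real \<Rightarrow> real \<Rightarrow> (real^'n \<Rightarrow> real^'n) \<Rightarrow>
     (real \<Rightarrow> real^'n \<Rightarrow> real^'n) \<Rightarrow> (real \<Rightarrow> real^'n \<Rightarrow> real^'n) \<Rightarrow> (real \<Rightarrow> real^'n \<Rightarrow> real) \<Rightarrow>
     (real^'n \<Rightarrow> real^'n) \<Rightarrow> bool" where
  "csm_strong_solution \<Omega> T \<nu> Cs \<delta> \<mu> f w wt p w0 \<longleftrightarrow>
     w \<in> strong_class \<Omega> T \<and>
     H1_time_derivative \<Omega> T w wt \<and>
     w0 \<in> Lp \<Omega> 2 \<and> ((\<lambda>t. Lp_norm \<Omega> 2 (\<lambda>x. w t x - w0 x)) \<longlongrightarrow> 0) (at_right 0) \<and>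
     (AE t in lebesgue_on {0..T}. w t \<in> Xspace \<Omega> \<and> p t \<in> Qspace \<Omega> \<and>
        (\<forall>q\<in>Qspace \<Omega>. L2_inner \<Omega> q (wdiv \<Omega> (w t)) = 0)) \<and>
     (\<forall>v\<in>strong_class \<Omega> T. (AE t in lebesgue_on {0..T}. v t \<in> Xspace \<Omega>) \<longrightarrow>
        (AE t in lebesgue_on {0..T}. csm_weak_form \<Omega> \<nu> Cs \<delta> \<mu> f (w t) (wt t) (p t) (v t)))"

end

theory Submission
  imports Defs
begin

text \<open>
  Write \<open>\<phi> = u - w\<close> and \<open>K = C\<^sub>s\<^sup>4 \<delta>\<^sup>2 / \<mu>\<^sup>2\<close>. Both models are tested with \<open>\<phi>(t)\<close> at almost every time and subtracted.
  The force cancels, and the pressures disappear because \<open>\<phi>\<close> is divergence free. What remains is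
  \<open>(\<phi>\<^sub>t, \<phi>) + K (\<nabla>\<phi>\<^sub>t, \<nabla>\<phi>) + \<nu> \<parallel>\<nabla>\<phi>\<parallel>\<^sup>2 + (C\<^sub>s \<delta>)\<^sup>2 (\<bar>\<nabla>u\<bar>\<nabla>u - \<bar>\<nabla>w\<bar>\<nabla>w, \<nabla>\<phi>) + (\<phi> \<cdot> \<nabla>w, \<phi>)\<close>
  \<open>= K (\<nabla>u\<^sub>t, \<nabla>\<phi>) + (C\<^sub>s \<delta>)\<^sup>2 (\<bar>\<nabla>u\<bar>\<nabla>u, \<nabla>\<phi>)\<close>,
  since \<open>(u \<cdot> \<nabla>\<phi>, \<phi>) = 0\<close>. Strong monotonicity bounds the Smagorinsky difference from below by the cube of the \<open>L\<^sup>3\<close> norm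
  of \<open>\<nabla>\<phi>\<close>; Young's inequality absorbs half of it against the last term on the right. The one delicate term is
  \<open>(\<phi> \<cdot> \<nabla>w, \<phi>)\<close>, at most \<open>\<parallel>\<nabla>w\<parallel> \<parallel>\<phi>\<parallel>\<^sup>2\<close> in \<open>L\<^sup>3\<close> norms: in dimension 2 and 3 the square of the \<open>L\<^sup>3\<close> norm of \<open>\<phi>\<close> is bounded by
  a constant times the product of the \<open>L\<^sup>2\<close> norms of \<open>\<phi>\<close> and \<open>\<nabla>\<phi>\<close>, so half of the viscous term absorbs it up to a multiple of
  \<open>\<parallel>\<nabla>w\<parallel>\<^sup>2 \<parallel>\<phi>\<parallel>\<^sup>2\<close>, whose coefficient is integrable in time. Gronwall's inequality for the energy
  \<open>(\<parallel>\<phi>\<parallel>\<^sup>2 + K \<parallel>\<nabla>\<phi>\<parallel>\<^sup>2) / 2\<close> finishes the proof; it also absorbs the part \<open>K \<parallel>\<nabla>\<phi>\<parallel>\<^sup>2 / 2\<close> of the consistency term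
  \<open>K (\<nabla>u\<^sub>t, \<nabla>\<phi>)\<close>, which keeps the constant independent of \<open>K\<close>.

  The chosen weak gradient \<^const>\<open>wgrad\<close> is linear almost everywhere by uniqueness of weak
  gradients (\<open>weak_grad_unique\<close>, from the fundamental lemma of the calculus of variations). The bound of the \<open>L\<^sup>3\<close> norm
  (\<open>gagliardo_nirenberg_Xspace\<close>) is Gagliardo's argument with the Loomis-Whitney inequality, applied to \<open>\<bar>\<psi>\<bar>\<^sup>2\<close> for test fields \<open>\<psi>\<close>;
  density in \<open>X\<close> transfers it to \<open>\<phi>\<close>, as it transfers the distributional Navier-Stokes equations and the
  orthogonality \<open>(u \<cdot> \<nabla>\<phi>, \<phi>) = 0\<close>. These facts give a differential inequality at fixed time
  (\<open>error_energy_inequality\<close>). The chain rule for the energy along a curve whose derivative is only integrable with values in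
  \<open>H\<^sup>1\<close> (\<open>H1_energy_identity\<close>) turns it into an integral inequality, to which \<open>gronwall_integral\<close> applies.
\<close>

section \<open>Lebesgue spaces on a domain\<close>

lemma Lp_measurable: "f \<in> Lp \<Omega> p \<Longrightarrow> f \<in> borel_measurable (lebesgue_on \<Omega>)"
  by (simp add: Lp_def)

lemma Lp_integrable_powr: "f \<in> Lp \<Omega> p \<Longrightarrow> integrable (lebesgue_on \<Omega>) (\<lambda>x. norm (f x) powr p)"
  by (simp add: Lp_def)

lemma Lp_norm_nonneg [simp]: "0 \<le> Lp_norm \<Omega> p f"
  by (simp add: Lp_norm_def)

lemma Lp_norm_powr:
  assumes "p > 0"
  shows "Lp_norm \<Omega> p f powr p = (LINT x|lebesgue_on \<Omega>. norm (f x) powr p)"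
proof -
  have "0 \<le> (LINT x|lebesgue_on \<Omega>. norm (f x) powr p)"
    by (intro integral_nonneg_AE) auto
  then show ?thesis
    using assms by (simp add: Lp_norm_def powr_powr)
qed

lemma Lp_norm_power2: "(Lp_norm \<Omega> 2 f)\<^sup>2 = (LINT x|lebesgue_on \<Omega>. (norm (f x))\<^sup>2)"
  using Lp_norm_powr[of 2 \<Omega> f] by simp

lemma Lp_norm_power3: "(Lp_norm \<Omega> 3 f) ^ 3 = (LINT x|lebesgue_on \<Omega>. norm (f x) ^ 3)"
  using Lp_norm_powr[of 3 \<Omega> f] by simp

lemma Lp2_integrable: "f \<in> Lp \<Omega> 2 \<Longrightarrow> integrable (lebesgue_on \<Omega>) (\<lambda>x. (norm (f x))\<^sup>2)"
  using Lp_integrable_powr[of f \<Omega> 2] by simp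

lemma Lp3_integrable: "f \<in> Lp \<Omega> 3 \<Longrightarrow> integrable (lebesgue_on \<Omega>) (\<lambda>x. norm (f x) ^ 3)"
  using Lp_integrable_powr[of f \<Omega> 3] by simp

lemma Lp2I:
  "f \<in> borel_measurable (lebesgue_on \<Omega>) \<Longrightarrow> integrable (lebesgue_on \<Omega>) (\<lambda>x. (norm (f x))\<^sup>2) \<Longrightarrow> f \<in> Lp \<Omega> 2"
  by (simp add: Lp_def)

text \<open>Lebesgue measure is complete, so measurability passes to functions that agree almost everywhere. This is what makes
  the arbitrary representative chosen by \<^const>\<open>wgrad\<close> usable.\<close>

lemma lebesgue_on_measurable_cong_AE:
  fixes f g :: "'a::euclidean_space \<Rightarrow> 'b::euclidean_space"
  assumes S: "S \<in> sets lebesgue" and f: "f \<in> borel_measurable (lebesgue_on S)"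
    and ae: "AE x in lebesgue_on S. f x = g x"
  shows "g \<in> borel_measurable (lebesgue_on S)"
proof -
  have "(\<lambda>x. if x \<in> S then f x else 0) \<in> borel_measurable lebesgue"
    using f S by (simp add: borel_measurable_if)
  moreover have "AE x in lebesgue. (if x \<in> S then f x else 0) = (if x \<in> S then g x else 0)"
    using ae S by (simp add: AE_restrict_space_iff)
  ultimately have "(\<lambda>x. if x \<in> S then g x else 0) \<in> borel_measurable lebesgue"
    by (rule borel_measurable_AE)
  then show ?thesis
    using S by (simp add: borel_measurable_if)
qed

lemma Lp_cong_AE:
  fixes f g :: "real^'n \<Rightarrow> 'b::euclidean_space"
  assumes S: "\<Omega> \<in> sets lebesgue" and f: "f \<in> Lp \<Omega> p"
    and ae: "AE x in lebesgue_on \<Omega>. f x = g x"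
  shows "g \<in> Lp \<Omega> p"
proof -
  have g: "g \<in> borel_measurable (lebesgue_on \<Omega>)"
    using lebesgue_on_measurable_cong_AE[OF S Lp_measurable[OF f] ae] .
  have "integrable (lebesgue_on \<Omega>) (\<lambda>x. norm (g x) powr p)"
    using Lp_integrable_powr[OF f]
    by (rule integrable_cong_AE_imp) (use g ae in auto)
  with g show ?thesis by (simp add: Lp_def)
qed

lemma Lp_norm_cong_AE:
  assumes f: "f \<in> borel_measurable (lebesgue_on \<Omega>)" and g: "g \<in> borel_measurable (lebesgue_on \<Omega>)"
    and ae: "AE x in lebesgue_on \<Omega>. f x = g x"
  shows "Lp_norm \<Omega> p f = Lp_norm \<Omega> p g"
proof -
  have "(LINT x|lebesgue_on \<Omega>. norm (f x) powr p) = (LINT x|lebesgue_on \<Omega>. norm (g x) powr p)"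
    by (rule integral_cong_AE) (use f g ae in auto)
  then show ?thesis by (simp add: Lp_norm_def)
qed

lemma Lp_scaleR:
  assumes "f \<in> Lp \<Omega> p" shows "(\<lambda>x. c *\<^sub>R f x) \<in> Lp \<Omega> p"
  using assms by (auto simp: Lp_def powr_mult)

lemma Lp_norm_uminus: "Lp_norm \<Omega> p (\<lambda>x. - f x) = Lp_norm \<Omega> p f"
  by (simp add: Lp_norm_def)

lemma Lp_norm_minus_commute: "Lp_norm \<Omega> p (\<lambda>x. f x - g x) = Lp_norm \<Omega> p (\<lambda>x. g x - f x)"
  by (simp add: Lp_norm_def norm_minus_commute)

text \<open>Convexity of \<open>s \<mapsto> s powr p\<close> at the weights \<open>a / (a + b)\<close> and \<open>b / (a + b)\<close>. With \<open>a\<close>, \<open>b\<close> bounds for the norms of two functions, integration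
  over \<open>\<Omega>\<close> gives the triangle inequality in \<open>L\<^sup>p\<close>.\<close>

lemma powr_sum_le_weighted:
  fixes a b s t p :: real
  assumes p: "p \<ge> 1" and ab: "a > 0" "b > 0" and st: "s \<ge> 0" "t \<ge> 0"
  shows "(s + t) powr p \<le> (a + b) powr (p - 1) * (a powr (1 - p) * s powr p + b powr (1 - p) * t powr p)"
proof -
  have conv: "convex_on {0..} (\<lambda>x::real. x powr p)"
  proof (rule convex_onI)
    fix t x y :: real
    assume t: "0 < t" "t < 1" and xy: "x \<in> {0..}" "y \<in> {0..}"
    have t1: "s powr p \<le> s" if "0 < s" "s < 1" for s :: real
      using powr_mono'[of 1 p s] p that by simp
    show "((1 - t) *\<^sub>R x + t *\<^sub>R y) powr p \<le> (1 - t) * x powr p + t * y powr p"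
    proof (cases "x = 0 \<or> y = 0")
      case True
      then show ?thesis
        using t1[of t] t1[of "1 - t"] t xy p by (auto simp: powr_mult intro!: mult_right_mono)
    next
      case False
      then show ?thesis
        using convex_onD[OF powr_convex[OF p], of t x y] t xy by auto
    qed
  qed (rule convex_real_interval)
  define l where "l = a / (a + b)"
  have l: "0 < l" "l < 1" and l': "1 - l = b / (a + b)"
    using ab by (auto simp: l_def field_simps)
  have "(s + t) = (1 - (1 - l)) *\<^sub>R (s / l) + (1 - l) *\<^sub>R (t / (1 - l))"
    using l by simp
  then have "(s + t) powr p \<le> (1 - (1 - l)) * (s / l) powr p + (1 - l) * (t / (1 - l)) powr p"
    using convex_onD[OF conv, of "1 - l" "s / l" "t / (1 - l)"] l st by auto
  also have "\<dots> = (a + b) powr (p - 1) * (a powr (1 - p) * s powr p + b powr (1 - p) * t powr p)"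
  proof -
    have 1: "l * (s / l) powr p = (a + b) powr (p - 1) * (a powr (1 - p) * s powr p)"
    proof -
      have "l * (s / l) powr p = l powr (1 - p) * s powr p"
        using l st by (simp add: powr_divide powr_diff)
      also have "l powr (1 - p) = (a + b) powr (p - 1) * a powr (1 - p)"
        using ab by (simp add: l_def powr_divide powr_diff)
      finally show ?thesis by simp
    qed
    have 2: "(1 - l) * (t / (1 - l)) powr p = (a + b) powr (p - 1) * (b powr (1 - p) * t powr p)"
    proof -
      have "(1 - l) * (t / (1 - l)) powr p = (1 - l) powr (1 - p) * t powr p"
        using l st by (simp add: powr_divide powr_diff)
      also have "(1 - l) powr (1 - p) = (a + b) powr (p - 1) * b powr (1 - p)"
        using ab by (simp add: l' powr_divide powr_diff)
      finally show ?thesis by simp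
    qed
    show ?thesis using 1 2 by (simp add: distrib_left)
  qed
  finally show ?thesis .
qed

lemma Lp_add:
  fixes f g :: "real^'n \<Rightarrow> 'b::euclidean_space"
  assumes p: "p \<ge> 1" and f: "f \<in> Lp \<Omega> p" and g: "g \<in> Lp \<Omega> p"
  shows "(\<lambda>x. f x + g x) \<in> Lp \<Omega> p"
proof -
  note [measurable] = Lp_measurable[OF f] Lp_measurable[OF g]
  have "integrable (lebesgue_on \<Omega>) (\<lambda>x. norm (f x + g x) powr p)"
  proof (rule Bochner_Integration.integrable_bound)
    show "integrable (lebesgue_on \<Omega>) (\<lambda>x. 2 powr (p - 1) * (norm (f x) powr p + norm (g x) powr p))"
      using Lp_integrable_powr[OF f] Lp_integrable_powr[OF g] by simp
    show "AE x in lebesgue_on \<Omega>. norm (norm (f x + g x) powr p)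
       \<le> norm (2 powr (p - 1) * (norm (f x) powr p + norm (g x) powr p))"
    proof (rule AE_I2)
      fix x
      have "norm (f x + g x) powr p \<le> (norm (f x) + norm (g x)) powr p"
        using p by (intro powr_mono2 norm_triangle_ineq) auto
      also have "\<dots> \<le> 2 powr (p - 1) * (norm (f x) powr p + norm (g x) powr p)"
        using powr_sum_le_weighted[OF p, of 1 1 "norm (f x)" "norm (g x)"] by simp
      finally show "norm (norm (f x + g x) powr p)
       \<le> norm (2 powr (p - 1) * (norm (f x) powr p + norm (g x) powr p))" by simp
    qed
  qed measurable
  then show ?thesis by (simp add: Lp_def)
qed

lemma Lp_diff:
  fixes f g :: "real^'n \<Rightarrow> 'b::euclidean_space"
  assumes p: "p \<ge> 1" and f: "f \<in> Lp \<Omega> p" and g: "g \<in> Lp \<Omega> p"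
  shows "(\<lambda>x. f x - g x) \<in> Lp \<Omega> p"
  using Lp_add[OF p f Lp_scaleR[OF g, of "-1"]] by simp

text \<open>Scaling arguments divide by norms, which may vanish. They are carried out with \<open>\<parallel>f\<parallel> + e\<close> in place of \<open>\<parallel>f\<parallel>\<close>, and
  this lemma lets \<open>e\<close> tend to zero.\<close>

lemma le_at_zero_if_le_pos:
  fixes F :: "real \<Rightarrow> real"
  assumes "continuous_on UNIV F" "\<And>e. e > 0 \<Longrightarrow> X \<le> F e"
  shows "X \<le> F 0"
proof (rule tendsto_lowerbound)
  show "(F \<longlongrightarrow> F 0) (at_right 0)"
    using assms(1) by (simp add: continuous_on_eq_continuous_at continuous_within_subset isCont_def 
        filterlim_at_split)
  show "\<forall>\<^sub>F x in at_right 0. X \<le> F x"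
    using assms(2) by (simp add: eventually_at_right_less eventually_at_filter)
qed simp

theorem Lp_norm_triangle:
  fixes f g :: "real^'n \<Rightarrow> 'b::euclidean_space"
  assumes p: "p \<ge> 1" and f: "f \<in> Lp \<Omega> p" and g: "g \<in> Lp \<Omega> p"
  shows "Lp_norm \<Omega> p (\<lambda>x. f x + g x) \<le> Lp_norm \<Omega> p f + Lp_norm \<Omega> p g"
proof -
  let ?M = "lebesgue_on \<Omega>"
  note [measurable] = Lp_measurable[OF f] Lp_measurable[OF g]
  have "Lp_norm \<Omega> p (\<lambda>x. f x + g x) \<le> (Lp_norm \<Omega> p f + e) + (Lp_norm \<Omega> p g + e)" if "e > 0" for e
  proof -
    define a where "a = Lp_norm \<Omega> p f + e"
    define b where "b = Lp_norm \<Omega> p g + e"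
    have ab: "a > 0" "b > 0" using that by (auto simp: a_def b_def add_nonneg_pos)
    have fa: "(LINT x|?M. norm (f x) powr p) \<le> a powr p"
      unfolding Lp_norm_powr[symmetric, OF order.strict_trans2[OF zero_less_one p]]
      using p that by (intro powr_mono2) (auto simp: a_def)
    have gb: "(LINT x|?M. norm (g x) powr p) \<le> b powr p"
      unfolding Lp_norm_powr[symmetric, OF order.strict_trans2[OF zero_less_one p]]
      using p that by (intro powr_mono2) (auto simp: b_def)
    have "(LINT x|?M. norm (f x + g x) powr p) \<le>
          (LINT x|?M. (a + b) powr (p - 1) * (a powr (1 - p) * norm (f x) powr p + b powr (1 - p) * norm (g x) powr p))"
    proof (rule integral_mono)
      show "integrable ?M (\<lambda>x. norm (f x + g x) powr p)"
        using Lp_add[OF p f g] by (rule Lp_integrable_powr)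
      show "integrable ?M (\<lambda>x. (a + b) powr (p - 1) * (a powr (1 - p) * norm (f x) powr p + b powr (1 - p) * norm (g x) powr p))"
        using Lp_integrable_powr[OF f] Lp_integrable_powr[OF g] by simp
      fix x
      have "norm (f x + g x) powr p \<le> (norm (f x) + norm (g x)) powr p"
        using p by (intro powr_mono2 norm_triangle_ineq) auto
      also have "\<dots> \<le> (a + b) powr (p - 1) * (a powr (1 - p) * norm (f x) powr p + b powr (1 - p) * norm (g x) powr p)"
        using ab by (intro powr_sum_le_weighted[OF p]) auto
      finally show "norm (f x + g x) powr p \<le> \<dots>" .
    qed
    also have "\<dots> = (a + b) powr (p - 1) * (a powr (1 - p) * (LINT x|?M. norm (f x) powr p)
                     + b powr (1 - p) * (LINT x|?M. norm (g x) powr p))"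
      using Lp_integrable_powr[OF f] Lp_integrable_powr[OF g] by simp
    also have "\<dots> \<le> (a + b) powr (p - 1) * (a powr (1 - p) * a powr p + b powr (1 - p) * b powr p)"
      using fa gb by (intro mult_left_mono add_mono) auto
    also have "\<dots> = (a + b) powr p"
      using ab by (simp add: powr_add[symmetric]) (simp add: powr_diff)
    finally have "Lp_norm \<Omega> p (\<lambda>x. f x + g x) powr p \<le> (a + b) powr p"
      using p by (simp add: Lp_norm_powr)
    then have "Lp_norm \<Omega> p (\<lambda>x. f x + g x) \<le> a + b"
      using p ab by (smt (verit) Lp_norm_nonneg powr_less_mono2)
    then show ?thesis by (simp add: a_def b_def)
  qed
  from le_at_zero_if_le_pos[of "\<lambda>e. (Lp_norm \<Omega> p f + e) + (Lp_norm \<Omega> p g + e)", OF _ this] show ?thesis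
    by (simp add: continuous_intros)
qed

lemma Lp_norm_diff_le:
  fixes f g :: "real^'n \<Rightarrow> 'b::euclidean_space"
  assumes p: "p \<ge> 1" and f: "f \<in> Lp \<Omega> p" and g: "g \<in> Lp \<Omega> p"
  shows "\<bar>Lp_norm \<Omega> p f - Lp_norm \<Omega> p g\<bar> \<le> Lp_norm \<Omega> p (\<lambda>x. f x - g x)"
  using Lp_norm_triangle[OF p Lp_diff[OF p f g] g] Lp_norm_triangle[OF p Lp_diff[OF p g f] f]
  by (simp add: Lp_norm_minus_commute[of \<Omega> p f g])

lemma Lp_norm_diff_triangle:
  fixes f g :: "real^'n \<Rightarrow> 'b::euclidean_space"
  assumes p: "p \<ge> 1" and f: "f \<in> Lp \<Omega> p" and g: "g \<in> Lp \<Omega> p"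
  shows "Lp_norm \<Omega> p (\<lambda>x. f x - g x) \<le> Lp_norm \<Omega> p f + Lp_norm \<Omega> p g"
  using Lp_norm_triangle[OF p f Lp_scaleR[OF g, of "-1"]] p
  by (simp add: Lp_norm_uminus)

lemma young3: "(x::real) \<ge> 0 \<Longrightarrow> y \<ge> 0 \<Longrightarrow> z \<ge> 0 \<Longrightarrow> x * y * z \<le> (x^3 + y^3 + z^3) / 3"
proof -
  assume "x \<ge> 0" "y \<ge> 0" "z \<ge> 0"
  then have "0 \<le> (x + y + z) * ((x - y)\<^sup>2 + (y - z)\<^sup>2 + (z - x)\<^sup>2) / 2" by simp
  also have "\<dots> = x^3 + y^3 + z^3 - 3 * x * y * z"
    by (simp add: power2_eq_square power3_eq_cube field_simps)
  finally show ?thesis by simp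
qed

text \<open>Normalise the three factors in \<open>L\<^sup>3\<close> and integrate Young's inequality (Hoelder's inequality). A function \<open>F\<close> dominated by
  the product of the norms, rather than the product itself, covers matrix-vector products and inner products alike.\<close>

lemma holder3:
  fixes f :: "real^'n \<Rightarrow> 'a::euclidean_space" and g :: "real^'n \<Rightarrow> 'b::euclidean_space"
    and h :: "real^'n \<Rightarrow> 'c::euclidean_space" and F :: "real^'n \<Rightarrow> real"
  assumes f: "f \<in> Lp \<Omega> 3" and g: "g \<in> Lp \<Omega> 3" and h: "h \<in> Lp \<Omega> 3"
    and F: "F \<in> borel_measurable (lebesgue_on \<Omega>)"
    and le: "\<And>x. \<bar>F x\<bar> \<le> norm (f x) * norm (g x) * norm (h x)"
  shows "integrable (lebesgue_on \<Omega>) F"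
    and "\<bar>LINT x|lebesgue_on \<Omega>. F x\<bar> \<le> Lp_norm \<Omega> 3 f * Lp_norm \<Omega> 3 g * Lp_norm \<Omega> 3 h"
proof -
  let ?M = "lebesgue_on \<Omega>"
  note int = Lp3_integrable[OF f] Lp3_integrable[OF g] Lp3_integrable[OF h]
  have bd: "\<bar>F x\<bar> \<le> a * b * c / 3 * (norm (f x) ^ 3 / a ^ 3 + norm (g x) ^ 3 / b ^ 3 + norm (h x) ^ 3 / c ^ 3)"
    if "a > 0" "b > 0" "c > 0" for a b c x
  proof -
    have "norm (f x) * norm (g x) * norm (h x) = a * b * c * (norm (f x) / a * (norm (g x) / b) * (norm (h x) / c))"
      using that by simp
    also have "\<dots> \<le> a * b * c * (((norm (f x) / a) ^ 3 + (norm (g x) / b) ^ 3 + (norm (h x) / c) ^ 3) / 3)"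
      using that by (intro mult_left_mono young3) auto
    finally show ?thesis using le[of x] by (simp add: power_divide)
  qed
  show iF: "integrable ?M F"
  proof (rule Bochner_Integration.integrable_bound[OF _ F])
    show "integrable ?M (\<lambda>x. (norm (f x) ^ 3 + norm (g x) ^ 3 + norm (h x) ^ 3) / 3)"
      using int by simp
    show "AE x in ?M. norm (F x) \<le> norm ((norm (f x) ^ 3 + norm (g x) ^ 3 + norm (h x) ^ 3) / 3)"
      using bd[of 1 1 1] by (intro AE_I2) auto
  qed
  have "\<bar>LINT x|?M. F x\<bar> \<le> (Lp_norm \<Omega> 3 f + e) * (Lp_norm \<Omega> 3 g + e) * (Lp_norm \<Omega> 3 h + e)"
    if e: "e > 0" for e
  proof -
    define a where "a = Lp_norm \<Omega> 3 f + e"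
    define b where "b = Lp_norm \<Omega> 3 g + e"
    define c where "c = Lp_norm \<Omega> 3 h + e"
    have pos: "a > 0" "b > 0" "c > 0"
      using e by (auto simp: a_def b_def c_def add_nonneg_pos)
    have A: "(LINT x|?M. norm (f x) ^ 3) \<le> a ^ 3" "(LINT x|?M. norm (g x) ^ 3) \<le> b ^ 3"
      "(LINT x|?M. norm (h x) ^ 3) \<le> c ^ 3"
      unfolding Lp_norm_power3[symmetric] a_def b_def c_def
      using e by (auto intro!: power_mono)
    have "\<bar>LINT x|?M. F x\<bar> \<le> (LINT x|?M. \<bar>F x\<bar>)"
      by (rule integral_abs_bound)
    also have "\<dots> \<le> (LINT x|?M. a * b * c / 3 * (norm (f x) ^ 3 / a ^ 3 + norm (g x) ^ 3 / b ^ 3 + norm (h x) ^ 3 / c ^ 3))"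
      using int iF bd pos by (intro integral_mono) auto
    also have "\<dots> = a * b * c / 3 * ((LINT x|?M. norm (f x) ^ 3) / a ^ 3 + (LINT x|?M. norm (g x) ^ 3) / b ^ 3 + (LINT x|?M. norm (h x) ^ 3) / c ^ 3)"
      using int by simp
    also have "\<dots> \<le> a * b * c / 3 * (1 + 1 + 1)"
      using A pos by (intro mult_left_mono add_mono) auto
    finally show ?thesis by (simp add: a_def b_def c_def)
  qed
  from le_at_zero_if_le_pos[of "\<lambda>e. (Lp_norm \<Omega> 3 f + e) * (Lp_norm \<Omega> 3 g + e) * (Lp_norm \<Omega> 3 h + e)", OF _ this]
  show "\<bar>LINT x|?M. F x\<bar> \<le> Lp_norm \<Omega> 3 f * Lp_norm \<Omega> 3 g * Lp_norm \<Omega> 3 h"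
    by (simp add: continuous_intros)
qed

lemma holder2:
  fixes f :: "real^'n \<Rightarrow> 'a::euclidean_space" and g :: "real^'n \<Rightarrow> 'b::euclidean_space"
    and F :: "real^'n \<Rightarrow> real"
  assumes f: "f \<in> Lp \<Omega> 2" and g: "g \<in> Lp \<Omega> 2"
    and F: "F \<in> borel_measurable (lebesgue_on \<Omega>)"
    and le: "\<And>x. \<bar>F x\<bar> \<le> norm (f x) * norm (g x)"
  shows "integrable (lebesgue_on \<Omega>) F"
    and "\<bar>LINT x|lebesgue_on \<Omega>. F x\<bar> \<le> Lp_norm \<Omega> 2 f * Lp_norm \<Omega> 2 g"
proof -
  let ?M = "lebesgue_on \<Omega>"
  note int = Lp2_integrable[OF f] Lp2_integrable[OF g]
  have bd: "\<bar>F x\<bar> \<le> a * b / 2 * ((norm (f x))\<^sup>2 / a\<^sup>2 + (norm (g x))\<^sup>2 / b\<^sup>2)"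
    if "a > 0" "b > 0" for a b x
  proof -
    have "norm (f x) * norm (g x) = a * b / 2 * (2 * (norm (f x) / a) * (norm (g x) / b))"
      using that by simp
    also have "\<dots> \<le> a * b / 2 * ((norm (f x) / a)\<^sup>2 + (norm (g x) / b)\<^sup>2)"
      using that by (intro mult_left_mono sum_squares_bound) auto
    finally show ?thesis using le[of x] by (simp add: power_divide)
  qed
  show iF: "integrable ?M F"
  proof (rule Bochner_Integration.integrable_bound[OF _ F])
    show "integrable ?M (\<lambda>x. ((norm (f x))\<^sup>2 + (norm (g x))\<^sup>2) / 2)"
      using int by simp
    show "AE x in ?M. norm (F x) \<le> norm (((norm (f x))\<^sup>2 + (norm (g x))\<^sup>2) / 2)"
      using bd[of 1 1] by (intro AE_I2) auto
  qed
  have "\<bar>LINT x|?M. F x\<bar> \<le> (Lp_norm \<Omega> 2 f + e) * (Lp_norm \<Omega> 2 g + e)"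
    if e: "e > 0" for e
  proof -
    define a where "a = Lp_norm \<Omega> 2 f + e"
    define b where "b = Lp_norm \<Omega> 2 g + e"
    have pos: "a > 0" "b > 0"
      using e by (auto simp: a_def b_def add_nonneg_pos)
    have A: "(LINT x|?M. (norm (f x))\<^sup>2) \<le> a\<^sup>2" "(LINT x|?M. (norm (g x))\<^sup>2) \<le> b\<^sup>2"
      unfolding Lp_norm_power2[symmetric] a_def b_def
      using e by (auto intro!: power_mono)
    have "\<bar>LINT x|?M. F x\<bar> \<le> (LINT x|?M. \<bar>F x\<bar>)"
      by (rule integral_abs_bound)
    also have "\<dots> \<le> (LINT x|?M. a * b / 2 * ((norm (f x))\<^sup>2 / a\<^sup>2 + (norm (g x))\<^sup>2 / b\<^sup>2))"
      using int iF bd pos by (intro integral_mono) auto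
    also have "\<dots> = a * b / 2 * ((LINT x|?M. (norm (f x))\<^sup>2) / a\<^sup>2 + (LINT x|?M. (norm (g x))\<^sup>2) / b\<^sup>2)"
      using int by simp
    also have "\<dots> \<le> a * b / 2 * (1 + 1)"
      using A pos by (intro mult_left_mono add_mono) auto
    finally show ?thesis by (simp add: a_def b_def)
  qed
  from le_at_zero_if_le_pos[of "\<lambda>e. (Lp_norm \<Omega> 2 f + e) * (Lp_norm \<Omega> 2 g + e)", OF _ this]
  show "\<bar>LINT x|?M. F x\<bar> \<le> Lp_norm \<Omega> 2 f * Lp_norm \<Omega> 2 g"
    by (simp add: continuous_intros)
qed

lemma L2_inner_integrable:
  assumes "f \<in> Lp \<Omega> 2" "g \<in> Lp \<Omega> 2"
  shows "integrable (lebesgue_on \<Omega>) (\<lambda>x. f x \<bullet> g x)"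
  using assms Lp_measurable[OF assms(1)] Lp_measurable[OF assms(2)]
  by (intro holder2(1)[OF assms]) (auto simp: Cauchy_Schwarz_ineq2)

lemma L2_inner_le:
  assumes "f \<in> Lp \<Omega> 2" "g \<in> Lp \<Omega> 2"
  shows "\<bar>L2_inner \<Omega> f g\<bar> \<le> Lp_norm \<Omega> 2 f * Lp_norm \<Omega> 2 g"
  unfolding L2_inner_def
  using assms Lp_measurable[OF assms(1)] Lp_measurable[OF assms(2)]
  by (intro holder2(2)[OF assms]) (auto simp: Cauchy_Schwarz_ineq2)

lemma L2_inner_diff_right:
  assumes "f \<in> Lp \<Omega> 2" "g \<in> Lp \<Omega> 2" "h \<in> Lp \<Omega> 2"
  shows "L2_inner \<Omega> f (\<lambda>x. g x - h x) = L2_inner \<Omega> f g - L2_inner \<Omega> f h"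
  unfolding L2_inner_def
  using L2_inner_integrable[OF assms(1,2)] L2_inner_integrable[OF assms(1,3)]
  by (simp add: inner_diff_right)

lemma L2_inner_commute: "L2_inner \<Omega> f g = L2_inner \<Omega> g f"
  by (simp add: L2_inner_def inner_commute)

lemma L2_inner_diff_left:
  assumes "f \<in> Lp \<Omega> 2" "g \<in> Lp \<Omega> 2" "h \<in> Lp \<Omega> 2"
  shows "L2_inner \<Omega> (\<lambda>x. g x - h x) f = L2_inner \<Omega> g f - L2_inner \<Omega> h f"
  using L2_inner_diff_right[OF assms] by (simp add: L2_inner_commute)

lemma L2_inner_self: "L2_inner \<Omega> f f = (Lp_norm \<Omega> 2 f)\<^sup>2"
  by (simp add: L2_inner_def Lp_norm_power2 power2_norm_eq_inner)

lemma L2_inner_cong_AE: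
  assumes "f \<in> borel_measurable (lebesgue_on \<Omega>)" "f' \<in> borel_measurable (lebesgue_on \<Omega>)"
    "g \<in> borel_measurable (lebesgue_on \<Omega>)" "g' \<in> borel_measurable (lebesgue_on \<Omega>)"
    "AE x in lebesgue_on \<Omega>. f x = f' x" "AE x in lebesgue_on \<Omega>. g x = g' x"
  shows "L2_inner \<Omega> f g = L2_inner \<Omega> f' g'"
  unfolding L2_inner_def using assms by (intro integral_cong_AE) auto

text \<open>Splitting at the level \<open>\<bar>f\<bar> = \<lambda>\<close> gives \<open>\<bar>f\<bar>\<^sup>p \<le> \<lambda>\<^sup>p + \<lambda>\<^sup>p\<^sup>-\<^sup>q \<bar>f\<bar>\<^sup>q\<close>; with \<open>\<lambda>\<close> close to the \<open>L\<^sup>q\<close> norm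
  this is the inclusion of \<open>L\<^sup>q\<close> in \<open>L\<^sup>p\<close> on a domain of finite measure.\<close>

lemma powr_split_le:
  fixes s l p q :: real
  assumes "0 < p" "p \<le> q" "l > 0" "s \<ge> 0"
  shows "s powr p \<le> l powr p + l powr (p - q) * s powr q"
proof (cases "s \<le> l")
  case True
  then have "s powr p \<le> l powr p" using assms by (intro powr_mono2) auto
  then show ?thesis using assms by (simp add: add_increasing2)
next
  case False
  then have "s powr p = s powr (p - q) * s powr q"
    using assms by (simp add: powr_add[symmetric])
  also have "\<dots> \<le> l powr (p - q) * s powr q"
    using False assms by (intro mult_right_mono powr_mono2') auto
  finally show ?thesis using assms by (simp add: add_increasing)
qed

lemma Lp3_imp_Lp2:
  fixes f :: "real^'n \<Rightarrow> 'a::euclidean_space"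
  assumes \<Omega>: "\<Omega> \<in> lmeasurable" and f: "f \<in> Lp \<Omega> 3"
  shows "f \<in> Lp \<Omega> 2"
    and "Lp_norm \<Omega> 2 f \<le> sqrt (measure lebesgue \<Omega> + 1) * Lp_norm \<Omega> 3 f"
proof -
  let ?M = "lebesgue_on \<Omega>"
  interpret finite_measure ?M
    using \<Omega> by (rule finite_measure_lebesgue_on)
  have fin: "integrable ?M (\<lambda>x. c)" for c :: real
    by simp
  have M1: "(LINT x|?M. c) = c * measure lebesgue \<Omega>" for c :: real
    using \<Omega> by (simp add: measure_restrict_space)
  have bd: "(norm (f x))\<^sup>2 \<le> l\<^sup>2 + norm (f x) ^ 3 / l" if "l > 0" for l x
    using powr_split_le[of 2 3 l "norm (f x)"] that by (simp add: powr_minus_divide)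
  show f2: "f \<in> Lp \<Omega> 2"
  proof (rule Lp2I)
    show "integrable ?M (\<lambda>x. (norm (f x))\<^sup>2)"
    proof (rule Bochner_Integration.integrable_bound)
      show "integrable ?M (\<lambda>x. 1 + norm (f x) ^ 3)"
        using fin Lp3_integrable[OF f] by (rule Bochner_Integration.integrable_add)
      show "AE x in ?M. norm ((norm (f x))\<^sup>2) \<le> norm (1 + norm (f x) ^ 3)"
        using bd[of 1] by (intro AE_I2) auto
    qed (use Lp_measurable[OF f] in auto)
  qed (use Lp_measurable[OF f] in auto)
  have "(Lp_norm \<Omega> 2 f)\<^sup>2 \<le> (measure lebesgue \<Omega> + 1) * (Lp_norm \<Omega> 3 f + e)\<^sup>2" if e: "e > 0" for e
  proof -
    define l where "l = Lp_norm \<Omega> 3 f + e"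
    have l: "l > 0" using e by (simp add: l_def add_nonneg_pos)
    have A: "(LINT x|?M. norm (f x) ^ 3) \<le> l ^ 3"
      unfolding Lp_norm_power3[symmetric] l_def using e by (auto intro!: power_mono)
    have "(Lp_norm \<Omega> 2 f)\<^sup>2 \<le> (LINT x|?M. l\<^sup>2 + norm (f x) ^ 3 / l)"
      unfolding Lp_norm_power2 
      using Lp2_integrable[OF f2] fin Lp3_integrable[OF f] bd[OF l] by (intro integral_mono) auto
    also have "\<dots> = l\<^sup>2 * measure lebesgue \<Omega> + (LINT x|?M. norm (f x) ^ 3) / l"
      using fin[of "l\<^sup>2"] Lp3_integrable[OF f] M1 by simp
    also have "\<dots> \<le> l\<^sup>2 * measure lebesgue \<Omega> + l ^ 3 / l"
      using A l by (intro add_left_mono divide_right_mono) auto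
    also have "\<dots> = (measure lebesgue \<Omega> + 1) * l\<^sup>2"
      using l by (simp add: field_simps power2_eq_square power3_eq_cube)
    finally show ?thesis by (simp add: l_def)
  qed
  from le_at_zero_if_le_pos[of "\<lambda>e. (measure lebesgue \<Omega> + 1) * (Lp_norm \<Omega> 3 f + e)\<^sup>2", OF _ this]
  have "(Lp_norm \<Omega> 2 f)\<^sup>2 \<le> (measure lebesgue \<Omega> + 1) * (Lp_norm \<Omega> 3 f)\<^sup>2"
    by (simp add: continuous_intros)
  also have "\<dots> = (sqrt (measure lebesgue \<Omega> + 1) * Lp_norm \<Omega> 3 f)\<^sup>2"
    by (simp add: power_mult_distrib)
  finally show "Lp_norm \<Omega> 2 f \<le> sqrt (measure lebesgue \<Omega> + 1) * Lp_norm \<Omega> 3 f"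
    by (rule power2_le_imp_le) simp
qed

section \<open>Continuously differentiable functions with compact support\<close>

definition C1_fun :: "('a::real_normed_vector \<Rightarrow> 'b::real_normed_vector) \<Rightarrow> bool" where
  "C1_fun \<psi> \<longleftrightarrow> (\<forall>x. \<psi> differentiable (at x)) \<and>
               (\<forall>h. continuous_on UNIV (\<lambda>x. frechet_derivative \<psi> (at x) h))"

lemma C1c_iff:
  "\<psi> \<in> C1c \<Omega> \<longleftrightarrow> C1_fun \<psi> \<and> compact (closure {x. \<psi> x \<noteq> 0}) \<and> closure {x. \<psi> x \<noteq> 0} \<subseteq> \<Omega>"
  by (auto simp: C1c_def C1_fun_def)

lemma C1_funI:
  assumes "\<And>x. (\<psi> has_derivative D x) (at x)" "\<And>h. continuous_on UNIV (\<lambda>x. D x h)"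
  shows "C1_fun \<psi>"
proof -
  have "frechet_derivative \<psi> (at x) = D x" for x
    using frechet_derivative_at[OF assms(1)] by simp
  then show ?thesis
    using assms by (auto simp: C1_fun_def differentiable_def)
qed

lemma C1_fun_has_derivative: "C1_fun \<psi> \<Longrightarrow> (\<psi> has_derivative frechet_derivative \<psi> (at x)) (at x)"
  by (auto simp: C1_fun_def frechet_derivative_works)

lemma C1_fun_continuous_deriv: "C1_fun \<psi> \<Longrightarrow> continuous_on S (\<lambda>x. frechet_derivative \<psi> (at x) h)"
  by (auto simp: C1_fun_def intro: continuous_on_subset)

lemma C1_fun_continuous: "C1_fun \<psi> \<Longrightarrow> continuous_on S \<psi>"
  using C1_fun_has_derivative[of \<psi>]
  by (meson continuous_at_imp_continuous_on has_derivative_continuous)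

lemma C1_fun_has_derivative_line:
  fixes F :: "'a::real_normed_vector \<Rightarrow> real"
  assumes F: "C1_fun F"
  shows "((\<lambda>s. F (x + s *\<^sub>R e)) has_real_derivative frechet_derivative F (at (x + s *\<^sub>R e)) e) (at s)"
proof -
  have "((\<lambda>s. x + s *\<^sub>R e) has_derivative (\<lambda>h. h *\<^sub>R e)) (at s)"
    by (auto intro!: derivative_eq_intros)
  from has_derivative_compose[OF this C1_fun_has_derivative[OF F]]
  have "((\<lambda>s. F (x + s *\<^sub>R e)) has_derivative (\<lambda>h. frechet_derivative F (at (x + s *\<^sub>R e)) (h *\<^sub>R e))) (at s)" .
  moreover have "frechet_derivative F (at (x + s *\<^sub>R e)) (h *\<^sub>R e) = frechet_derivative F (at (x + s *\<^sub>R e)) e * h" for h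
    using C1_fun_has_derivative[OF F, of "x + s *\<^sub>R e"]
    by (simp add: has_derivative_bounded_linear linear_simps)
  ultimately show ?thesis by (simp add: has_field_derivative_def)
qed

lemma C1_fun_const: "C1_fun (\<lambda>x. c)"
  by (rule C1_funI[where D="\<lambda>x h. 0"]) auto

lemma C1_fun_bounded_linear: "bounded_linear f \<Longrightarrow> C1_fun f"
  by (rule C1_funI[where D="\<lambda>x. f"]) (auto intro: bounded_linear_imp_has_derivative)

lemma C1_fun_add: "C1_fun f \<Longrightarrow> C1_fun g \<Longrightarrow> C1_fun (\<lambda>x. f x + g x)"
  by (rule C1_funI[where D="\<lambda>x h. frechet_derivative f (at x) h + frechet_derivative g (at x) h"])
    (auto intro!: continuous_intros has_derivative_add C1_fun_has_derivative C1_fun_continuous_deriv)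

lemma has_derivative_C1_mult:
  fixes f g :: "'a::real_normed_vector \<Rightarrow> real"
  assumes "C1_fun f" "C1_fun g"
  shows "((\<lambda>x. f x * g x) has_derivative
    (\<lambda>h. f x * frechet_derivative g (at x) h + frechet_derivative f (at x) h * g x)) (at x)"
  by (intro has_derivative_mult C1_fun_has_derivative assms)

lemma frechet_derivative_C1_mult:
  fixes f g :: "'a::real_normed_vector \<Rightarrow> real"
  assumes "C1_fun f" "C1_fun g"
  shows "frechet_derivative (\<lambda>x. f x * g x) (at x) h
    = f x * frechet_derivative g (at x) h + frechet_derivative f (at x) h * g x"
  using frechet_derivative_at[OF has_derivative_C1_mult[OF assms]] by metis

lemma C1_fun_mult:
  fixes f g :: "'a::real_normed_vector \<Rightarrow> real"
  assumes "C1_fun f" "C1_fun g"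
  shows "C1_fun (\<lambda>x. f x * g x)"
  by (rule C1_funI[OF has_derivative_C1_mult[OF assms] continuous_on_add[OF
      continuous_on_mult[OF C1_fun_continuous[OF assms(1)] C1_fun_continuous_deriv[OF assms(2)]]
      continuous_on_mult[OF C1_fun_continuous_deriv[OF assms(1)] C1_fun_continuous[OF assms(2)]]]])

lemma C1_fun_bounded_linear_compose:
  assumes "bounded_linear L" "C1_fun f"
  shows "C1_fun (\<lambda>x. L (f x))"
    and "frechet_derivative (\<lambda>x. L (f x)) (at x) h = L (frechet_derivative f (at x) h)"
proof -
  have D: "((\<lambda>x. L (f x)) has_derivative (\<lambda>h. L (frechet_derivative f (at x) h))) (at x)" for x
    by (rule bounded_linear.has_derivative[OF assms(1) C1_fun_has_derivative[OF assms(2)]])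
  show "C1_fun (\<lambda>x. L (f x))"
    using assms by (intro C1_funI[OF D] bounded_linear.continuous_on[OF assms(1)] C1_fun_continuous_deriv)
  show "frechet_derivative (\<lambda>x. L (f x)) (at x) h = L (frechet_derivative f (at x) h)"
    using frechet_derivative_at[OF D] by metis
qed

lemma C1_fun_real_compose:
  fixes g :: "'a::real_normed_vector \<Rightarrow> real" and m :: "real \<Rightarrow> real"
  assumes g: "C1_fun g" and m: "\<And>s. (m has_real_derivative m' s) (at s)" and m': "continuous_on UNIV m'"
  shows "C1_fun (\<lambda>x. m (g x))"
proof (rule C1_funI)
  show "((\<lambda>x. m (g x)) has_derivative (\<lambda>h. frechet_derivative g (at x) h * m' (g x))) (at x)" for x
    using has_derivative_compose[OF C1_fun_has_derivative[OF g] m[of "g x", unfolded has_field_derivative_def]]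
    by (simp add: mult.commute)
  show "continuous_on UNIV (\<lambda>x. frechet_derivative g (at x) h * m' (g x))" for h
    by (intro continuous_intros C1_fun_continuous_deriv[OF g]
        continuous_on_compose2[OF m' C1_fun_continuous[OF g]]) auto
qed

lemma C1_fun_inner:
  fixes f g :: "'a::real_normed_vector \<Rightarrow> 'b::real_inner"
  assumes f: "C1_fun f" and g: "C1_fun g"
  shows "C1_fun (\<lambda>x. f x \<bullet> g x)"
    and "frechet_derivative (\<lambda>x. f x \<bullet> g x) (at x) h
      = f x \<bullet> frechet_derivative g (at x) h + frechet_derivative f (at x) h \<bullet> g x"
proof -
  have D: "((\<lambda>x. f x \<bullet> g x) has_derivative
    (\<lambda>h. f x \<bullet> frechet_derivative g (at x) h + frechet_derivative f (at x) h \<bullet> g x)) (at x)" for x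
    by (intro has_derivative_inner C1_fun_has_derivative assms)
  show "C1_fun (\<lambda>x. f x \<bullet> g x)"
    by (rule C1_funI[OF D continuous_on_add[OF continuous_on_inner[OF C1_fun_continuous[OF f] C1_fun_continuous_deriv[OF g]]
          continuous_on_inner[OF C1_fun_continuous_deriv[OF f] C1_fun_continuous[OF g]]]])
  show "frechet_derivative (\<lambda>x. f x \<bullet> g x) (at x) h
      = f x \<bullet> frechet_derivative g (at x) h + frechet_derivative f (at x) h \<bullet> g x"
    using frechet_derivative_at[OF D] by metis
qed

lemma C1_fun_real_polynomial_function:
  "real_polynomial_function p \<Longrightarrow> C1_fun p"
  by (induction rule: real_polynomial_function.induct)
    (auto intro: C1_fun_bounded_linear C1_fun_const C1_fun_add C1_fun_mult)

lemma C1c_smaller_support: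
  assumes "C1_fun f" "\<And>x. g x = 0 \<Longrightarrow> f x = 0" "g \<in> C1c \<Omega>"
  shows "f \<in> C1c \<Omega>"
proof -
  have sub: "closure {x. f x \<noteq> 0} \<subseteq> closure {x. g x \<noteq> 0}"
    using assms(2) by (intro closure_mono) auto
  then have "compact (closure {x. f x \<noteq> 0})"
    using assms(3) unfolding C1c_iff
    by (meson bounded_subset closed_closure compact_eq_bounded_closed)
  with sub assms show ?thesis by (auto simp: C1c_iff)
qed

lemma C1c_mult_left:
  fixes f g :: "real^'n \<Rightarrow> real"
  assumes "f \<in> C1c \<Omega>" "C1_fun g" shows "(\<lambda>x. f x * g x) \<in> C1c \<Omega>"
proof (rule C1c_smaller_support[OF _ _ assms(1)])
  show "C1_fun (\<lambda>x. f x * g x)"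
    using assms by (intro C1_fun_mult) (simp_all add: C1c_iff)
qed simp

lemma C1c_mono: "f \<in> C1c \<Omega> \<Longrightarrow> \<Omega> \<subseteq> \<Omega>' \<Longrightarrow> f \<in> C1c \<Omega>'"
  by (auto simp: C1c_iff)

lemma C1c_component:
  fixes f :: "real^'n \<Rightarrow> 'b::real_normed_vector"
  assumes "f \<in> C1c \<Omega>" "bounded_linear L" shows "(\<lambda>x. L (f x)) \<in> C1c \<Omega>"
proof (rule C1c_smaller_support[OF _ _ assms(1)])
  show "C1_fun (\<lambda>x. L (f x))"
    using assms by (simp add: C1c_iff C1_fun_bounded_linear_compose(1))
qed (simp add: linear_0[OF bounded_linear.linear[OF assms(2)]])

lemma C1c_zero_outside:
  assumes "f \<in> C1c \<Omega>" "x \<notin> closure {x. f x \<noteq> 0}"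
  shows "f x = 0" "frechet_derivative f (at x) h = 0"
proof -
  show "f x = 0" using assms(2) closure_subset[of "{x. f x \<noteq> 0}"] by auto
  have "(f has_derivative (\<lambda>h. 0)) (at x)"
    by (rule has_derivative_transform_within_open[of "\<lambda>x. 0" _ _ _ "- closure {x. f x \<noteq> 0}"])
      (use assms(2) closure_subset[of "{x. f x \<noteq> 0}"] in auto)
  from frechet_derivative_at[OF this] show "frechet_derivative f (at x) h = 0" by metis
qed

lemma C1c_diff:
  fixes f g :: "real^'n \<Rightarrow> 'b::real_normed_vector"
  assumes "f \<in> C1c \<Omega>" "g \<in> C1c \<Omega>" shows "(\<lambda>x. f x - g x) \<in> C1c \<Omega>"
proof -
  have C1: "C1_fun (\<lambda>x. f x + (-1) *\<^sub>R g x)"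
    using assms
    by (intro C1_fun_add C1_fun_bounded_linear_compose(1)[OF bounded_linear_scaleR_right])
      (simp_all add: C1c_iff)
  have sub: "closure {x. f x - g x \<noteq> 0} \<subseteq> closure {x. f x \<noteq> 0} \<union> closure {x. g x \<noteq> 0}"
    unfolding closure_Un[symmetric] by (intro closure_mono) auto
  moreover have "compact (closure {x. f x \<noteq> 0} \<union> closure {x. g x \<noteq> 0})"
    using assms by (auto simp: C1c_iff)
  ultimately have "compact (closure {x. f x - g x \<noteq> 0})"
    by (meson bounded_subset closed_closure compact_eq_bounded_closed)
  moreover have "closure {x. f x - g x \<noteq> 0} \<subseteq> \<Omega>"
    using sub assms unfolding C1c_iff by blast
  ultimately show ?thesis using C1 unfolding C1c_iff by simp
qed

lemma integrable_continuous_compact_support: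
  fixes f :: "'a::euclidean_space \<Rightarrow> real"
  assumes "continuous_on UNIV f" "compact K" "\<And>x. x \<notin> K \<Longrightarrow> f x = 0"
  shows "integrable lborel f"
proof -
  have "integrable lborel (\<lambda>x. indicator K x *\<^sub>R f x)"
    using assms by (intro borel_integrable_compact) (auto intro: continuous_on_subset)
  moreover have "(\<lambda>x. indicator K x *\<^sub>R f x) = f"
    using assms(3) by (auto simp: fun_eq_iff indicator_def)
  ultimately show ?thesis by simp
qed

lemma bounded_continuous_compact_support:
  fixes f :: "'a::euclidean_space \<Rightarrow> 'b::real_normed_vector"
  assumes "continuous_on UNIV f" "compact K" "\<And>x. x \<notin> K \<Longrightarrow> f x = 0"
  obtains B where "B > 0" "\<And>x. norm (f x) \<le> B"
proof -
  have "bounded (f ` K)"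
    using assms by (intro compact_imp_bounded compact_continuous_image) (auto intro: continuous_on_subset)
  then obtain B where "B > 0" "\<forall>x\<in>K. norm (f x) \<le> B"
    by (auto simp: bounded_pos)
  then show ?thesis using assms(3) by (intro that[of B]) (metis norm_zero less_imp_le)+
qed

text \<open>Translation invariance of Lebesgue measure makes the integral of every difference quotient
  vanish; the quotients are bounded by the mean value theorem and live in a fixed ball.\<close>

lemma integral_directional_derivative_eq_0:
  fixes F :: "real^'n \<Rightarrow> real"
  assumes F: "F \<in> C1c UNIV"
  shows "(LINT x|lborel. frechet_derivative F (at x) e) = 0"
proof -
  define K where "K = closure {x. F x \<noteq> 0}"
  define D where "D x = frechet_derivative F (at x) e" for x
  have C1: "C1_fun F" and K: "compact K" using F by (auto simp: C1c_iff K_def)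
  have out: "F x = 0" "D x = 0" if "x \<notin> K" for x
    using C1c_zero_outside[OF F that[unfolded K_def]] by (simp_all add: D_def)
  have contD: "continuous_on UNIV D" and contF: "continuous_on UNIV F"
    unfolding D_def using C1 by (auto intro: C1_fun_continuous_deriv C1_fun_continuous)
  obtain B where B: "B > 0" "\<And>x. norm (D x) \<le> B"
    using bounded_continuous_compact_support[OF contD K out(2)] by blast
  obtain R where R: "R > 0" "\<And>x. x \<in> K \<Longrightarrow> norm x \<le> R"
    using compact_imp_bounded[OF K] by (auto simp: bounded_pos)
  have intF: "integrable lborel F"
    by (rule integrable_continuous_compact_support[OF contF K out(1)])
  have measF: "F \<in> borel_measurable borel" "D \<in> borel_measurable borel"
    using contF contD by (auto intro: borel_measurable_continuous_onI)
  define q where "q n x = (F (x + (1 / real (Suc n)) *\<^sub>R e) - F x) * real (Suc n)" for n x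
  have int_q: "(LINT x|lborel. q n x) = 0" for n
  proof -
    let ?c = "(1 / real (Suc n)) *\<^sub>R e"
    have eq: "distr lborel borel ((+) ?c) = lborel"
      by (rule lborel_distr_plus)
    have "(LINT x|distr lborel borel ((+) ?c). F x) = (LINT x|lborel. F (?c + x))"
      using measF by (intro integral_distr) auto
    then have tr: "(LINT x|lborel. F (x + ?c)) = (LINT x|lborel. F x)"
      unfolding eq by (simp add: add.commute)
    have "integrable (distr lborel borel ((+) ?c)) F"
      unfolding eq by (rule intF)
    then have "integrable lborel (\<lambda>x. F (x + ?c))"
      using measF by (subst (asm) integrable_distr_eq) (auto simp: add.commute)
    then show ?thesis
      unfolding q_def using intF tr by simp
  qed
  have deriv: "((\<lambda>s. F (x + s *\<^sub>R e)) has_real_derivative D (x + s *\<^sub>R e)) (at s)" for x s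
    unfolding D_def by (rule C1_fun_has_derivative_line[OF C1])
  have "(\<lambda>n. LINT x|lborel. q n x) \<longlonglongrightarrow> (LINT x|lborel. D x)"
  proof (rule integral_dominated_convergence[where w="\<lambda>x. B * indicator (cball 0 (R + norm e)) x"])
    show "D \<in> borel_measurable lborel" "\<And>n. q n \<in> borel_measurable lborel"
      using measF by (auto simp: q_def[abs_def])
    have "integrable lborel (\<lambda>x. indicator (cball 0 (R + norm e)) x *\<^sub>R B)"
      by (rule borel_integrable_compact) auto
    then show "integrable lborel (\<lambda>x. B * indicator (cball (0::real^'n) (R + norm e)) x)"
      by (simp add: mult.commute)
    show "AE x in lborel. (\<lambda>n. q n x) \<longlonglongrightarrow> D x"
    proof (rule AE_I2)
      fix x
      have "((\<lambda>s. (F (x + s *\<^sub>R e) - F x) / s) \<longlongrightarrow> D x) (at 0)"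
        using deriv[of x 0] by (simp add: has_field_derivative_iff)
      moreover have "filterlim (\<lambda>n. 1 / real (Suc n)) (at 0) sequentially"
        using LIMSEQ_Suc[OF lim_1_over_n] 
        by (auto simp: filterlim_at)
      ultimately have "(\<lambda>n. (F (x + (1 / real (Suc n)) *\<^sub>R e) - F x) / (1 / real (Suc n))) \<longlonglongrightarrow> D x"
        by (rule filterlim_compose)
      then show "(\<lambda>n. q n x) \<longlonglongrightarrow> D x"
        by (simp add: q_def del: of_nat_Suc)
    qed
    fix n
    show "AE x in lborel. norm (q n x) \<le> B * indicator (cball 0 (R + norm e)) x"
    proof (rule AE_I2)
      fix x
      define s where "s = 1 / real (Suc n)"
      have s: "0 < s" "s \<le> 1" by (auto simp: s_def)
      have q: "q n x = (F (x + s *\<^sub>R e) - F x) / s"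
        by (simp add: q_def s_def del: of_nat_Suc)
      show "norm (q n x) \<le> B * indicator (cball 0 (R + norm e)) x"
      proof (cases "x \<in> cball 0 (R + norm e)")
        case True
        obtain z where "F (x + s *\<^sub>R e) - F (x + 0 *\<^sub>R e) = (s - 0) * D (x + z *\<^sub>R e)"
          using MVT2[OF s(1), of "\<lambda>s. F (x + s *\<^sub>R e)" "\<lambda>s. D (x + s *\<^sub>R e)"] deriv by blast
        then have "q n x = D (x + z *\<^sub>R e)" using s by (simp add: q)
        then show ?thesis using B(2)[of "x + z *\<^sub>R e"] True by simp
      next
        case False
        have "norm (s *\<^sub>R e) \<le> norm e"
          using s by (simp add: mult_left_le_one_le)
        then have "norm (x + s *\<^sub>R e) > R" "norm x > R"
          using False R(1) norm_triangle_ineq4[of "x + s *\<^sub>R e" "s *\<^sub>R e"]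
          by (auto intro: order.strict_trans2) (smt (verit) norm_ge_zero)+
        then have "x \<notin> K" "x + s *\<^sub>R e \<notin> K" using R(2) by fastforce+
        then show ?thesis using out B by (simp add: q)
      qed
    qed
  qed
  then show ?thesis unfolding int_q D_def by (simp add: LIMSEQ_const_iff)
qed

lemma integral_lebesgue_on_support:
  fixes f :: "real^'n \<Rightarrow> real"
  assumes "\<Omega> \<in> sets lebesgue" "f \<in> borel_measurable borel" "\<And>x. x \<notin> \<Omega> \<Longrightarrow> f x = 0"
  shows "(LINT x|lebesgue_on \<Omega>. f x) = (LINT x|lborel. f x)"
proof -
  have "(LINT x|lebesgue_on \<Omega>. f x) = (LINT x|lebesgue. indicator \<Omega> x *\<^sub>R f x)"
    using assms by (intro integral_restrict_space) auto
  also have "\<dots> = (LINT x|lebesgue. f x)"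
    using assms(3) by (intro Bochner_Integration.integral_cong) (auto simp: indicator_def)
  also have "\<dots> = (LINT x|lborel. f x)"
    using assms by (intro integral_completion) simp
  finally show ?thesis .
qed

text \<open>The product of the two functions has compact support, so the integral of its derivative vanishes.\<close>

lemma integral_by_parts:
  fixes f g :: "real^'n \<Rightarrow> real"
  assumes f: "C1_fun f" and g: "g \<in> C1c \<Omega>" and \<Omega>: "\<Omega> \<in> sets lebesgue"
  shows "(LINT x|lebesgue_on \<Omega>. f x * frechet_derivative g (at x) e)
    = - (LINT x|lebesgue_on \<Omega>. frechet_derivative f (at x) e * g x)"
proof -
  define K where "K = closure {x. g x \<noteq> 0}"
  have C1: "C1_fun g" and K: "compact K" "K \<subseteq> \<Omega>" using g by (auto simp: C1c_iff K_def)
  have out: "g x = 0" "frechet_derivative g (at x) e = 0" if "x \<notin> K" for x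
    using C1c_zero_outside[OF g that[unfolded K_def]] by simp_all
  let ?a = "\<lambda>x. f x * frechet_derivative g (at x) e" and ?b = "\<lambda>x. frechet_derivative f (at x) e * g x"
  have cont: "continuous_on UNIV ?a" "continuous_on UNIV ?b"
    by (rule continuous_on_mult[OF C1_fun_continuous[OF f] C1_fun_continuous_deriv[OF C1]],
        rule continuous_on_mult[OF C1_fun_continuous_deriv[OF f] C1_fun_continuous[OF C1]])
  have int: "integrable lborel ?a" "integrable lborel ?b"
    using out cont by (auto intro!: integrable_continuous_compact_support[OF _ K(1)])
  have "(\<lambda>x. g x * f x) \<in> C1c UNIV"
    using C1c_mono[OF C1c_mult_left[OF g f]] by auto
  from integral_directional_derivative_eq_0[OF this, of e]
  have "(LINT x|lborel. ?b x + ?a x) = 0"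
    unfolding frechet_derivative_C1_mult[OF C1 f] by (simp add: mult.commute)
  then have "(LINT x|lborel. ?a x) = - (LINT x|lborel. ?b x)"
    using int by simp
  moreover have "(LINT x|lebesgue_on \<Omega>. ?a x) = (LINT x|lborel. ?a x)"
    "(LINT x|lebesgue_on \<Omega>. ?b x) = (LINT x|lborel. ?b x)"
    using out K cont \<Omega> by (auto intro!: integral_lebesgue_on_support borel_measurable_continuous_onI) blast+
  ultimately show ?thesis by simp
qed

section \<open>Uniqueness of weak gradients\<close>

text \<open>The square makes the truncated paraboloid continuously differentiable across the sphere.\<close>

lemma C1_bump:
  fixes c :: "real^'n"
  assumes "r > 0"
  defines "\<theta> \<equiv> \<lambda>x. (max 0 (r\<^sup>2 - (x - c) \<bullet> (x - c)))\<^sup>2"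
  shows "\<theta> \<in> C1c (cball c r)" "\<And>x. x \<in> ball c r \<Longrightarrow> \<theta> x > 0"
proof -
  have pos: "r\<^sup>2 - (x - c) \<bullet> (x - c) > 0 \<longleftrightarrow> x \<in> ball c r" for x
    using assms(1) by (simp add: dot_square_norm dist_norm norm_minus_commute power_mono_iff
        flip: abs_square_less_1) (metis abs_le_square_iff abs_norm_cancel abs_of_pos linorder_not_less)
  show "\<theta> x > 0" if "x \<in> ball c r" for x
  proof -
    have "0 < r\<^sup>2 - (x - c) \<bullet> (x - c)" using pos that by blast
    then have "0 < max 0 (r\<^sup>2 - (x - c) \<bullet> (x - c))" by simp
    then show ?thesis unfolding \<theta>_def by (rule zero_less_power)
  qed
  have der: "((\<lambda>s::real. (max 0 s)\<^sup>2) has_real_derivative 2 * max 0 s) (at s)" for s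
  proof (cases s "0::real" rule: linorder_cases)
    case less
    have "((\<lambda>s::real. 0) has_real_derivative 0) (at s)" by simp
    from has_field_derivative_transform_within_open[OF this open_lessThan[of 0], of "\<lambda>s. (max 0 s)\<^sup>2"]
    show ?thesis using less by simp
  next
    case equal
    have "((\<lambda>h::real. (max 0 h)\<^sup>2 / h) \<longlongrightarrow> 0) (at 0)"
    proof (rule Lim_null_comparison[where g="\<lambda>h. \<bar>h\<bar>"])
      show "\<forall>\<^sub>F h in at 0. norm ((max 0 h)\<^sup>2 / h) \<le> \<bar>h\<bar>"
        by (intro always_eventually allI) (auto simp: max_def power2_eq_square)
      show "((\<lambda>h::real. \<bar>h\<bar>) \<longlongrightarrow> 0) (at 0)"
        by (rule tendsto_eq_intros | simp)+
    qed
    then show ?thesis using equal by (simp add: has_field_derivative_iff)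
  next
    case greater
    have "((\<lambda>s::real. s\<^sup>2) has_real_derivative 2 * s) (at s)"
      by (auto intro!: derivative_eq_intros)
    from has_field_derivative_transform_within_open[OF this open_greaterThan[of 0], of "\<lambda>s. (max 0 s)\<^sup>2"]
    show ?thesis using greater by simp
  qed
  have C1: "C1_fun \<theta>"
    unfolding \<theta>_def
  proof (rule C1_fun_real_compose[OF _ der])
    have "C1_fun (\<lambda>x::real^'n. x - c)"
      using C1_fun_add[OF C1_fun_bounded_linear[OF bounded_linear_ident] C1_fun_const, of "- c"] by simp
    then have "C1_fun (\<lambda>x. r\<^sup>2 + (-1) *\<^sub>R ((x - c) \<bullet> (x - c)))"
      by (intro C1_fun_add C1_fun_const C1_fun_bounded_linear_compose(1)[OF bounded_linear_scaleR_right] C1_fun_inner(1))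
    then show "C1_fun (\<lambda>x. r\<^sup>2 - (x - c) \<bullet> (x - c))" by simp
  qed (intro continuous_intros)
  have "{x. \<theta> x \<noteq> 0} \<subseteq> cball c r"
  proof
    fix x assume "x \<in> {x. \<theta> x \<noteq> 0}"
    then have "0 < r\<^sup>2 - (x - c) \<bullet> (x - c)"
      by (simp add: \<theta>_def max_def split: if_splits)
    then show "x \<in> cball c r" using pos ball_subset_cball by blast
  qed
  then have sub: "closure {x. \<theta> x \<noteq> 0} \<subseteq> cball c r"
    by (simp add: closure_minimal)
  then have "compact (closure {x. \<theta> x \<noteq> 0})"
    by (meson bounded_cball bounded_subset closed_closure compact_eq_bounded_closed)
  with sub C1 show "\<theta> \<in> C1c (cball c r)" by (simp add: C1c_iff)
qed

text \<open>A function orthogonal to all polynomials is, by the Stone-Weierstrass theorem, orthogonal to all continuous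
  functions, hence to its own sign, which is an almost everywhere limit of continuous functions.\<close>

lemma AE_zero_if_orthogonal_polynomials:
  fixes H :: "'a::euclidean_space \<Rightarrow> real"
  assumes H: "integrable lebesgue H" and K: "compact K" "\<And>x. x \<notin> K \<Longrightarrow> H x = 0"
    and orth: "\<And>P. real_polynomial_function P \<Longrightarrow> (LINT x|lebesgue. H x * P x) = 0"
  shows "AE x in lebesgue. H x = 0"
proof -
  have Hm[measurable]: "H \<in> borel_measurable lebesgue" using H by simp
  have meas: "f \<in> borel_measurable lebesgue" if "continuous_on UNIV f" for f :: "'a \<Rightarrow> real"
    using continuous_imp_measurable_on_sets_lebesgue[OF that] by (simp add: lebesgue_on_UNIV_eq)
  have int: "integrable lebesgue (\<lambda>x. H x * f x)" if f: "continuous_on UNIV f" for f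
  proof -
    obtain B where B: "\<forall>x\<in>K. norm (f x) \<le> B"
      using compact_imp_bounded[OF compact_continuous_image[OF continuous_on_subset[OF f] K(1)]]
      by (auto simp: bounded_iff)
    show ?thesis
    proof (rule Bochner_Integration.integrable_bound)
      show "integrable lebesgue (\<lambda>x. B * H x)" using H by simp
      show "(\<lambda>x. H x * f x) \<in> borel_measurable lebesgue" using meas[OF f] by measurable
      show "AE x in lebesgue. norm (H x * f x) \<le> norm (B * H x)"
      proof (rule AE_I2)
        fix x show "norm (H x * f x) \<le> norm (B * H x)"
        proof (cases "x \<in> K")
          case True
          then have "\<bar>f x\<bar> \<le> \<bar>B\<bar>" using B by fastforce
          from mult_left_mono[OF this abs_ge_zero[of "H x"]]
          show ?thesis by (simp add: abs_mult mult.commute)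
        qed (use K(2) in simp)
      qed
    qed
  qed
  have orthc: "(LINT x|lebesgue. H x * f x) = 0" if f: "continuous_on UNIV f" for f
  proof -
    have "\<bar>LINT x|lebesgue. H x * f x\<bar> \<le> e * (LINT x|lebesgue. \<bar>H x\<bar>)" if e: "e > 0" for e
    proof -
      obtain P where P: "polynomial_function P" "\<forall>x\<in>K. norm (f x - P x) < e"
        using Stone_Weierstrass_polynomial_function[OF K(1) continuous_on_subset[OF f] e] by auto
      have Pr: "real_polynomial_function P" using P by (simp add: real_polynomial_function_eq)
      have Pc: "continuous_on UNIV P" using P by (simp add: continuous_on_polymonial_function)
      have "(LINT x|lebesgue. H x * f x) = (LINT x|lebesgue. H x * f x) - (LINT x|lebesgue. H x * P x)"
        by (simp add: orth[OF Pr])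
      also have "\<dots> = (LINT x|lebesgue. H x * f x - H x * P x)"
        using int[OF f] int[OF Pc] by simp
      finally have "\<bar>LINT x|lebesgue. H x * f x\<bar> \<le> (LINT x|lebesgue. \<bar>H x * f x - H x * P x\<bar>)"
        by (simp only: integral_abs_bound)
      also have "\<dots> \<le> (LINT x|lebesgue. e * \<bar>H x\<bar>)"
      proof (rule integral_mono)
        show "integrable lebesgue (\<lambda>x. \<bar>H x * f x - H x * P x\<bar>)"
          using int[OF f] int[OF Pc] by simp
        show "integrable lebesgue (\<lambda>x. e * \<bar>H x\<bar>)" using H by simp
        fix x show "\<bar>H x * f x - H x * P x\<bar> \<le> e * \<bar>H x\<bar>"
        proof (cases "x \<in> K")
          case True
          then have "\<bar>H x\<bar> * \<bar>f x - P x\<bar> \<le> \<bar>H x\<bar> * e"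
            using P(2) by (intro mult_left_mono) auto
          then show ?thesis by (simp add: abs_mult[symmetric] right_diff_distrib mult.commute)
        qed (use K(2) in simp)
      qed
      finally show ?thesis by simp
    qed
    from le_at_zero_if_le_pos[of "\<lambda>e. e * (LINT x|lebesgue. \<bar>H x\<bar>)", OF _ this]
    show ?thesis by (simp add: continuous_intros)
  qed
  have "(\<lambda>x. sgn (H x)) \<in> borel_measurable lebesgue" by measurable
  then have "(\<lambda>x. sgn (H x)) measurable_on UNIV"
    by (intro lebesgue_measurable_imp_measurable_on) auto
  then obtain N g where N: "negligible N" and g: "\<And>n. continuous_on UNIV (g n)"
    and lim: "\<And>x. x \<notin> N \<Longrightarrow> (\<lambda>n. g n x) \<longlonglongrightarrow> sgn (H x)"
    by (auto simp: measurable_on_def)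
  define c where "c n x = max (-1) (min 1 (g n x))" for n x
  have c: "continuous_on UNIV (c n)" for n
    unfolding c_def by (intro continuous_intros g)
  have "(\<lambda>n. LINT x|lebesgue. H x * c n x) \<longlonglongrightarrow> (LINT x|lebesgue. \<bar>H x\<bar>)"
  proof (rule integral_dominated_convergence[where w="\<lambda>x. \<bar>H x\<bar>"])
    show "AE x in lebesgue. (\<lambda>n. H x * c n x) \<longlonglongrightarrow> \<bar>H x\<bar>"
    proof (rule AE_I')
      show "N \<in> null_sets lebesgue" using N by (simp add: negligible_iff_null_sets)
      show "{x \<in> space lebesgue. \<not> (\<lambda>n. H x * c n x) \<longlonglongrightarrow> \<bar>H x\<bar>} \<subseteq> N"
      proof (clarsimp, rule ccontr)
        fix x assume x: "\<not> (\<lambda>n. H x * c n x) \<longlonglongrightarrow> \<bar>H x\<bar>" "x \<notin> N"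
        have "(\<lambda>n. H x * c n x) \<longlonglongrightarrow> H x * max (-1) (min 1 (sgn (H x)))"
          unfolding c_def by (intro tendsto_intros lim x(2))
        moreover have "H x * max (-1) (min 1 (sgn (H x))) = \<bar>H x\<bar>"
          by (simp add: sgn_if)
        ultimately show False using x by simp
      qed
    qed
    show "AE x in lebesgue. norm (H x * c n x) \<le> \<bar>H x\<bar>" for n
      by (intro AE_I2) (auto simp: abs_mult c_def intro!: mult_left_le)
  qed (use H int[OF c] in auto)
  then have "(LINT x|lebesgue. \<bar>H x\<bar>) = 0"
    unfolding orthc[OF c] by (simp add: LIMSEQ_const_iff)
  then show ?thesis
    using integral_nonneg_eq_0_iff_AE[of lebesgue "\<lambda>x. \<bar>H x\<bar>"] H by simp
qed

lemma locally_integrable_mult: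
  fixes g \<eta> :: "real^'n \<Rightarrow> real"
  assumes g: "locally_integrable \<Omega> g" and \<eta>: "continuous_on UNIV \<eta>"
    and K: "compact K" "K \<subseteq> \<Omega>" "\<And>x. x \<notin> K \<Longrightarrow> \<eta> x = 0"
  shows "integrable lebesgue (\<lambda>x. g x * \<eta> x)"
proof -
  obtain B where B: "B > 0" "\<And>x. norm (\<eta> x) \<le> B"
    using bounded_continuous_compact_support[OF \<eta> K(1,3)] by blast
  have \<eta>m: "\<eta> \<in> borel_measurable lebesgue"
    using continuous_imp_measurable_on_sets_lebesgue[OF \<eta>] by (simp add: lebesgue_on_UNIV_eq)
  have gi: "integrable lebesgue (\<lambda>x. indicator K x * g x)"
    using g K by (auto simp: locally_integrable_def set_integrable_def)
  have eq: "(\<lambda>x. g x * \<eta> x) = (\<lambda>x. (indicator K x * g x) * \<eta> x)"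
    using K(3) by (auto simp: fun_eq_iff indicator_def)
  show ?thesis unfolding eq
  proof (rule Bochner_Integration.integrable_bound)
    show "integrable lebesgue (\<lambda>x. B * (indicator K x * g x))" using gi by simp
    show "(\<lambda>x. indicator K x * g x * \<eta> x) \<in> borel_measurable lebesgue"
      using borel_measurable_integrable[OF gi] \<eta>m by measurable
    show "AE x in lebesgue. norm (indicator K x * g x * \<eta> x) \<le> norm (B * (indicator K x * g x))"
    proof (rule AE_I2)
      fix x
      have "\<bar>indicator K x * g x\<bar> * \<bar>\<eta> x\<bar> \<le> \<bar>indicator K x * g x\<bar> * B"
        using B(2)[of x] by (intro mult_left_mono) auto
      then show "norm (indicator K x * g x * \<eta> x) \<le> norm (B * (indicator K x * g x))"
        using B(1) by (simp add: abs_mult mult.commute)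
    qed
  qed
qed

lemma integrable_lebesgue_on_if_integrable:
  fixes f :: "real^'n \<Rightarrow> real"
  assumes "integrable lebesgue f" "\<Omega> \<in> sets lebesgue"
  shows "integrable (lebesgue_on \<Omega>) f"
  using integrable_mult_indicator[OF assms(2,1)] assms(2)
  by (simp add: integrable_restrict_space)

text \<open>Locally, multiply \<open>g\<close> by a bump function that is positive on a ball. Products of the bump with polynomials are test
  functions, so the product is orthogonal to all polynomials and vanishes almost everywhere.\<close>

theorem fundamental_lemma_calculus_of_variations:
  fixes g :: "real^'n \<Rightarrow> real"
  assumes \<Omega>: "open \<Omega>" and g: "locally_integrable \<Omega> g"
    and orth: "\<And>\<psi>. \<psi> \<in> C1c \<Omega> \<Longrightarrow> (LINT x|lebesgue_on \<Omega>. g x * \<psi> x) = 0"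
  shows "AE x in lebesgue_on \<Omega>. g x = 0"
proof -
  have ball0: "negligible {x\<in>ball c r. g x \<noteq> 0}" if r: "r > 0" "cball c r \<subseteq> \<Omega>" for c r
  proof -
    define \<theta> where "\<theta> = (\<lambda>x. (max 0 (r\<^sup>2 - (x - c) \<bullet> (x - c)))\<^sup>2)"
    note \<theta> = C1_bump(1)[OF r(1), of c, folded \<theta>_def]
    have \<theta>pos: "\<theta> x > 0" if "x \<in> ball c r" for x
      using C1_bump(2)[OF r(1) that] by (simp only: \<theta>_def)
    have \<theta>c: "continuous_on UNIV \<theta>" using \<theta> by (simp add: C1c_iff C1_fun_continuous)
    have \<theta>0: "\<theta> x = 0" if "x \<notin> cball c r" for x
      using \<theta> closure_subset[of "{x. \<theta> x \<noteq> 0}"] that by (auto simp: C1c_iff)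
    have "AE x in lebesgue. g x * \<theta> x = 0"
    proof (rule AE_zero_if_orthogonal_polynomials)
      show "integrable lebesgue (\<lambda>x. g x * \<theta> x)"
        by (rule locally_integrable_mult[OF g \<theta>c compact_cball r(2) \<theta>0])
      show "compact (cball c r)" by simp
      show "g x * \<theta> x = 0" if "x \<notin> cball c r" for x using \<theta>0[OF that] by simp
      fix P :: "real^'n \<Rightarrow> real" assume P: "real_polynomial_function P"
      have \<theta>P: "(\<lambda>x. \<theta> x * P x) \<in> C1c \<Omega>"
        by (rule C1c_mono[OF C1c_mult_left[OF \<theta> C1_fun_real_polynomial_function[OF P]] r(2)])
      have "(LINT x|lebesgue. g x * \<theta> x * P x) = (LINT x|lebesgue. indicator \<Omega> x *\<^sub>R (g x * (\<theta> x * P x)))"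
      proof (intro Bochner_Integration.integral_cong refl)
        fix x show "g x * \<theta> x * P x = indicator \<Omega> x *\<^sub>R (g x * (\<theta> x * P x))"
          using \<theta>0[of x] r(2) by (cases "x \<in> cball c r") auto
      qed
      also have "\<dots> = (LINT x|lebesgue_on \<Omega>. g x * (\<theta> x * P x))"
        using \<Omega> by (intro integral_restrict_space[symmetric]) auto
      also have "\<dots> = 0" by (rule orth[OF \<theta>P])
      finally show "(LINT x|lebesgue. g x * \<theta> x * P x) = 0" .
    qed
    then have "negligible {x. g x * \<theta> x \<noteq> 0}"
      by (simp add: negligible_iff_null_sets completion.AE_iff_null_sets)
    then show ?thesis
    proof (rule negligible_subset)
      show "{x \<in> ball c r. g x \<noteq> 0} \<subseteq> {x. g x * \<theta> x \<noteq> 0}"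
      proof
        fix x assume "x \<in> {x \<in> ball c r. g x \<noteq> 0}"
        then show "x \<in> {x. g x * \<theta> x \<noteq> 0}" using \<theta>pos[of x] by simp
      qed
    qed
  qed
  have "negligible {x\<in>\<Omega>. g x \<noteq> 0}"
    unfolding locally_negligible_alt[of "{x\<in>\<Omega>. g x \<noteq> 0}"]
  proof
    fix x assume x: "x \<in> {x\<in>\<Omega>. g x \<noteq> 0}"
    then obtain r where r: "r > 0" "cball x r \<subseteq> \<Omega>"
      using \<Omega> open_contains_cball by blast
    show "\<exists>U. openin (top_of_set {x\<in>\<Omega>. g x \<noteq> 0}) U \<and> x \<in> U \<and> negligible U"
    proof (intro exI conjI)
      show "openin (top_of_set {x\<in>\<Omega>. g x \<noteq> 0}) ({x\<in>\<Omega>. g x \<noteq> 0} \<inter> ball x r)"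
        by (rule openin_open_Int) simp
      show "x \<in> {x\<in>\<Omega>. g x \<noteq> 0} \<inter> ball x r" using x r by simp
      show "negligible ({x\<in>\<Omega>. g x \<noteq> 0} \<inter> ball x r)"
        by (rule negligible_subset[OF ball0[OF r]]) auto
    qed
  qed
  then have "AE x in lebesgue. x \<in> \<Omega> \<longrightarrow> g x = 0"
    by (simp add: negligible_iff_null_sets completion.AE_iff_null_sets)
  then show ?thesis using \<Omega> by (simp add: AE_restrict_space_iff)
qed

lemma locally_integrable_bounded_linear:
  fixes g :: "real^'n \<Rightarrow> 'b::euclidean_space" and L :: "'b \<Rightarrow> 'c::euclidean_space"
  assumes g: "locally_integrable \<Omega> g" and L: "bounded_linear L"
  shows "locally_integrable \<Omega> (\<lambda>x. L (g x))"
  unfolding locally_integrable_def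
proof (intro allI impI)
  fix K assume "compact K \<and> K \<subseteq> \<Omega>"
  then have "g absolutely_integrable_on K"
    using g by (auto simp: locally_integrable_def)
  from absolutely_integrable_linear[OF this L]
  show "(\<lambda>x. L (g x)) absolutely_integrable_on K" by (simp add: o_def)
qed

lemma locally_integrable_diff:
  fixes g h :: "real^'n \<Rightarrow> 'b::euclidean_space"
  assumes "locally_integrable \<Omega> g" "locally_integrable \<Omega> h"
  shows "locally_integrable \<Omega> (\<lambda>x. g x - h x)"
  using assms by (auto simp: locally_integrable_def intro!: set_integral_diff(1))

lemma locally_integrable_continuous:
  fixes g :: "real^'n \<Rightarrow> 'b::euclidean_space"
  assumes "continuous_on UNIV g"
  shows "locally_integrable \<Omega> g"
  unfolding locally_integrable_def set_integrable_def
proof (intro allI impI)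
  fix K :: "(real^'n) set" assume "compact K \<and> K \<subseteq> \<Omega>"
  then have "integrable lborel (\<lambda>x. indicator K x *\<^sub>R g x)"
    using assms by (intro borel_integrable_compact) (auto intro: continuous_on_subset)
  then show "integrable lebesgue (\<lambda>x. indicator K x *\<^sub>R g x)"
    using integrable_completion borel_measurable_integrable by blast
qed

lemma bounded_linear_entry: "bounded_linear (\<lambda>A::real^'n^'m. A $ i $ j)"
  by (intro bounded_linear_compose[OF bounded_linear_vec_nth bounded_linear_vec_nth])

text \<open>Both integrals in the definition of a weak gradient exist, so that this definition is linear in the field.\<close>

lemma weak_grad_integrable:
  fixes \<Omega> :: "(real^'n) set"
  assumes \<Omega>: "open \<Omega>" and g: "locally_integrable \<Omega> (g :: real^'n \<Rightarrow> real)" and \<psi>: "\<psi> \<in> C1c \<Omega>"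
  shows "integrable (lebesgue_on \<Omega>) (\<lambda>x. g x * \<psi> x)"
    and "integrable (lebesgue_on \<Omega>) (\<lambda>x. g x * frechet_derivative \<psi> (at x) h)"
proof -
  have K: "compact (closure {x. \<psi> x \<noteq> 0})" "closure {x. \<psi> x \<noteq> 0} \<subseteq> \<Omega>" and C1: "C1_fun \<psi>"
    using \<psi> by (auto simp: C1c_iff)
  have \<Omega>': "\<Omega> \<in> sets lebesgue" using \<Omega> by simp
  show "integrable (lebesgue_on \<Omega>) (\<lambda>x. g x * \<psi> x)"
    by (rule integrable_lebesgue_on_if_integrable[OF locally_integrable_mult[OF g C1_fun_continuous[OF C1] K] \<Omega>'])
      (rule C1c_zero_outside(1)[OF \<psi>])
  show "integrable (lebesgue_on \<Omega>) (\<lambda>x. g x * frechet_derivative \<psi> (at x) h)"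
    by (rule integrable_lebesgue_on_if_integrable[OF locally_integrable_mult[OF g C1_fun_continuous_deriv[OF C1] K] \<Omega>'])
      (rule C1c_zero_outside(2)[OF \<psi>])
qed

lemma has_weak_grad_diff:
  assumes \<Omega>: "open \<Omega>" and v: "has_weak_grad \<Omega> v G" and w: "has_weak_grad \<Omega> w H"
  shows "has_weak_grad \<Omega> (\<lambda>x. v x - w x) (\<lambda>x. G x - H x)"
  unfolding has_weak_grad_def
proof (intro conjI ballI allI)
  show "locally_integrable \<Omega> (\<lambda>x. v x - w x)" "locally_integrable \<Omega> (\<lambda>x. G x - H x)"
    using v w by (auto simp: has_weak_grad_def intro: locally_integrable_diff)
  fix \<psi> :: "real^'a \<Rightarrow> real" and i j assume \<psi>: "\<psi> \<in> C1c \<Omega>"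
  have loc: "locally_integrable \<Omega> (\<lambda>x. v x $ i)" "locally_integrable \<Omega> (\<lambda>x. w x $ i)"
    "locally_integrable \<Omega> (\<lambda>x. G x $ i $ j)" "locally_integrable \<Omega> (\<lambda>x. H x $ i $ j)"
    using v w by (auto simp: has_weak_grad_def
        intro: locally_integrable_bounded_linear[OF _ bounded_linear_vec_nth] locally_integrable_bounded_linear[OF _ bounded_linear_entry])
  note int = weak_grad_integrable(2)[OF \<Omega> loc(1) \<psi>] weak_grad_integrable(2)[OF \<Omega> loc(2) \<psi>]
    weak_grad_integrable(1)[OF \<Omega> loc(3) \<psi>] weak_grad_integrable(1)[OF \<Omega> loc(4) \<psi>]
  show "(LINT x|lebesgue_on \<Omega>. (v x - w x) $ i * frechet_derivative \<psi> (at x) (axis j 1)) =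
        - (LINT x|lebesgue_on \<Omega>. (G x - H x) $ i $ j * \<psi> x)"
    using v w \<psi> int by (simp add: has_weak_grad_def left_diff_distrib)
qed

text \<open>The difference of two weak gradients is orthogonal to all test functions, entry by entry.\<close>

theorem weak_grad_unique:
  fixes \<Omega> :: "(real^'n) set"
  assumes \<Omega>: "open \<Omega>" and G: "has_weak_grad \<Omega> v G" and H: "has_weak_grad \<Omega> v H"
  shows "AE x in lebesgue_on \<Omega>. G x = H x"
proof -
  have "AE x in lebesgue_on \<Omega>. G x $ i $ j - H x $ i $ j = 0" for i j
  proof (rule fundamental_lemma_calculus_of_variations[OF \<Omega>])
    have loc: "locally_integrable \<Omega> (\<lambda>x. G x $ i $ j)" "locally_integrable \<Omega> (\<lambda>x. H x $ i $ j)"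
      using G H by (auto simp: has_weak_grad_def intro: locally_integrable_bounded_linear[OF _ bounded_linear_entry])
    then show "locally_integrable \<Omega> (\<lambda>x. G x $ i $ j - H x $ i $ j)"
      by (rule locally_integrable_diff)
    fix \<psi> :: "real^'n \<Rightarrow> real" assume \<psi>: "\<psi> \<in> C1c \<Omega>"
    show "(LINT x|lebesgue_on \<Omega>. (G x $ i $ j - H x $ i $ j) * \<psi> x) = 0"
      using G H \<psi> weak_grad_integrable(1)[OF \<Omega> loc(1) \<psi>] weak_grad_integrable(1)[OF \<Omega> loc(2) \<psi>]
      by (simp add: has_weak_grad_def left_diff_distrib)
  qed
  then have "AE x in lebesgue_on \<Omega>. \<forall>i j. G x $ i $ j = H x $ i $ j"
    by (simp add: AE_all_countable)
  then show ?thesis by (simp add: vec_eq_iff)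
qed

lemma has_weak_grad_wgrad: "has_weak_grad \<Omega> v G \<Longrightarrow> has_weak_grad \<Omega> v (wgrad \<Omega> v)"
  unfolding wgrad_def by (rule someI[of "has_weak_grad \<Omega> v"])

lemma wgrad_AE:
  "open \<Omega> \<Longrightarrow> has_weak_grad \<Omega> v G \<Longrightarrow> AE x in lebesgue_on \<Omega>. wgrad \<Omega> v x = G x"
  using weak_grad_unique has_weak_grad_wgrad by blast

lemma W1p_wgrad:
  assumes "v \<in> W1p \<Omega> p" and \<Omega>: "open \<Omega>"
  shows "v \<in> Lp \<Omega> p" "wgrad \<Omega> v \<in> Lp \<Omega> p" "has_weak_grad \<Omega> v (wgrad \<Omega> v)"
proof -
  obtain G where G: "G \<in> Lp \<Omega> p" "has_weak_grad \<Omega> v G" and v: "v \<in> Lp \<Omega> p"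
    using assms by (auto simp: W1p_def)
  show "v \<in> Lp \<Omega> p" by fact
  show "has_weak_grad \<Omega> v (wgrad \<Omega> v)" using has_weak_grad_wgrad[OF G(2)] .
  have "AE x in lebesgue_on \<Omega>. G x = wgrad \<Omega> v x"
    using weak_grad_unique[OF \<Omega> G(2) has_weak_grad_wgrad[OF G(2)]] .
  then show "wgrad \<Omega> v \<in> Lp \<Omega> p"
    using \<Omega> by (intro Lp_cong_AE[OF _ G(1)]) auto
qed

lemma wgrad_diff:
  assumes v: "v \<in> W1p \<Omega> p" and w: "w \<in> W1p \<Omega> q" and \<Omega>: "open \<Omega>"
  shows "AE x in lebesgue_on \<Omega>. wgrad \<Omega> (\<lambda>x. v x - w x) x = wgrad \<Omega> v x - wgrad \<Omega> w x"
  using wgrad_AE[OF \<Omega> has_weak_grad_diff[OF \<Omega> W1p_wgrad(3)[OF v \<Omega>] W1p_wgrad(3)[OF w \<Omega>]]] .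

lemma W1p_diff:
  assumes v: "v \<in> W1p \<Omega> p" and w: "w \<in> W1p \<Omega> p" and \<Omega>: "open \<Omega>" and p: "p \<ge> 1"
  shows "(\<lambda>x. v x - w x) \<in> W1p \<Omega> p"
  using has_weak_grad_diff[OF \<Omega> W1p_wgrad(3)[OF v \<Omega>] W1p_wgrad(3)[OF w \<Omega>]]
    Lp_diff[OF p W1p_wgrad(1)[OF v \<Omega>] W1p_wgrad(1)[OF w \<Omega>]]
    Lp_diff[OF p W1p_wgrad(2)[OF v \<Omega>] W1p_wgrad(2)[OF w \<Omega>]]
  by (auto simp: W1p_def)

lemma Lp_norm_wgrad_diff:
  assumes v: "v \<in> W1p \<Omega> p" and w: "w \<in> W1p \<Omega> p" and \<Omega>: "open \<Omega>" and p: "p \<ge> 1"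
  shows "Lp_norm \<Omega> p (wgrad \<Omega> (\<lambda>x. v x - w x)) = Lp_norm \<Omega> p (\<lambda>x. wgrad \<Omega> v x - wgrad \<Omega> w x)"
  using Lp_measurable[OF W1p_wgrad(2)[OF W1p_diff[OF v w \<Omega> p] \<Omega>]]
    Lp_measurable[OF Lp_diff[OF p W1p_wgrad(2)[OF v \<Omega>] W1p_wgrad(2)[OF w \<Omega>]]] wgrad_diff[OF v w \<Omega>]
  by (rule Lp_norm_cong_AE)

lemma W1p_norm_nonneg [simp]: "0 \<le> W1p_norm \<Omega> p v"
  by (simp add: W1p_norm_def)

lemma Lp_norm_le_W1p_norm: "Lp_norm \<Omega> p v \<le> W1p_norm \<Omega> p v" "Lp_norm \<Omega> p (wgrad \<Omega> v) \<le> W1p_norm \<Omega> p v"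
  by (simp_all add: W1p_norm_def)

lemma W1p_norm_diff_triangle:
  assumes v: "v \<in> W1p \<Omega> p" and w: "w \<in> W1p \<Omega> p" and \<Omega>: "open \<Omega>" and p: "p \<ge> 1"
  shows "W1p_norm \<Omega> p (\<lambda>x. v x - w x) \<le> W1p_norm \<Omega> p v + W1p_norm \<Omega> p w"
  using Lp_norm_diff_triangle[OF p W1p_wgrad(1)[OF v \<Omega>] W1p_wgrad(1)[OF w \<Omega>]]
    Lp_norm_diff_triangle[OF p W1p_wgrad(2)[OF v \<Omega>] W1p_wgrad(2)[OF w \<Omega>]]
  by (simp add: W1p_norm_def Lp_norm_wgrad_diff[OF v w \<Omega> p])

lemma wgrad_norm_diff_le:
  assumes v: "v \<in> W1p \<Omega> p" and w: "w \<in> W1p \<Omega> p" and \<Omega>: "open \<Omega>" and p: "p \<ge> 1"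
  shows "\<bar>Lp_norm \<Omega> p (wgrad \<Omega> v) - Lp_norm \<Omega> p (wgrad \<Omega> w)\<bar> \<le> W1p_norm \<Omega> p (\<lambda>x. v x - w x)"
  using Lp_norm_diff_le[OF p W1p_wgrad(2)[OF v \<Omega>] W1p_wgrad(2)[OF w \<Omega>]]
    Lp_norm_le_W1p_norm(2)[of \<Omega> p "\<lambda>x. v x - w x"]
  by (simp add: Lp_norm_wgrad_diff[OF v w \<Omega> p])

lemma W1p_norm_diff_le:
  assumes v: "v \<in> W1p \<Omega> p" and w: "w \<in> W1p \<Omega> p" and \<Omega>: "open \<Omega>" and p: "p \<ge> 1"
  shows "\<bar>W1p_norm \<Omega> p v - W1p_norm \<Omega> p w\<bar> \<le> W1p_norm \<Omega> p (\<lambda>x. v x - w x)"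
  using Lp_norm_diff_le[OF p W1p_wgrad(1)[OF v \<Omega>] W1p_wgrad(1)[OF w \<Omega>]]
    Lp_norm_diff_le[OF p W1p_wgrad(2)[OF v \<Omega>] W1p_wgrad(2)[OF w \<Omega>]]
  by (simp add: W1p_norm_def Lp_norm_wgrad_diff[OF v w \<Omega> p])

section \<open>Test fields\<close>

definition classical_grad :: "(real^'n \<Rightarrow> real^'n) \<Rightarrow> real^'n \<Rightarrow> real^'n^'n" where
  "classical_grad \<psi> x = (\<chi> i j. frechet_derivative \<psi> (at x) (axis j 1) $ i)"

lemma continuous_classical_grad:
  assumes "C1_fun \<psi>" shows "continuous_on S (classical_grad \<psi>)"
  unfolding classical_grad_def
  by (intro continuous_on_vec_lambda bounded_linear.continuous_on[OF bounded_linear_vec_nth] C1_fun_continuous_deriv assms)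

lemma has_weak_grad_C1:
  assumes \<psi>: "C1_fun \<psi>" and \<Omega>: "open \<Omega>"
  shows "has_weak_grad \<Omega> \<psi> (classical_grad \<psi>)"
  unfolding has_weak_grad_def
proof (intro conjI ballI allI)
  show "locally_integrable \<Omega> \<psi>" "locally_integrable \<Omega> (classical_grad \<psi>)"
    using \<psi> by (auto intro: locally_integrable_continuous C1_fun_continuous continuous_classical_grad)
  fix \<eta> :: "real^'a \<Rightarrow> real" and i j assume \<eta>: "\<eta> \<in> C1c \<Omega>"
  have "C1_fun (\<lambda>x. \<psi> x $ i)"
    by (rule C1_fun_bounded_linear_compose(1)[OF bounded_linear_vec_nth \<psi>])
  from integral_by_parts[OF this \<eta>, of "axis j 1"] \<Omega>
  show "(LINT x|lebesgue_on \<Omega>. \<psi> x $ i * frechet_derivative \<eta> (at x) (axis j 1)) =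
        - (LINT x|lebesgue_on \<Omega>. classical_grad \<psi> x $ i $ j * \<eta> x)"
    by (simp add: classical_grad_def C1_fun_bounded_linear_compose(2)[OF bounded_linear_vec_nth \<psi>])
qed

lemma wgrad_C1:
  assumes "C1_fun \<psi>" "open \<Omega>"
  shows "AE x in lebesgue_on \<Omega>. wgrad \<Omega> \<psi> x = classical_grad \<psi> x"
  using wgrad_AE[OF assms(2) has_weak_grad_C1[OF assms]] .

lemma Lp_continuous_compact_support:
  fixes f :: "real^'n \<Rightarrow> 'b::euclidean_space"
  assumes f: "continuous_on UNIV f" and K: "compact K" "\<And>x. x \<notin> K \<Longrightarrow> f x = 0"
    and \<Omega>: "\<Omega> \<in> sets lebesgue" and p: "p > 0"
  shows "f \<in> Lp \<Omega> p"
proof -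
  have "integrable lborel (\<lambda>x. norm (f x) powr p)"
    using K p f by (intro integrable_continuous_compact_support[OF _ K(1)] continuous_on_powr' continuous_intros) auto
  then have "integrable lebesgue (\<lambda>x. norm (f x) powr p)"
    using integrable_completion borel_measurable_integrable by blast
  then have "integrable (lebesgue_on \<Omega>) (\<lambda>x. norm (f x) powr p)"
    by (rule integrable_lebesgue_on_if_integrable[OF _ \<Omega>])
  moreover have "f \<in> borel_measurable (lebesgue_on \<Omega>)"
    using continuous_imp_measurable_on_sets_lebesgue[OF continuous_on_subset[OF f] \<Omega>] by simp
  ultimately show ?thesis by (simp add: Lp_def)
qed

lemma C1c_imp_W1p:
  assumes \<psi>: "\<psi> \<in> C1c \<Omega>" and \<Omega>: "open \<Omega>" and p: "p > 0"
  shows "\<psi> \<in> W1p \<Omega> p"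
proof -
  have C1: "C1_fun \<psi>" and K: "compact (closure {x. \<psi> x \<noteq> 0})"
    using \<psi> by (auto simp: C1c_iff)
  have grad0: "classical_grad \<psi> x = 0" if "x \<notin> closure {x. \<psi> x \<noteq> 0}" for x
    using C1c_zero_outside(2)[OF \<psi> that] by (simp add: classical_grad_def vec_eq_iff)
  have "\<psi> \<in> Lp \<Omega> p" 
    using \<Omega> p by (intro Lp_continuous_compact_support[OF C1_fun_continuous[OF C1] K C1c_zero_outside(1)[OF \<psi>]]) auto
  moreover have "classical_grad \<psi> \<in> Lp \<Omega> p"
    using \<Omega> p by (intro Lp_continuous_compact_support[OF continuous_classical_grad[OF C1] K grad0]) auto
  ultimately show ?thesis
    using has_weak_grad_C1[OF C1 \<Omega>] by (auto simp: W1p_def)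
qed

lemma Xspace_W1p: "v \<in> Xspace \<Omega> \<Longrightarrow> v \<in> W1p \<Omega> 3"
  by (simp add: Xspace_def)

lemma Xspace_approx:
  assumes "v \<in> Xspace \<Omega>"
  obtains \<psi> where "\<And>k. \<psi> k \<in> C1c \<Omega>" "(\<lambda>k. W1p_norm \<Omega> 3 (\<lambda>x. \<psi> k x - v x)) \<longlonglongrightarrow> 0"
  using assms by (auto simp: Xspace_def)

lemma W1p_norm_zero: "open \<Omega> \<Longrightarrow> p > 0 \<Longrightarrow> W1p_norm \<Omega> p (\<lambda>x. 0) = 0"
proof -
  assume \<Omega>: "open \<Omega>" and p: "p > 0"
  have "AE x in lebesgue_on \<Omega>. wgrad \<Omega> (\<lambda>x. 0) x = classical_grad (\<lambda>x. 0) x"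
    by (rule wgrad_C1[OF C1_fun_const \<Omega>])
  moreover have "classical_grad (\<lambda>x. 0::real^'a) x = 0" for x :: "real^'a"
    by (simp add: classical_grad_def vec_eq_iff)
  ultimately have "AE x in lebesgue_on \<Omega>. norm (wgrad \<Omega> (\<lambda>x. 0) x) powr p = 0"
    using p by simp
  then have "(LINT x|lebesgue_on \<Omega>. norm (wgrad \<Omega> (\<lambda>x. 0) x) powr p) = 0"
    by (rule integral_eq_zero_AE)
  then show ?thesis using p by (simp add: W1p_norm_def Lp_norm_def)
qed

lemma C1c_imp_Xspace:
  assumes \<psi>: "\<psi> \<in> C1c \<Omega>" and \<Omega>: "open \<Omega>"
  shows "\<psi> \<in> Xspace \<Omega>"
  unfolding Xspace_def using C1c_imp_W1p[OF \<psi> \<Omega>, of 3] W1p_norm_zero[OF \<Omega>, of 3] \<psi>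
  by (auto intro!: exI[of _ "\<lambda>k. \<psi>"])

lemma Xspace_diff:
  assumes v: "v \<in> Xspace \<Omega>" and w: "w \<in> Xspace \<Omega>" and \<Omega>: "open \<Omega>"
  shows "(\<lambda>x. v x - w x) \<in> Xspace \<Omega>"
proof -
  obtain a where a: "\<And>k. a k \<in> C1c \<Omega>" "(\<lambda>k. W1p_norm \<Omega> 3 (\<lambda>x. a k x - v x)) \<longlonglongrightarrow> 0"
    using v by (rule Xspace_approx) blast
  obtain b where b: "\<And>k. b k \<in> C1c \<Omega>" "(\<lambda>k. W1p_norm \<Omega> 3 (\<lambda>x. b k x - w x)) \<longlonglongrightarrow> 0"
    using w by (rule Xspace_approx) blast
  have W: "(\<lambda>x. a k x - v x) \<in> W1p \<Omega> 3" "(\<lambda>x. b k x - w x) \<in> W1p \<Omega> 3" for k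
    using W1p_diff[OF C1c_imp_W1p[OF a(1) \<Omega>] Xspace_W1p[OF v] \<Omega>]
      W1p_diff[OF C1c_imp_W1p[OF b(1) \<Omega>] Xspace_W1p[OF w] \<Omega>] by simp_all
  have "(\<lambda>k. W1p_norm \<Omega> 3 (\<lambda>x. (a k x - b k x) - (v x - w x))) \<longlonglongrightarrow> 0"
  proof (rule Lim_null_comparison)
    show "\<forall>\<^sub>F k in sequentially. norm (W1p_norm \<Omega> 3 (\<lambda>x. a k x - b k x - (v x - w x)))
      \<le> W1p_norm \<Omega> 3 (\<lambda>x. a k x - v x) + W1p_norm \<Omega> 3 (\<lambda>x. b k x - w x)"
    proof (intro always_eventually allI)
      fix k
      have "(\<lambda>x. a k x - b k x - (v x - w x)) = (\<lambda>x. (a k x - v x) - (b k x - w x))"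
        by (simp add: fun_eq_iff algebra_simps)
      then show "norm (W1p_norm \<Omega> 3 (\<lambda>x. a k x - b k x - (v x - w x)))
      \<le> W1p_norm \<Omega> 3 (\<lambda>x. a k x - v x) + W1p_norm \<Omega> 3 (\<lambda>x. b k x - w x)"
        using W1p_norm_diff_triangle[OF W(1)[of k] W(2)[of k] \<Omega>] by simp
    qed
    show "(\<lambda>k. W1p_norm \<Omega> 3 (\<lambda>x. a k x - v x) + W1p_norm \<Omega> 3 (\<lambda>x. b k x - w x)) \<longlonglongrightarrow> 0"
      using tendsto_add[OF a(2) b(2)] by simp
  qed
  moreover have "(\<lambda>x. v x - w x) \<in> W1p \<Omega> 3"
    using v w \<Omega> by (intro W1p_diff Xspace_W1p) auto
  ultimately show ?thesis
    using C1c_diff[OF a(1) b(1)] by (auto simp: Xspace_def intro!: exI[of _ "\<lambda>k x. a k x - b k x"])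
qed

text \<open>Lipschitz bounds in \<open>W\<^sup>1\<^sup>,\<^sup>3\<close> are the form in which equalities and inequalities pass from test fields to \<open>X\<close>.\<close>

lemma Xspace_lipschitz_tendsto:
  fixes F :: "(real^'n \<Rightarrow> real^'n) \<Rightarrow> real"
  assumes lim: "(\<lambda>k. W1p_norm \<Omega> 3 (\<lambda>x. \<psi> k x - v x)) \<longlonglongrightarrow> 0"
    and lip: "\<And>k. \<bar>F (\<psi> k) - F v\<bar> \<le> c * W1p_norm \<Omega> 3 (\<lambda>x. \<psi> k x - v x)"
  shows "(\<lambda>k. F (\<psi> k)) \<longlonglongrightarrow> F v"
proof -
  have "(\<lambda>k. F (\<psi> k) - F v) \<longlonglongrightarrow> 0"
    by (rule Lim_null_comparison[OF always_eventually tendsto_mult_right_zero[OF lim, of c]])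
      (use lip in simp)
  then show ?thesis by (simp add: LIM_zero_iff)
qed

section \<open>A Gagliardo-Nirenberg inequality\<close>

text \<open>Lebesgue measure on a Euclidean space is the product of its coordinate measures. The iterated integrals below may
  list the basis in any order, so each hypothesis of the Loomis-Whitney inequality can be met in the order that suits it.\<close>

lemma nn_integral_lborel_PiM:
  fixes f :: "'a::euclidean_space \<Rightarrow> ennreal"
  assumes [measurable]: "f \<in> borel_measurable borel"
  shows "(\<integral>\<^sup>+x. f x \<partial>lborel) = (\<integral>\<^sup>+g. f (\<Sum>b\<in>Basis. g b *\<^sub>R b) \<partial>(\<Pi>\<^sub>M b\<in>Basis. lborel))"
  by (subst lborel_eq) (simp add: nn_integral_distr)

lemma nn_integral_lborel_2:
  fixes f :: "'a::euclidean_space \<Rightarrow> ennreal"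
  assumes [measurable]: "f \<in> borel_measurable borel" and B: "Basis = {d, e}" "d \<noteq> e"
  shows "(\<integral>\<^sup>+x. f x \<partial>lborel) = (\<integral>\<^sup>+y. \<integral>\<^sup>+x. f (x *\<^sub>R d + y *\<^sub>R e) \<partial>lborel \<partial>lborel)"
proof -
  interpret product_sigma_finite "\<lambda>_::'a. lborel :: real measure"
    by standard
  have "(\<integral>\<^sup>+x. f x \<partial>lborel) = (\<integral>\<^sup>+g. f (\<Sum>b\<in>{d, e}. g b *\<^sub>R b) \<partial>(Pi\<^sub>M (insert d {e}) (\<lambda>_. lborel)))"
    by (subst nn_integral_lborel_PiM) (simp_all add: B)
  also have "\<dots> = (\<integral>\<^sup>+g. \<integral>\<^sup>+x. f (x *\<^sub>R d + g e *\<^sub>R e) \<partial>lborel \<partial>(Pi\<^sub>M {e} (\<lambda>_. lborel)))"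
    using B(2-) by (subst product_nn_integral_insert) simp_all
  also have "\<dots> = (\<integral>\<^sup>+y. \<integral>\<^sup>+x. f (x *\<^sub>R d + y *\<^sub>R e) \<partial>lborel \<partial>lborel)"
    by (rule product_nn_integral_singleton) measurable
  finally show ?thesis .
qed

lemma nn_integral_lborel_3:
  fixes f :: "'a::euclidean_space \<Rightarrow> ennreal"
  assumes [measurable]: "f \<in> borel_measurable borel"
    and B: "Basis = {c, d, e}" "c \<noteq> d" "c \<noteq> e" "d \<noteq> e"
  shows "(\<integral>\<^sup>+x. f x \<partial>lborel)
    = (\<integral>\<^sup>+z. \<integral>\<^sup>+y. \<integral>\<^sup>+x. f (x *\<^sub>R c + y *\<^sub>R d + z *\<^sub>R e) \<partial>lborel \<partial>lborel \<partial>lborel)"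
proof -
  interpret product_sigma_finite "\<lambda>_::'a. lborel :: real measure"
    by standard
  have "(\<integral>\<^sup>+x. f x \<partial>lborel) = (\<integral>\<^sup>+g. f (\<Sum>b\<in>{c, d, e}. g b *\<^sub>R b) \<partial>(Pi\<^sub>M (insert c {d, e}) (\<lambda>_. lborel)))"
    by (subst nn_integral_lborel_PiM) (simp_all add: B)
  also have "\<dots> = (\<integral>\<^sup>+g. \<integral>\<^sup>+x. f (x *\<^sub>R c + g d *\<^sub>R d + g e *\<^sub>R e) \<partial>lborel \<partial>(Pi\<^sub>M (insert d {e}) (\<lambda>_. lborel)))"
    using B(2-) by (subst product_nn_integral_insert) (simp_all add: add.assoc)
  also have "\<dots> = (\<integral>\<^sup>+g. \<integral>\<^sup>+y. \<integral>\<^sup>+x. f (x *\<^sub>R c + y *\<^sub>R d + g e *\<^sub>R e) \<partial>lborel \<partial>lborel \<partial>(Pi\<^sub>M {e} (\<lambda>_. lborel)))"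
    using B(2-) by (subst product_nn_integral_insert) simp_all
  also have "\<dots> = (\<integral>\<^sup>+z. \<integral>\<^sup>+y. \<integral>\<^sup>+x. f (x *\<^sub>R c + y *\<^sub>R d + z *\<^sub>R e) \<partial>lborel \<partial>lborel \<partial>lborel)"
    by (rule product_nn_integral_singleton) measurable
  finally show ?thesis .
qed

text \<open>Arithmetic-geometric mean inequality with a free weight: it replaces square roots of extended nonnegative
  reals, and the best weight is chosen only after the integration.\<close>

lemma ennreal_amgm:
  fixes s x y :: ennreal
  assumes "s\<^sup>2 \<le> x * y" "l > 0"
  shows "2 * s \<le> ennreal l * x + ennreal (1 / l) * y"
proof (cases "x = top \<or> y = top")
  case True
  then show ?thesis using assms(2) by (auto simp: ennreal_mult_top)
next
  case False
  then obtain a b where ab: "x = ennreal a" "y = ennreal b" "a \<ge> 0" "b \<ge> 0"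
    by (metis ennreal_cases)
  have "s\<^sup>2 \<noteq> top"
    using assms(1) ab by (auto simp: ennreal_mult[symmetric] top_unique)
  then have "s \<noteq> top" by (auto simp: power2_eq_square)
  then obtain r where r: "s = ennreal r" "r \<ge> 0" by (metis ennreal_cases)
  have "r\<^sup>2 \<le> a * b"
    using assms(1) r ab by (simp add: ennreal_power ennreal_mult[symmetric])
  also have "a * b = (l * a) * (b / l)" using assms(2) by simp
  finally have "4 * r\<^sup>2 \<le> 4 * ((l * a) * (b / l))" by simp
  also have "\<dots> \<le> (l * a + b / l)\<^sup>2"
  proof -
    have "4 * (x * y) \<le> (x + y)\<^sup>2" for x y :: real
      using sum_squares_bound[of x y] by (simp add: power2_sum)
    then show ?thesis .
  qed
  finally have "(2 * r)\<^sup>2 \<le> (l * a + b / l)\<^sup>2"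
    by (simp add: power_mult_distrib)
  then have "2 * r \<le> l * a + b / l"
    by (rule power2_le_imp_le) (use ab assms(2) in auto)
  then have "ennreal (2 * r) \<le> ennreal (l * a + b / l)" by (rule ennreal_leI)
  moreover have "2 * s = ennreal (2 * r)"
    using r by (simp add: ennreal_mult')
  moreover have "ennreal l * x + ennreal (1 / l) * y = ennreal (l * a + b / l)"
    using ab assms(2) by (simp add: ennreal_mult[symmetric])
  ultimately show ?thesis by simp
qed

lemma le_sqrt_if_amgm:
  fixes I X Y :: real
  assumes "I \<ge> 0" "X \<ge> 0" "Y \<ge> 0" and le: "\<And>l. l > 0 \<Longrightarrow> 2 * I \<le> l * X + Y / l"
  shows "I\<^sup>2 \<le> X * Y"
proof -
  have "I\<^sup>2 \<le> (X + e) * (Y + e)" if e: "e > 0" for e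
  proof -
    define l where "l = sqrt ((Y + e) / (X + e))"
    have l: "l > 0" and l2: "l\<^sup>2 = (Y + e) / (X + e)" using e assms by (auto simp: l_def)
    have "2 * I \<le> l * X + Y / l" by (rule le[OF l])
    also have "\<dots> \<le> l * (X + e) + (Y + e) / l"
      using l e by (intro add_mono mult_left_mono divide_right_mono) auto
    also have "(Y + e) / l = l * (X + e)"
      using l l2 e assms by (simp add: field_simps power2_eq_square)
    finally have "I \<le> l * (X + e)" by simp
    then have "I\<^sup>2 \<le> (l * (X + e))\<^sup>2" using assms by (intro power_mono) auto
    also have "\<dots> = (X + e) * (Y + e)"
      using l2 e assms by (simp add: power_mult_distrib field_simps power2_eq_square)
    finally show ?thesis .
  qed
  from le_at_zero_if_le_pos[of "\<lambda>e. (X + e) * (Y + e)", OF _ this]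
  show ?thesis by (simp add: continuous_intros)
qed

text \<open>For fixed \<open>z\<close>, the Cauchy-Schwarz inequality in \<open>(x, y)\<close> applied to \<open>s\<^sup>3 = s\<^sup>2 s\<close> leaves the integrals of \<open>s\<^sup>4\<close>, bounded by a product of a
  function of \<open>y\<close> and a function of \<open>x\<close>, and of \<open>s\<^sup>2\<close>, bounded by a function that is independent of \<open>z\<close>. The remaining
  integration in \<open>z\<close> is of the square root of a product, and the weighted mean inequality handles it (the
  Loomis-Whitney inequality).\<close>

lemma loomis_whitney_3:
  fixes s p q r :: "real \<times> real \<times> real \<Rightarrow> ennreal"
  assumes [measurable]: "s \<in> borel_measurable (borel \<Otimes>\<^sub>M borel \<Otimes>\<^sub>M borel)"
    "p \<in> borel_measurable (borel \<Otimes>\<^sub>M borel \<Otimes>\<^sub>M borel)"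
    "q \<in> borel_measurable (borel \<Otimes>\<^sub>M borel \<Otimes>\<^sub>M borel)"
    "r \<in> borel_measurable (borel \<Otimes>\<^sub>M borel \<Otimes>\<^sub>M borel)"
    and p: "\<And>x y z. (s (x, y, z))\<^sup>2 \<le> (\<integral>\<^sup>+x. p (x, y, z) \<partial>lborel)"
    and q: "\<And>x y z. (s (x, y, z))\<^sup>2 \<le> (\<integral>\<^sup>+y. q (x, y, z) \<partial>lborel)"
    and r: "\<And>x y z. (s (x, y, z))\<^sup>2 \<le> (\<integral>\<^sup>+z. r (x, y, z) \<partial>lborel)"
    and P: "(\<integral>\<^sup>+z. \<integral>\<^sup>+y. \<integral>\<^sup>+x. p (x, y, z) \<partial>lborel \<partial>lborel \<partial>lborel) \<le> ennreal A"
    and Q: "(\<integral>\<^sup>+z. \<integral>\<^sup>+x. \<integral>\<^sup>+y. q (x, y, z) \<partial>lborel \<partial>lborel \<partial>lborel) \<le> ennreal B"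
    and R: "(\<integral>\<^sup>+x. \<integral>\<^sup>+y. \<integral>\<^sup>+z. r (x, y, z) \<partial>lborel \<partial>lborel \<partial>lborel) \<le> ennreal C"
    and pos: "A \<ge> 0" "B \<ge> 0" "C \<ge> 0"
    and fin: "(\<integral>\<^sup>+z. \<integral>\<^sup>+x. \<integral>\<^sup>+y. (s (x, y, z)) ^ 3 \<partial>lborel \<partial>lborel \<partial>lborel) = ennreal I" "I \<ge> 0"
  shows "I\<^sup>2 \<le> A * B * C"
proof -
  let ?L = "lborel :: real measure"
  define a where "a z = (\<integral>\<^sup>+y. \<integral>\<^sup>+x. p (x, y, z) \<partial>?L \<partial>?L)" for z
  define b where "b z = (\<integral>\<^sup>+x. \<integral>\<^sup>+y. q (x, y, z) \<partial>?L \<partial>?L)" for z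
  define S where "S z = (\<integral>\<^sup>+x. \<integral>\<^sup>+y. (s (x, y, z)) ^ 3 \<partial>?L \<partial>?L)" for z
  have [measurable]: "a \<in> borel_measurable borel" "b \<in> borel_measurable borel" "S \<in> borel_measurable borel"
    unfolding a_def[abs_def] b_def[abs_def] S_def[abs_def] by measurable
  have S: "(S z)\<^sup>2 \<le> (a z * ennreal C) * b z" for z
  proof -
    have fst_eq: "(\<integral>\<^sup>+x. \<integral>\<^sup>+y. f (x, y) \<partial>?L \<partial>?L) = (\<integral>\<^sup>+w. f w \<partial>(?L \<Otimes>\<^sub>M ?L))"
      if "f \<in> borel_measurable (?L \<Otimes>\<^sub>M ?L)" for f :: "real \<times> real \<Rightarrow> ennreal"
      using that by (rule lborel.nn_integral_fst)
    have "(S z)\<^sup>2 = (\<integral>\<^sup>+w. (s (fst w, snd w, z))\<^sup>2 * s (fst w, snd w, z) \<partial>(?L \<Otimes>\<^sub>M ?L))\<^sup>2"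
      unfolding S_def by (subst fst_eq[symmetric]) (simp_all add: power3_eq_cube power2_eq_square mult.assoc)
    also have "\<dots> \<le> (\<integral>\<^sup>+w. ((s (fst w, snd w, z))\<^sup>2)\<^sup>2 \<partial>(?L \<Otimes>\<^sub>M ?L)) * (\<integral>\<^sup>+w. (s (fst w, snd w, z))\<^sup>2 \<partial>(?L \<Otimes>\<^sub>M ?L))"
      by (rule Cauchy_Schwarz_nn_integral) measurable
    also have "\<dots> \<le> (\<integral>\<^sup>+w. (\<integral>\<^sup>+x. p (x, snd w, z) \<partial>?L) * (\<integral>\<^sup>+y. q (fst w, y, z) \<partial>?L) \<partial>(?L \<Otimes>\<^sub>M ?L))
        * (\<integral>\<^sup>+w. (\<integral>\<^sup>+z. r (fst w, snd w, z) \<partial>?L) \<partial>(?L \<Otimes>\<^sub>M ?L))"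
      unfolding power2_eq_square[of "(_)\<^sup>2"] using p q r
      by (intro mult_mono nn_integral_mono) auto
    also have "(\<integral>\<^sup>+w. (\<integral>\<^sup>+z. r (fst w, snd w, z) \<partial>?L) \<partial>(?L \<Otimes>\<^sub>M ?L)) = (\<integral>\<^sup>+x. \<integral>\<^sup>+y. \<integral>\<^sup>+z. r (x, y, z) \<partial>?L \<partial>?L \<partial>?L)"
      by (subst fst_eq[symmetric]) simp_all
    also have "(\<integral>\<^sup>+w. (\<integral>\<^sup>+x. p (x, snd w, z) \<partial>?L) * (\<integral>\<^sup>+y. q (fst w, y, z) \<partial>?L) \<partial>(?L \<Otimes>\<^sub>M ?L))
        = (\<integral>\<^sup>+x'. \<integral>\<^sup>+y'. (\<integral>\<^sup>+x. p (x, y', z) \<partial>?L) * (\<integral>\<^sup>+y. q (x', y, z) \<partial>?L) \<partial>?L \<partial>?L)"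
      by (subst fst_eq[symmetric]) simp_all
    also have "\<dots> = a z * b z"
      by (simp add: nn_integral_multc nn_integral_cmult a_def b_def)
    also have "a z * b z * (\<integral>\<^sup>+x. \<integral>\<^sup>+y. \<integral>\<^sup>+z. r (x, y, z) \<partial>?L \<partial>?L \<partial>?L) \<le> a z * b z * ennreal C"
      using R by (intro mult_left_mono) auto
    finally show ?thesis by (simp add: mult_ac)
  qed
  have "2 * I \<le> l * (A * C) + B / l" if l: "l > 0" for l
  proof -
    have "2 * ennreal I = (\<integral>\<^sup>+z. 2 * S z \<partial>?L)"
      using fin by (simp add: nn_integral_cmult S_def)
    also have "\<dots> \<le> (\<integral>\<^sup>+z. ennreal l * (a z * ennreal C) + ennreal (1 / l) * b z \<partial>?L)"
      by (intro nn_integral_mono ennreal_amgm S l)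
    also have "\<dots> = ennreal l * ((\<integral>\<^sup>+z. a z \<partial>?L) * ennreal C) + ennreal (1 / l) * (\<integral>\<^sup>+z. b z \<partial>?L)"
      by (simp add: nn_integral_add nn_integral_cmult nn_integral_multc)
    also have "\<dots> \<le> ennreal l * (ennreal A * ennreal C) + ennreal (1 / l) * ennreal B"
      using P Q unfolding a_def b_def by (intro add_mono mult_left_mono mult_right_mono) auto
    also have "\<dots> = ennreal (l * (A * C) + B / l)"
      using pos l by (simp add: ennreal_mult'[symmetric] ennreal_plus[symmetric] del: ennreal_plus)
    finally have "ennreal (2 * I) \<le> ennreal (l * (A * C) + B / l)"
      using fin(2) by (simp add: ennreal_mult')
    then show ?thesis using pos l by (subst (asm) ennreal_le_iff) auto
  qed
  then have "I\<^sup>2 \<le> (A * C) * B"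
    using pos fin(2) by (intro le_sqrt_if_amgm) auto
  then show ?thesis by (simp add: mult_ac)
qed

text \<open>The fundamental theorem of calculus on the line through \<open>x\<close> in direction \<open>e\<close>, started outside the support.\<close>

lemma C1c_line_bound:
  fixes F :: "real^'n \<Rightarrow> real"
  assumes F: "F \<in> C1c UNIV" and e: "e \<noteq> 0"
  shows "ennreal \<bar>F (x + a *\<^sub>R e)\<bar> \<le> (\<integral>\<^sup>+t. ennreal \<bar>frechet_derivative F (at (x + t *\<^sub>R e)) e\<bar> \<partial>lborel)"
proof -
  define D where "D t = frechet_derivative F (at (x + t *\<^sub>R e)) e" for t
  have C1: "C1_fun F" and K: "compact (closure {x. F x \<noteq> 0})" using F by (auto simp: C1c_iff)
  obtain R where R: "\<And>y. y \<in> closure {x. F x \<noteq> 0} \<Longrightarrow> norm y \<le> R"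
    using compact_imp_bounded[OF K] by (auto simp: bounded_iff)
  \<comment> \<open>far enough along the line to leave the ball of radius \<open>R\<close>\<close>
  define b where "b = a - (R + norm (x + a *\<^sub>R e) + 1) / norm e"
  have R0: "R + norm (x + a *\<^sub>R e) + 1 > 0 \<or> closure {x. F x \<noteq> 0} = {}"
    using R norm_ge_zero by (smt (verit) ex_in_conv)
  have zero: "\<exists>b\<le>a. F (x + b *\<^sub>R e) = 0"
  proof (cases "closure {x. F x \<noteq> 0} = {}")
    case True
    then have "F (x + a *\<^sub>R e) = 0" by (intro C1c_zero_outside(1)[OF F]) simp
    then show ?thesis by blast
  next
    case False
    then have pos: "R + norm (x + a *\<^sub>R e) + 1 > 0" using R0 by blast
    have "norm (x + b *\<^sub>R e) > R"
    proof -
      have "x + b *\<^sub>R e = (x + a *\<^sub>R e) - ((R + norm (x + a *\<^sub>R e) + 1) / norm e) *\<^sub>R e"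
        by (simp add: b_def algebra_simps)
      then have "norm (x + b *\<^sub>R e) \<ge> norm (((R + norm (x + a *\<^sub>R e) + 1) / norm e) *\<^sub>R e) - norm (x + a *\<^sub>R e)"
        by (metis norm_minus_commute norm_triangle_ineq2)
      then show ?thesis using pos e by simp
    qed
    then have "x + b *\<^sub>R e \<notin> closure {x. F x \<noteq> 0}" using R by force
    then have "F (x + b *\<^sub>R e) = 0" by (rule C1c_zero_outside(1)[OF F])
    moreover have "b \<le> a" using pos e by (simp add: b_def)
    ultimately show ?thesis by blast
  qed
  then obtain c where c: "c \<le> a" "F (x + c *\<^sub>R e) = 0" by blast
  have cont: "continuous_on UNIV D"
    unfolding D_def
    by (rule continuous_on_compose2[OF C1_fun_continuous_deriv[OF C1, of UNIV e]]) (auto intro!: continuous_intros)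
  have deriv: "((\<lambda>s. F (x + s *\<^sub>R e)) has_real_derivative D s) (at s)" for s
    unfolding D_def by (rule C1_fun_has_derivative_line[OF C1])
  have bi: "has_bochner_integral lborel (\<lambda>t. D t * indicator {c..a} t) (F (x + a *\<^sub>R e) - F (x + c *\<^sub>R e))"
    using cont by (intro has_bochner_integral_FTC_Icc_real[OF c(1)] deriv) (simp add: continuous_on_eq_continuous_at)
  have "ennreal \<bar>F (x + a *\<^sub>R e)\<bar> = ennreal (norm (LINT t|lborel. D t * indicator {c..a} t))"
    using bi c(2) by (simp add: has_bochner_integral_integral_eq)
  also have "\<dots> \<le> (\<integral>\<^sup>+t. ennreal (norm (D t * indicator {c..a} t)) \<partial>lborel)"
    using bi by (intro integral_norm_bound_ennreal) (simp add: has_bochner_integral_iff)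
  also have "\<dots> \<le> (\<integral>\<^sup>+t. ennreal \<bar>D t\<bar> \<partial>lborel)"
    by (intro nn_integral_mono) (auto simp: indicator_def)
  finally show ?thesis by (simp add: D_def)
qed

lemma axis_1_Basis: "Basis = range (\<lambda>i. axis i (1::real))"
  by (auto simp: Basis_vec_def)

text \<open>Gagliardo's argument is applied to \<open>\<bar>\<psi>\<bar>\<^sup>2\<close> rather than to \<open>\<psi>\<close>: its partial derivatives are bounded by \<open>2 \<bar>\<psi>\<bar> \<bar>\<nabla>\<psi>\<bar>\<close>, whose
  integral is at most a product of \<open>L\<^sup>2\<close> norms.\<close>

lemma gagliardo_test_field:
  fixes \<psi> :: "real^'n \<Rightarrow> real^'n"
  assumes \<psi>: "\<psi> \<in> C1c UNIV"
    and D: "(\<integral>\<^sup>+x. ennreal (2 * norm (\<psi> x) * norm (classical_grad \<psi> x)) \<partial>lborel) \<le> ennreal A" "A \<ge> 0"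
  shows "CARD('n) = 2 \<Longrightarrow> (LINT x|lborel. norm (\<psi> x) ^ 4) \<le> A\<^sup>2"
    and "CARD('n) = 3 \<Longrightarrow> (LINT x|lborel. norm (\<psi> x) ^ 3)\<^sup>2 \<le> A ^ 3"
proof -
  define F where "F x = \<psi> x \<bullet> \<psi> x" for x
  define p where "p e x = ennreal \<bar>frechet_derivative F (at x) e\<bar>" for e x
  have C1: "C1_fun \<psi>" and K: "compact (closure {x. \<psi> x \<noteq> 0})" using \<psi> by (auto simp: C1c_iff)
  have F: "F \<in> C1c UNIV"
    by (rule C1c_smaller_support[OF _ _ \<psi>]) (auto simp: F_def[abs_def] intro: C1_fun_inner(1)[OF C1 C1])
  have C1F: "C1_fun F" using F by (simp add: C1c_iff)
  have contp: "continuous_on UNIV (\<lambda>x. frechet_derivative F (at x) e)" for e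
    by (rule C1_fun_continuous_deriv[OF C1F])
  have [measurable]: "p e \<in> borel_measurable borel" for e
    using borel_measurable_continuous_onI[OF contp[of e]] unfolding p_def[abs_def] by measurable
  have [measurable]: "\<psi> \<in> borel_measurable borel"
    using C1_fun_continuous[OF C1] by (rule borel_measurable_continuous_onI)
  have ple: "p e x \<le> ennreal (2 * norm (\<psi> x) * norm (classical_grad \<psi> x))" if "e \<in> Basis" for e x
  proof -
    obtain j where e: "e = axis j 1" using \<open>e \<in> Basis\<close> by (auto simp: axis_1_Basis)
    have "norm (frechet_derivative \<psi> (at x) e) \<le> norm (classical_grad \<psi> x)"
    proof -
      have "frechet_derivative \<psi> (at x) e = column j (classical_grad \<psi> x)"
        by (simp add: column_def classical_grad_def e vec_eq_iff)
      moreover have "norm (column j (classical_grad \<psi> x)) \<le> norm (classical_grad \<psi> x)"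
        unfolding norm_vec_def[of "column j _"] norm_vec_def[of "classical_grad \<psi> x"]
        by (rule L2_set_mono) (simp_all add: column_def component_le_norm_cart)
      ultimately show ?thesis by simp
    qed
    then have "\<bar>\<psi> x \<bullet> frechet_derivative \<psi> (at x) e\<bar> \<le> norm (\<psi> x) * norm (classical_grad \<psi> x)"
      by (intro order_trans[OF Cauchy_Schwarz_ineq2] mult_left_mono) auto
    then have "\<bar>frechet_derivative F (at x) e\<bar> \<le> 2 * norm (\<psi> x) * norm (classical_grad \<psi> x)"
      by (simp add: F_def[abs_def] C1_fun_inner(2)[OF C1 C1] inner_commute)
    then show ?thesis unfolding p_def by (rule ennreal_leI)
  qed
  have pA: "(\<integral>\<^sup>+x. p e x \<partial>lborel) \<le> ennreal A" if "e \<in> Basis" for e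
    using nn_integral_mono[of lborel "p e", OF ple[OF that]] D(1) by (rule order_trans)
  have s2: "(ennreal (norm (\<psi> (x + a *\<^sub>R e))))\<^sup>2 \<le> (\<integral>\<^sup>+t. p e (x + t *\<^sub>R e) \<partial>lborel)" if "e \<in> Basis" for x a e
    using C1c_line_bound[OF F, of e x a] nonzero_Basis[OF that]
    by (simp add: F_def p_def ennreal_power power2_norm_eq_inner)
  have int: "integrable lborel (\<lambda>x. norm (\<psi> x) ^ m)" if "m > 0" for m
  proof (rule integrable_continuous_compact_support[OF _ K])
    show "continuous_on UNIV (\<lambda>x. norm (\<psi> x) ^ m)"
      by (rule continuous_on_power[OF continuous_on_norm[OF C1_fun_continuous[OF C1]]])
    show "norm (\<psi> x) ^ m = 0" if "x \<notin> closure {x. \<psi> x \<noteq> 0}" for x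
      using C1c_zero_outside(1)[OF \<psi> that] \<open>m > 0\<close> by simp
  qed
  show "(LINT x|lborel. norm (\<psi> x) ^ 4) \<le> A\<^sup>2" if n: "CARD('n) = 2"
  proof -
    have "card (Basis :: (real^'n) set) = 2" using n by simp
    then obtain d e :: "real^'n" where B: "Basis = {d, e}" "d \<noteq> e" by (meson card_2_iff)
    have B': "Basis = {e, d}" "e \<noteq> d" using B by auto
    have inB: "d \<in> Basis" "e \<in> Basis" using B by auto
    have "ennreal (LINT x|lborel. norm (\<psi> x) ^ 4) = (\<integral>\<^sup>+x. ennreal (norm (\<psi> x) ^ 4) \<partial>lborel)"
      using int[of 4] by (intro nn_integral_eq_integral[symmetric]) auto
    also have "\<dots> = (\<integral>\<^sup>+y. \<integral>\<^sup>+x. ennreal (norm (\<psi> (x *\<^sub>R d + y *\<^sub>R e)) ^ 4) \<partial>lborel \<partial>lborel)"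
      by (rule nn_integral_lborel_2[OF _ B]) measurable
    also have "\<dots> \<le> (\<integral>\<^sup>+y. \<integral>\<^sup>+x. (\<integral>\<^sup>+t. p d (t *\<^sub>R d + y *\<^sub>R e) \<partial>lborel) * (\<integral>\<^sup>+t. p e (t *\<^sub>R e + x *\<^sub>R d) \<partial>lborel) \<partial>lborel \<partial>lborel)"
    proof (intro nn_integral_mono)
      fix x y
      have "ennreal (norm (\<psi> (x *\<^sub>R d + y *\<^sub>R e)) ^ 4) = (ennreal (norm (\<psi> (y *\<^sub>R e + x *\<^sub>R d))))\<^sup>2 * (ennreal (norm (\<psi> (x *\<^sub>R d + y *\<^sub>R e))))\<^sup>2"
        by (simp add: ennreal_power ennreal_mult[symmetric] add.commute power_add[symmetric])
      also have "\<dots> \<le> (\<integral>\<^sup>+t. p d (t *\<^sub>R d + y *\<^sub>R e) \<partial>lborel) * (\<integral>\<^sup>+t. p e (t *\<^sub>R e + x *\<^sub>R d) \<partial>lborel)"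
        using s2[OF inB(1), of "y *\<^sub>R e" x] s2[OF inB(2), of "x *\<^sub>R d" y]
        by (intro mult_mono) (auto simp: add.commute)
      finally show "ennreal (norm (\<psi> (x *\<^sub>R d + y *\<^sub>R e)) ^ 4) \<le> \<dots>" .
    qed
    also have "\<dots> = (\<integral>\<^sup>+y. \<integral>\<^sup>+t. p d (t *\<^sub>R d + y *\<^sub>R e) \<partial>lborel \<partial>lborel) * (\<integral>\<^sup>+x. \<integral>\<^sup>+t. p e (t *\<^sub>R e + x *\<^sub>R d) \<partial>lborel \<partial>lborel)"
      by (simp add: nn_integral_cmult nn_integral_multc)
    also have "\<dots> = (\<integral>\<^sup>+x. p d x \<partial>lborel) * (\<integral>\<^sup>+x. p e x \<partial>lborel)"
      by (subst nn_integral_lborel_2[OF _ B], measurable, subst nn_integral_lborel_2[OF _ B'], measurable)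
    also have "\<dots> \<le> ennreal A * ennreal A"
      by (intro mult_mono pA inB) auto
    also have "\<dots> = ennreal (A\<^sup>2)"
      using D(2) by (simp add: power2_eq_square ennreal_mult)
    finally show ?thesis by simp
  qed
  show "(LINT x|lborel. norm (\<psi> x) ^ 3)\<^sup>2 \<le> A ^ 3" if n: "CARD('n) = 3"
  proof -
    have "card (Basis :: (real^'n) set) = 3" using n by simp
    then obtain c d e :: "real^'n" where B: "Basis = {c, d, e}" "c \<noteq> d" "c \<noteq> e" "d \<noteq> e"
      by (metis card_3_iff)
    have inB: "c \<in> Basis" "d \<in> Basis" "e \<in> Basis" using B by auto
    define v where "v = (\<lambda>(x::real, y::real, z::real). x *\<^sub>R c + y *\<^sub>R d + z *\<^sub>R e)"
    have [measurable]: "v \<in> borel_measurable (borel \<Otimes>\<^sub>M borel \<Otimes>\<^sub>M borel)"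
      unfolding v_def by measurable
    have "(LINT x|lborel. norm (\<psi> x) ^ 3)\<^sup>2 \<le> A * A * A"
    proof (rule loomis_whitney_3[where s="\<lambda>w. ennreal (norm (\<psi> (v w)))" and p="\<lambda>w. p c (v w)"
          and q="\<lambda>w. p d (v w)" and r="\<lambda>w. p e (v w)"])
      fix x y z
      show "(ennreal (norm (\<psi> (v (x, y, z)))))\<^sup>2 \<le> (\<integral>\<^sup>+x. p c (v (x, y, z)) \<partial>lborel)"
        using s2[OF inB(1), of "y *\<^sub>R d + z *\<^sub>R e" x] by (simp add: v_def add_ac)
      show "(ennreal (norm (\<psi> (v (x, y, z)))))\<^sup>2 \<le> (\<integral>\<^sup>+y. p d (v (x, y, z)) \<partial>lborel)"
        using s2[OF inB(2), of "x *\<^sub>R c + z *\<^sub>R e" y] by (simp add: v_def add_ac)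
      show "(ennreal (norm (\<psi> (v (x, y, z)))))\<^sup>2 \<le> (\<integral>\<^sup>+z. p e (v (x, y, z)) \<partial>lborel)"
        using s2[OF inB(3), of "x *\<^sub>R c + y *\<^sub>R d" z] by (simp add: v_def add_ac)
    next
      have "(\<integral>\<^sup>+z. \<integral>\<^sup>+y. \<integral>\<^sup>+x. p c (v (x, y, z)) \<partial>lborel \<partial>lborel \<partial>lborel) = (\<integral>\<^sup>+x. p c x \<partial>lborel)"
        by (subst nn_integral_lborel_3[OF _ B]) (simp_all add: v_def)
      then show "(\<integral>\<^sup>+z. \<integral>\<^sup>+y. \<integral>\<^sup>+x. p c (v (x, y, z)) \<partial>lborel \<partial>lborel \<partial>lborel) \<le> ennreal A"
        using pA[OF inB(1)] by simp
      have "(\<integral>\<^sup>+z. \<integral>\<^sup>+x. \<integral>\<^sup>+y. p d (v (x, y, z)) \<partial>lborel \<partial>lborel \<partial>lborel) = (\<integral>\<^sup>+x. p d x \<partial>lborel)"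
        using B by (subst nn_integral_lborel_3[of _ d c e]) (auto simp: v_def add_ac)
      then show "(\<integral>\<^sup>+z. \<integral>\<^sup>+x. \<integral>\<^sup>+y. p d (v (x, y, z)) \<partial>lborel \<partial>lborel \<partial>lborel) \<le> ennreal A"
        using pA[OF inB(2)] by simp
      have "(\<integral>\<^sup>+x. \<integral>\<^sup>+y. \<integral>\<^sup>+z. p e (v (x, y, z)) \<partial>lborel \<partial>lborel \<partial>lborel) = (\<integral>\<^sup>+x. p e x \<partial>lborel)"
        using B by (subst nn_integral_lborel_3[of _ e d c]) (auto simp: v_def add_ac)
      then show "(\<integral>\<^sup>+x. \<integral>\<^sup>+y. \<integral>\<^sup>+z. p e (v (x, y, z)) \<partial>lborel \<partial>lborel \<partial>lborel) \<le> ennreal A"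
        using pA[OF inB(3)] by simp
      have "(\<integral>\<^sup>+z. \<integral>\<^sup>+x. \<integral>\<^sup>+y. (ennreal (norm (\<psi> (v (x, y, z))))) ^ 3 \<partial>lborel \<partial>lborel \<partial>lborel)
        = (\<integral>\<^sup>+x. ennreal (norm (\<psi> x) ^ 3) \<partial>lborel)"
        using B by (subst nn_integral_lborel_3[of _ d c e]) (auto simp: v_def add_ac ennreal_power)
      also have "\<dots> = ennreal (LINT x|lborel. norm (\<psi> x) ^ 3)"
        using int[of 3] by (intro nn_integral_eq_integral) auto
      finally show "(\<integral>\<^sup>+z. \<integral>\<^sup>+x. \<integral>\<^sup>+y. (ennreal (norm (\<psi> (v (x, y, z))))) ^ 3 \<partial>lborel \<partial>lborel \<partial>lborel)
        = ennreal (LINT x|lborel. norm (\<psi> x) ^ 3)" .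
      show "0 \<le> (LINT x|lborel. norm (\<psi> x) ^ 3)" by (intro integral_nonneg_AE) auto
    qed (use D(2) in measurable)
    then show ?thesis by (simp add: power3_eq_cube)
  qed
qed

lemma W1p3_imp_W1p2:
  assumes \<Omega>: "open \<Omega>" "bounded \<Omega>" and v: "v \<in> W1p \<Omega> 3"
  shows "v \<in> W1p \<Omega> 2"
proof -
  have "\<Omega> \<in> lmeasurable" using \<Omega> by (simp add: lmeasurable_open)
  from Lp3_imp_Lp2(1)[OF this W1p_wgrad(1)[OF v \<Omega>(1)]] Lp3_imp_Lp2(1)[OF this W1p_wgrad(2)[OF v \<Omega>(1)]]
  show ?thesis using W1p_wgrad(3)[OF v \<Omega>(1)] by (auto simp: W1p_def)
qed

text \<open>In dimension 3 the Gagliardo bound is already one for the \<open>L\<^sup>3\<close> norm. In dimension 2 it controls the \<open>L\<^sup>4\<close> norm, and splitting at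
  a level \<open>l\<close> near \<open>sqrt A\<close> trades \<open>L\<^sup>4\<close> for \<open>L\<^sup>3\<close> at the price of the measure of \<open>\<Omega>\<close>.\<close>

lemma gagliardo_nirenberg_C1c:
  fixes \<psi> :: "real^'n \<Rightarrow> real^'n"
  assumes n: "CARD('n) = 2 \<or> CARD('n) = 3" and \<Omega>: "open \<Omega>" "bounded \<Omega>" and \<psi>: "\<psi> \<in> C1c \<Omega>"
  shows "(Lp_norm \<Omega> 3 \<psi>)\<^sup>2 \<le> 2 * (measure lebesgue \<Omega> + 1)\<^sup>2 * Lp_norm \<Omega> 2 \<psi> * Lp_norm \<Omega> 2 (wgrad \<Omega> \<psi>)"
proof -
  let ?M = "lebesgue_on \<Omega>" and ?m = "measure lebesgue \<Omega>"
  have lm: "\<Omega> \<in> lmeasurable" and \<Omega>s: "\<Omega> \<in> sets lebesgue" using \<Omega> by (simp_all add: lmeasurable_open)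
  have C1: "C1_fun \<psi>" and K: "compact (closure {x. \<psi> x \<noteq> 0})" and K\<Omega>: "closure {x. \<psi> x \<noteq> 0} \<subseteq> \<Omega>"
    using \<psi> by (auto simp: C1c_iff)
  have W: "\<psi> \<in> W1p \<Omega> 2" "\<psi> \<in> W1p \<Omega> 3" using C1c_imp_W1p[OF \<psi> \<Omega>(1)] by simp_all
  note out = C1c_zero_outside(1)[OF \<psi>]
  have supp: "\<psi> x = 0" if "x \<notin> \<Omega>" for x using out K\<Omega> that by blast
  have \<psi>c: "continuous_on UNIV \<psi>" and gc: "continuous_on UNIV (classical_grad \<psi>)"
    using C1 by (auto intro: C1_fun_continuous continuous_classical_grad)
  have \<psi>m: "\<psi> \<in> borel_measurable borel" and gm: "classical_grad \<psi> \<in> borel_measurable borel"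
    using \<psi>c gc by (auto intro: borel_measurable_continuous_onI)
  have gAE: "AE x in ?M. wgrad \<Omega> \<psi> x = classical_grad \<psi> x" by (rule wgrad_C1[OF C1 \<Omega>(1)])
  have gL2: "classical_grad \<psi> \<in> Lp \<Omega> 2"
    using Lp_cong_AE[OF \<Omega>s W1p_wgrad(2)[OF W(1) \<Omega>(1)] gAE] .
  have gn: "Lp_norm \<Omega> 2 (wgrad \<Omega> \<psi>) = Lp_norm \<Omega> 2 (classical_grad \<psi>)"
    using Lp_norm_cong_AE[OF Lp_measurable[OF W1p_wgrad(2)[OF W(1) \<Omega>(1)]] Lp_measurable[OF gL2] gAE] .
  define A where "A = 2 * Lp_norm \<Omega> 2 \<psi> * Lp_norm \<Omega> 2 (wgrad \<Omega> \<psi>)"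
  have A0: "A \<ge> 0" by (simp add: A_def)
  let ?h = "\<lambda>x. 2 * norm (\<psi> x) * norm (classical_grad \<psi> x)"
  have hi: "integrable lborel ?h"
  proof (rule integrable_continuous_compact_support[OF _ K])
    show "continuous_on UNIV ?h" using \<psi>c gc by (intro continuous_intros) auto
    show "?h x = 0" if "x \<notin> closure {x. \<psi> x \<noteq> 0}" for x using out[OF that] by simp
  qed
  have "(\<integral>\<^sup>+x. ennreal (?h x) \<partial>lborel) = ennreal (LINT x|lborel. ?h x)"
    using hi by (intro nn_integral_eq_integral) auto
  also have "(LINT x|lborel. ?h x) = (LINT x|?M. ?h x)"
    using \<psi>m gm supp by (intro integral_lebesgue_on_support[symmetric] \<Omega>s) auto
  also have "\<dots> = 2 * (LINT x|?M. norm (\<psi> x) * norm (classical_grad \<psi> x))"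
    by (simp add: mult.assoc)
  also have "\<dots> \<le> A"
    using holder2(2)[OF W1p_wgrad(1)[OF W(1) \<Omega>(1)] gL2, of "\<lambda>x. norm (\<psi> x) * norm (classical_grad \<psi> x)"]
      Lp_measurable[OF W1p_wgrad(1)[OF W(1) \<Omega>(1)]] Lp_measurable[OF gL2]
    by (simp add: A_def gn)
  finally have hA: "(\<integral>\<^sup>+x. ennreal (?h x) \<partial>lborel) \<le> ennreal A"
    by (simp add: ennreal_leI)
  have \<psi>U: "\<psi> \<in> C1c UNIV" using C1c_mono[OF \<psi>] by simp
  have on\<Omega>: "(LINT x|lborel. norm (\<psi> x) ^ k) = (LINT x|?M. norm (\<psi> x) ^ k)" if "k > 0" for k
    using \<psi>m supp that by (intro integral_lebesgue_on_support[symmetric] \<Omega>s) auto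
  have "(Lp_norm \<Omega> 3 \<psi>)\<^sup>2 \<le> (?m + 1)\<^sup>2 * A"
    using n
  proof
    assume "CARD('n) = 3"
    from gagliardo_test_field(2)[OF \<psi>U hA A0 this]
    have "((Lp_norm \<Omega> 3 \<psi>)\<^sup>2) ^ 3 \<le> A ^ 3"
      unfolding on\<Omega>[of 3, simplified] Lp_norm_power3[symmetric] by (simp add: power_mult[symmetric])
    then have "(Lp_norm \<Omega> 3 \<psi>)\<^sup>2 \<le> A" using A0 by (subst (asm) power_mono_iff) auto
    also have "\<dots> \<le> (?m + 1)\<^sup>2 * A"
      using A0 mult_right_mono[of 1 "(?m + 1)\<^sup>2" A] by (simp add: one_le_power)
    finally show ?thesis .
  next
    assume "CARD('n) = 2"
    from gagliardo_test_field(1)[OF \<psi>U hA A0 this]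
    have I4: "(LINT x|?M. norm (\<psi> x) ^ 4) \<le> A\<^sup>2" by (simp add: on\<Omega>)
    have int4: "integrable ?M (\<lambda>x. norm (\<psi> x) ^ 4)"
      using Lp_integrable_powr[of \<psi> \<Omega> 4] W1p_wgrad(1)[OF C1c_imp_W1p[OF \<psi> \<Omega>(1), of 4] \<Omega>(1)] by simp
    interpret finite_measure ?M
      using lm by (rule finite_measure_lebesgue_on)
    have "(Lp_norm \<Omega> 3 \<psi>)\<^sup>2 \<le> (?m + 1)\<^sup>2 * (A + e)" if e: "e > 0" for e
    proof -
      define l where "l = sqrt (A + e)"
      have l: "l > 0" "l\<^sup>2 = A + e" using A0 e by (auto simp: l_def)
      have "Lp_norm \<Omega> 3 \<psi> ^ 3 \<le> (LINT x|?M. l ^ 3 + norm (\<psi> x) ^ 4 / l)"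
        unfolding Lp_norm_power3
      proof (rule integral_mono)
        show "integrable ?M (\<lambda>x. norm (\<psi> x) ^ 3)" by (rule Lp3_integrable[OF W1p_wgrad(1)[OF W(2) \<Omega>(1)]])
        show "integrable ?M (\<lambda>x. l ^ 3 + norm (\<psi> x) ^ 4 / l)" using int4 by simp
        show "norm (\<psi> x) ^ 3 \<le> l ^ 3 + norm (\<psi> x) ^ 4 / l" for x
          using powr_split_le[of 3 4 l "norm (\<psi> x)"] l by (simp add: powr_minus_divide)
      qed
      also have "\<dots> = ?m * l ^ 3 + (LINT x|?M. norm (\<psi> x) ^ 4) / l"
        using int4 lm by (simp add: measure_restrict_space)
      also have "\<dots> \<le> ?m * l ^ 3 + (l\<^sup>2)\<^sup>2 / l"
        using l e A0 by (intro add_left_mono divide_right_mono order_trans[OF I4] power_mono) auto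
      also have "\<dots> = (?m + 1) * l ^ 3"
        using l by (simp add: field_simps power2_eq_square power3_eq_cube)
      also have "\<dots> \<le> ((?m + 1) * l) ^ 3"
      proof -
        have "(?m + 1) ^ 1 \<le> (?m + 1) ^ 3" by (intro power_increasing) auto
        then show ?thesis using l by (simp add: power_mult_distrib mult_right_mono)
      qed
      finally have "Lp_norm \<Omega> 3 \<psi> \<le> (?m + 1) * l"
        using l by (subst (asm) power_mono_iff) auto
      then have "(Lp_norm \<Omega> 3 \<psi>)\<^sup>2 \<le> ((?m + 1) * l)\<^sup>2" by (intro power_mono) auto
      then show ?thesis by (simp add: power_mult_distrib l)
    qed
    from le_at_zero_if_le_pos[of "\<lambda>e. (?m + 1)\<^sup>2 * (A + e)", OF _ this]
    show ?thesis by (simp add: continuous_intros)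
  qed
  then show ?thesis by (simp add: A_def mult_ac)
qed

text \<open>All three norms are continuous in \<open>W\<^sup>1\<^sup>,\<^sup>3\<close> because \<open>\<Omega>\<close> has finite measure, and test fields are dense in \<open>X\<close>.\<close>

theorem gagliardo_nirenberg_Xspace:
  fixes v :: "real^'n \<Rightarrow> real^'n"
  assumes n: "CARD('n) = 2 \<or> CARD('n) = 3" and \<Omega>: "open \<Omega>" "bounded \<Omega>" and v: "v \<in> Xspace \<Omega>"
  shows "(Lp_norm \<Omega> 3 v)\<^sup>2 \<le> 2 * (measure lebesgue \<Omega> + 1)\<^sup>2 * Lp_norm \<Omega> 2 v * Lp_norm \<Omega> 2 (wgrad \<Omega> v)"
proof -
  have lm: "\<Omega> \<in> lmeasurable" using \<Omega> by (simp add: lmeasurable_open)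
  let ?c = "sqrt (measure lebesgue \<Omega> + 1)"
  obtain \<psi> where \<psi>: "\<And>k. \<psi> k \<in> C1c \<Omega>" "(\<lambda>k. W1p_norm \<Omega> 3 (\<lambda>x. \<psi> k x - v x)) \<longlonglongrightarrow> 0"
    using Xspace_approx[OF v] by blast
  have Wv: "v \<in> W1p \<Omega> 3" "v \<in> W1p \<Omega> 2" using Xspace_W1p[OF v] W1p3_imp_W1p2[OF \<Omega>] by auto
  have W\<psi>: "\<psi> k \<in> W1p \<Omega> 3" "\<psi> k \<in> W1p \<Omega> 2" for k
    using C1c_imp_W1p[OF \<psi>(1) \<Omega>(1)] by simp_all
  have d: "(\<lambda>x. \<psi> k x - v x) \<in> W1p \<Omega> 3" for k
    using W1p_diff[OF W\<psi>(1) Wv(1) \<Omega>(1)] by simp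
  have L2W: "Lp_norm \<Omega> 2 g \<le> ?c * W1p_norm \<Omega> 3 h" if "g \<in> Lp \<Omega> 3" "Lp_norm \<Omega> 3 g \<le> W1p_norm \<Omega> 3 h"
    for g :: "real^'n \<Rightarrow> 'x::euclidean_space" and h
    using Lp3_imp_Lp2(2)[OF lm that(1)] mult_left_mono[OF that(2), of ?c] by simp
  have 1: "(\<lambda>k. Lp_norm \<Omega> 3 (\<psi> k)) \<longlonglongrightarrow> Lp_norm \<Omega> 3 v"
  proof (rule Xspace_lipschitz_tendsto[OF \<psi>(2), where c=1])
    fix k
    show "\<bar>Lp_norm \<Omega> 3 (\<psi> k) - Lp_norm \<Omega> 3 v\<bar> \<le> 1 * W1p_norm \<Omega> 3 (\<lambda>x. \<psi> k x - v x)"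
      using Lp_norm_diff_le[of 3, OF _ W1p_wgrad(1)[OF W\<psi>(1)[of k] \<Omega>(1)] W1p_wgrad(1)[OF Wv(1) \<Omega>(1)]]
        Lp_norm_le_W1p_norm(1)[of \<Omega> 3 "\<lambda>x. \<psi> k x - v x"] by simp
  qed
  have 2: "(\<lambda>k. Lp_norm \<Omega> 2 (\<psi> k)) \<longlonglongrightarrow> Lp_norm \<Omega> 2 v"
  proof (rule Xspace_lipschitz_tendsto[OF \<psi>(2), where c="?c"])
    fix k
    show "\<bar>Lp_norm \<Omega> 2 (\<psi> k) - Lp_norm \<Omega> 2 v\<bar> \<le> ?c * W1p_norm \<Omega> 3 (\<lambda>x. \<psi> k x - v x)"
      using Lp_norm_diff_le[of 2, OF _ W1p_wgrad(1)[OF W\<psi>(2)[of k] \<Omega>(1)] W1p_wgrad(1)[OF Wv(2) \<Omega>(1)]]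
        L2W[OF W1p_wgrad(1)[OF d[of k] \<Omega>(1)] Lp_norm_le_W1p_norm(1)] by simp
  qed
  have 3: "(\<lambda>k. Lp_norm \<Omega> 2 (wgrad \<Omega> (\<psi> k))) \<longlonglongrightarrow> Lp_norm \<Omega> 2 (wgrad \<Omega> v)"
  proof (rule Xspace_lipschitz_tendsto[OF \<psi>(2), where c="?c" and F="\<lambda>v. Lp_norm \<Omega> 2 (wgrad \<Omega> v)"])
    fix k
    show "\<bar>Lp_norm \<Omega> 2 (wgrad \<Omega> (\<psi> k)) - Lp_norm \<Omega> 2 (wgrad \<Omega> v)\<bar> \<le> ?c * W1p_norm \<Omega> 3 (\<lambda>x. \<psi> k x - v x)"
      using Lp_norm_diff_le[of 2, OF _ W1p_wgrad(2)[OF W\<psi>(2)[of k] \<Omega>(1)] W1p_wgrad(2)[OF Wv(2) \<Omega>(1)]]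
        L2W[OF W1p_wgrad(2)[OF d[of k] \<Omega>(1)] Lp_norm_le_W1p_norm(2)]
      by (simp add: Lp_norm_wgrad_diff[OF W\<psi>(2)[of k] Wv(2) \<Omega>(1)])
  qed
  show ?thesis
    by (rule LIMSEQ_le[OF tendsto_power[OF 1] tendsto_mult[OF tendsto_mult[OF tendsto_const 2] 3]])
      (use gagliardo_nirenberg_C1c[OF n \<Omega> \<psi>(1)] in blast)
qed

section \<open>The energy inequality at a fixed time\<close>

text \<open>The density argument for bounded linear functionals: it extends the Navier-Stokes equations and the divergence theorem
  from test fields to \<open>X\<close>.\<close>

lemma Xspace_functional_zero:
  fixes L :: "(real^'n \<Rightarrow> real^'n) \<Rightarrow> real"
  assumes \<Omega>: "open \<Omega>" and v: "v \<in> Xspace \<Omega>"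
    and diff: "\<And>a b. a \<in> Xspace \<Omega> \<Longrightarrow> b \<in> Xspace \<Omega> \<Longrightarrow> L (\<lambda>x. a x - b x) = L a - L b"
    and bound: "\<And>a. a \<in> Xspace \<Omega> \<Longrightarrow> \<bar>L a\<bar> \<le> c * W1p_norm \<Omega> 3 a"
    and zero: "\<And>\<psi>. \<psi> \<in> C1c \<Omega> \<Longrightarrow> L \<psi> = 0"
  shows "L v = 0"
proof -
  obtain \<psi> where \<psi>: "\<And>k. \<psi> k \<in> C1c \<Omega>" "(\<lambda>k. W1p_norm \<Omega> 3 (\<lambda>x. \<psi> k x - v x)) \<longlonglongrightarrow> 0"
    using Xspace_approx[OF v] by blast
  have "(\<lambda>k. L (\<psi> k)) \<longlonglongrightarrow> L v"
  proof (rule Xspace_lipschitz_tendsto[OF \<psi>(2), where c=c])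
    fix k
    have "\<psi> k \<in> Xspace \<Omega>" by (rule C1c_imp_Xspace[OF \<psi>(1) \<Omega>])
    then show "\<bar>L (\<psi> k) - L v\<bar> \<le> c * W1p_norm \<Omega> 3 (\<lambda>x. \<psi> k x - v x)"
      using bound[OF Xspace_diff[OF _ v \<Omega>]] diff[OF _ v] by simp
  qed
  then show ?thesis by (simp add: zero[OF \<psi>(1)] LIMSEQ_const_iff)
qed

lemma norm_matrix_vector_mult_le:
  fixes A :: "real^'n^'m"
  shows "norm (A *v x) \<le> norm A * norm x"
proof -
  have "norm (A *v x) \<le> L2_set (\<lambda>i. norm (A $ i) * norm x) UNIV"
    unfolding norm_vec_def[of "A *v x"]
    by (rule L2_set_mono) (simp_all add: matrix_mult_dot Cauchy_Schwarz_ineq2)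
  also have "\<dots> = norm A * norm x"
    by (simp add: norm_vec_def[of A] L2_set_left_distrib)
  finally show ?thesis .
qed

lemma borel_measurable_vec_component:
  fixes f :: "'a \<Rightarrow> 'b::euclidean_space^'n"
  assumes "f \<in> borel_measurable M" shows "(\<lambda>x. f x $ i) \<in> borel_measurable M"
  by (rule borel_measurable_continuous_on[OF _ assms]) (intro continuous_intros)

lemma borel_measurable_matrix_vector_mult:
  fixes A :: "'a \<Rightarrow> real^'n^'n"
  assumes "A \<in> borel_measurable M" "f \<in> borel_measurable M"
  shows "(\<lambda>x. A x *v f x) \<in> borel_measurable M"
proof -
  have "bounded_bilinear (\<lambda>(A::real^'n^'n) x. A *v x)"
    by (rule bounded_bilinear.intro)
      (auto simp: matrix_vector_mult_add_rdistrib matrix_vector_right_distrib scaleR_matrix_vector_assoc matrix_vector_mult_scaleR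
        intro!: exI[of _ 1] norm_matrix_vector_mult_le)
  from bounded_bilinear.continuous_on[OF this continuous_on_fst[OF continuous_on_id] continuous_on_snd[OF continuous_on_id]]
  show ?thesis
    using borel_measurable_continuous_Pair[OF assms, of "\<lambda>A x. A *v x"] by simp
qed

lemma convective_holder:
  fixes G :: "real^'n \<Rightarrow> real^'n^'n"
  assumes G: "G \<in> Lp \<Omega> 3" and a: "a \<in> Lp \<Omega> 3" and b: "b \<in> Lp \<Omega> 3"
  shows "integrable (lebesgue_on \<Omega>) (\<lambda>x. (G x *v a x) \<bullet> b x)"
    and "\<bar>LINT x|lebesgue_on \<Omega>. (G x *v a x) \<bullet> b x\<bar> \<le> Lp_norm \<Omega> 3 G * Lp_norm \<Omega> 3 a * Lp_norm \<Omega> 3 b"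
proof -
  have m: "(\<lambda>x. (G x *v a x) \<bullet> b x) \<in> borel_measurable (lebesgue_on \<Omega>)"
    using borel_measurable_matrix_vector_mult[OF Lp_measurable[OF G] Lp_measurable[OF a]] Lp_measurable[OF b]
    by (rule borel_measurable_inner)
  have le: "\<bar>(G x *v a x) \<bullet> b x\<bar> \<le> norm (G x) * norm (a x) * norm (b x)" for x
    by (intro order_trans[OF Cauchy_Schwarz_ineq2] mult_right_mono norm_matrix_vector_mult_le) auto
  show "integrable (lebesgue_on \<Omega>) (\<lambda>x. (G x *v a x) \<bullet> b x)"
    "\<bar>LINT x|lebesgue_on \<Omega>. (G x *v a x) \<bullet> b x\<bar> \<le> Lp_norm \<Omega> 3 G * Lp_norm \<Omega> 3 a * Lp_norm \<Omega> 3 b"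
    by (rule holder3[OF G a b m le])+
qed

lemma abs_trace_le: "\<bar>trace A\<bar> \<le> real CARD('n) * norm (A :: real^'n^'n)"
proof -
  have "\<bar>A $ i $ i\<bar> \<le> norm A" for i
    using component_le_norm_cart[of "A $ i" i] Finite_Cartesian_Product.norm_nth_le[of A i] by (rule order_trans)
  then have "\<bar>trace A\<bar> \<le> (\<Sum>i\<in>(UNIV::'n set). norm A)"
    unfolding trace_def by (intro order_trans[OF sum_abs] sum_mono)
  then show ?thesis by simp
qed

lemma borel_measurable_trace:
  fixes G :: "'a \<Rightarrow> real^'n^'n"
  assumes "G \<in> borel_measurable M" shows "(\<lambda>x. trace (G x)) \<in> borel_measurable M"
  unfolding trace_def by (intro borel_measurable_sum borel_measurable_vec_component assms)

lemma wdiv_L2: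
  fixes v :: "real^'n \<Rightarrow> real^'n"
  assumes v: "v \<in> W1p \<Omega> 2" and \<Omega>: "open \<Omega>"
  shows "wdiv \<Omega> v \<in> Lp \<Omega> 2" "Lp_norm \<Omega> 2 (wdiv \<Omega> v) \<le> real CARD('n) * Lp_norm \<Omega> 2 (wgrad \<Omega> v)"
proof -
  note g = W1p_wgrad(2)[OF v \<Omega>]
  have m: "wdiv \<Omega> v \<in> borel_measurable (lebesgue_on \<Omega>)"
    unfolding wdiv_def[abs_def] by (rule borel_measurable_trace[OF Lp_measurable[OF g]])
  have le: "(norm (wdiv \<Omega> v x))\<^sup>2 \<le> (real CARD('n))\<^sup>2 * (norm (wgrad \<Omega> v x))\<^sup>2" for x
    using power_mono[OF abs_trace_le[of "wgrad \<Omega> v x"], of 2] by (simp add: wdiv_def power_mult_distrib)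
  have int: "integrable (lebesgue_on \<Omega>) (\<lambda>x. (real CARD('n))\<^sup>2 * (norm (wgrad \<Omega> v x))\<^sup>2)"
    using Lp2_integrable[OF g] by simp
  show L: "wdiv \<Omega> v \<in> Lp \<Omega> 2"
  proof (rule Lp2I[OF m])
    show "integrable (lebesgue_on \<Omega>) (\<lambda>x. (norm (wdiv \<Omega> v x))\<^sup>2)"
      by (rule Bochner_Integration.integrable_bound[OF int]) (use m le in auto)
  qed
  have "(Lp_norm \<Omega> 2 (wdiv \<Omega> v))\<^sup>2 \<le> (real CARD('n) * Lp_norm \<Omega> 2 (wgrad \<Omega> v))\<^sup>2"
    unfolding power_mult_distrib Lp_norm_power2 integral_mult_right_zero[symmetric]
    by (rule integral_mono[OF Lp2_integrable[OF L] int le])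
  then show "Lp_norm \<Omega> 2 (wdiv \<Omega> v) \<le> real CARD('n) * Lp_norm \<Omega> 2 (wgrad \<Omega> v)"
    by (rule power2_le_imp_le) simp
qed

lemma wdiv_diff:
  assumes v: "v \<in> W1p \<Omega> p" and w: "w \<in> W1p \<Omega> q" and \<Omega>: "open \<Omega>"
  shows "AE x in lebesgue_on \<Omega>. wdiv \<Omega> (\<lambda>x. v x - w x) x = wdiv \<Omega> v x - wdiv \<Omega> w x"
  using wgrad_diff[OF v w \<Omega>] by eventually_elim (simp add: wdiv_def trace_sub)

text \<open>The representative \<^const>\<open>wgrad\<close> is linear only up to null sets, which the pairings do not see.\<close>

lemma L2_inner_wgrad_diff:
  assumes G: "G \<in> Lp \<Omega> 2" and v: "v \<in> W1p \<Omega> 2" and w: "w \<in> W1p \<Omega> 2" and \<Omega>: "open \<Omega>"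
  shows "L2_inner \<Omega> G (wgrad \<Omega> (\<lambda>x. v x - w x)) = L2_inner \<Omega> G (wgrad \<Omega> v) - L2_inner \<Omega> G (wgrad \<Omega> w)"
proof -
  have d: "(\<lambda>x. v x - w x) \<in> W1p \<Omega> 2" by (rule W1p_diff[OF v w \<Omega>]) simp
  have D: "(\<lambda>x. wgrad \<Omega> v x - wgrad \<Omega> w x) \<in> Lp \<Omega> 2"
    by (rule Lp_diff[OF _ W1p_wgrad(2)[OF v \<Omega>] W1p_wgrad(2)[OF w \<Omega>]]) simp
  have "L2_inner \<Omega> G (wgrad \<Omega> (\<lambda>x. v x - w x)) = L2_inner \<Omega> G (\<lambda>x. wgrad \<Omega> v x - wgrad \<Omega> w x)"
    by (rule L2_inner_cong_AE[OF Lp_measurable[OF G] Lp_measurable[OF G] Lp_measurable[OF W1p_wgrad(2)[OF d \<Omega>]]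
          Lp_measurable[OF D] _ wgrad_diff[OF v w \<Omega>]]) simp
  also have "\<dots> = L2_inner \<Omega> G (wgrad \<Omega> v) - L2_inner \<Omega> G (wgrad \<Omega> w)"
    by (rule L2_inner_diff_right[OF G W1p_wgrad(2)[OF v \<Omega>] W1p_wgrad(2)[OF w \<Omega>]])
  finally show ?thesis .
qed

lemma L2_inner_wdiv_diff:
  assumes q: "q \<in> Lp \<Omega> 2" and v: "v \<in> W1p \<Omega> 2" and w: "w \<in> W1p \<Omega> 2" and \<Omega>: "open \<Omega>"
  shows "L2_inner \<Omega> q (wdiv \<Omega> (\<lambda>x. v x - w x)) = L2_inner \<Omega> q (wdiv \<Omega> v) - L2_inner \<Omega> q (wdiv \<Omega> w)"
proof -
  have d: "(\<lambda>x. v x - w x) \<in> W1p \<Omega> 2" by (rule W1p_diff[OF v w \<Omega>]) simp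
  have D: "(\<lambda>x. wdiv \<Omega> v x - wdiv \<Omega> w x) \<in> Lp \<Omega> 2"
    by (rule Lp_diff[OF _ wdiv_L2(1)[OF v \<Omega>] wdiv_L2(1)[OF w \<Omega>]]) simp
  have "L2_inner \<Omega> q (wdiv \<Omega> (\<lambda>x. v x - w x)) = L2_inner \<Omega> q (\<lambda>x. wdiv \<Omega> v x - wdiv \<Omega> w x)"
    by (rule L2_inner_cong_AE[OF Lp_measurable[OF q] Lp_measurable[OF q] Lp_measurable[OF wdiv_L2(1)[OF d \<Omega>]]
          Lp_measurable[OF D] _ wdiv_diff[OF v w \<Omega>]]) simp
  also have "\<dots> = L2_inner \<Omega> q (wdiv \<Omega> v) - L2_inner \<Omega> q (wdiv \<Omega> w)"
    by (rule L2_inner_diff_right[OF q wdiv_L2(1)[OF v \<Omega>] wdiv_L2(1)[OF w \<Omega>]])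
  finally show ?thesis .
qed

lemma L2_norm_le_W13_norm:
  assumes \<Omega>: "open \<Omega>" "bounded \<Omega>" and v: "v \<in> W1p \<Omega> 3"
  shows "Lp_norm \<Omega> 2 v \<le> sqrt (measure lebesgue \<Omega> + 1) * W1p_norm \<Omega> 3 v"
    and "Lp_norm \<Omega> 2 (wgrad \<Omega> v) \<le> sqrt (measure lebesgue \<Omega> + 1) * W1p_norm \<Omega> 3 v"
proof -
  have lm: "\<Omega> \<in> lmeasurable" using \<Omega> by (simp add: lmeasurable_open)
  show "Lp_norm \<Omega> 2 v \<le> sqrt (measure lebesgue \<Omega> + 1) * W1p_norm \<Omega> 3 v"
    by (rule order_trans[OF Lp3_imp_Lp2(2)[OF lm W1p_wgrad(1)[OF v \<Omega>(1)]] mult_left_mono[OF Lp_norm_le_W1p_norm(1)]]) simp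
  show "Lp_norm \<Omega> 2 (wgrad \<Omega> v) \<le> sqrt (measure lebesgue \<Omega> + 1) * W1p_norm \<Omega> 3 v"
    by (rule order_trans[OF Lp3_imp_Lp2(2)[OF lm W1p_wgrad(2)[OF v \<Omega>(1)]] mult_left_mono[OF Lp_norm_le_W1p_norm(2)]]) simp
qed

lemma integral_wdiv_C1c:
  fixes \<psi> :: "real^'n \<Rightarrow> real^'n"
  assumes \<psi>: "\<psi> \<in> C1c \<Omega>" and \<Omega>: "open \<Omega>"
  shows "(LINT x|lebesgue_on \<Omega>. wdiv \<Omega> \<psi> x) = 0"
proof -
  have C1: "C1_fun \<psi>" and K: "compact (closure {x. \<psi> x \<noteq> 0})" "closure {x. \<psi> x \<noteq> 0} \<subseteq> \<Omega>"
    using \<psi> by (auto simp: C1c_iff)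
  let ?d = "\<lambda>i x. frechet_derivative (\<lambda>x. \<psi> x $ i) (at x) (axis i 1)"
  have C1i: "(\<lambda>x. \<psi> x $ i) \<in> C1c \<Omega>" for i
    by (rule C1c_component[OF \<psi> bounded_linear_vec_nth])
  have di: "?d i x = classical_grad \<psi> x $ i $ i" for i x
    by (simp add: classical_grad_def C1_fun_bounded_linear_compose(2)[OF bounded_linear_vec_nth C1])
  have zero: "?d i x = 0" if "x \<notin> closure {x. \<psi> x \<noteq> 0}" for i x
    using C1c_zero_outside(2)[OF \<psi> that] unfolding di by (simp add: classical_grad_def)
  have cont: "continuous_on UNIV (?d i)" for i
    using C1i[of i] by (intro C1_fun_continuous_deriv) (simp add: C1c_iff)
  have int: "integrable lborel (?d i)" for i
    by (rule integrable_continuous_compact_support[OF cont K(1) zero])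
  have AE: "AE x in lebesgue_on \<Omega>. wdiv \<Omega> \<psi> x = (\<Sum>i\<in>UNIV. ?d i x)"
    using wgrad_C1[OF C1 \<Omega>] by eventually_elim (simp add: wdiv_def trace_def di)
  have m: "(\<lambda>x. \<Sum>i\<in>UNIV. ?d i x) \<in> borel_measurable borel"
    using cont by (intro borel_measurable_sum borel_measurable_continuous_onI) auto
  have m': "(\<lambda>x. \<Sum>i\<in>UNIV. ?d i x) \<in> borel_measurable (lebesgue_on \<Omega>)"
    using cont \<Omega> by (intro continuous_imp_measurable_on_sets_lebesgue continuous_on_sum continuous_on_subset[OF cont]) auto
  have mw: "wdiv \<Omega> \<psi> \<in> borel_measurable (lebesgue_on \<Omega>)"
    by (rule Lp_measurable[OF wdiv_L2(1)[OF C1c_imp_W1p[OF \<psi> \<Omega>] \<Omega>]]) simp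
  have "(LINT x|lebesgue_on \<Omega>. wdiv \<Omega> \<psi> x) = (LINT x|lebesgue_on \<Omega>. (\<Sum>i\<in>UNIV. ?d i x))"
    by (rule integral_cong_AE[OF mw m' AE])
  also have "\<dots> = (LINT x|lborel. (\<Sum>i\<in>UNIV. ?d i x))"
  proof (rule integral_lebesgue_on_support[OF _ m])
    show "\<Omega> \<in> sets lebesgue" using \<Omega> by simp
    show "(\<Sum>i\<in>UNIV. ?d i x) = 0" if "x \<notin> \<Omega>" for x
      using zero[of x] K(2) that by (intro sum.neutral) blast
  qed
  also have "\<dots> = (\<Sum>i\<in>UNIV. (LINT x|lborel. ?d i x))"
    by (rule Bochner_Integration.integral_sum[OF int])
  also have "\<dots> = 0"
    using integral_directional_derivative_eq_0[OF C1c_mono[OF C1i subset_UNIV]] by simp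
  finally show ?thesis .
qed

lemma integral_wdiv_Xspace:
  fixes v :: "real^'n \<Rightarrow> real^'n"
  assumes \<Omega>: "open \<Omega>" "bounded \<Omega>" and v: "v \<in> Xspace \<Omega>"
  shows "(LINT x|lebesgue_on \<Omega>. wdiv \<Omega> v x) = 0"
proof -
  have lm: "\<Omega> \<in> lmeasurable" using \<Omega> by (simp add: lmeasurable_open)
  have one: "(\<lambda>x. 1::real) \<in> Lp \<Omega> 2"
    using finite_measure.integrable_const[OF finite_measure_lebesgue_on[OF lm]] by (simp add: Lp_def)
  have eq: "(LINT x|lebesgue_on \<Omega>. wdiv \<Omega> v x) = L2_inner \<Omega> (\<lambda>x. 1) (wdiv \<Omega> v)" for v
    by (simp add: L2_inner_def)
  show ?thesis
  proof (rule Xspace_functional_zero[OF \<Omega>(1) v])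
    fix a b :: "real^'n \<Rightarrow> real^'n" assume a: "a \<in> Xspace \<Omega>" and b: "b \<in> Xspace \<Omega>"
    show "(LINT x|lebesgue_on \<Omega>. wdiv \<Omega> (\<lambda>x. a x - b x) x)
      = (LINT x|lebesgue_on \<Omega>. wdiv \<Omega> a x) - (LINT x|lebesgue_on \<Omega>. wdiv \<Omega> b x)"
      unfolding eq
      by (rule L2_inner_wdiv_diff[OF one W1p3_imp_W1p2[OF \<Omega> Xspace_W1p[OF a]] W1p3_imp_W1p2[OF \<Omega> Xspace_W1p[OF b]] \<Omega>(1)])
  next
    fix a :: "real^'n \<Rightarrow> real^'n" assume a: "a \<in> Xspace \<Omega>"
    note a2 = W1p3_imp_W1p2[OF \<Omega> Xspace_W1p[OF a]]
    have "\<bar>LINT x|lebesgue_on \<Omega>. wdiv \<Omega> a x\<bar> \<le> Lp_norm \<Omega> 2 (\<lambda>x. 1::real) * Lp_norm \<Omega> 2 (wdiv \<Omega> a)"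
      unfolding eq by (rule L2_inner_le[OF one wdiv_L2(1)[OF a2 \<Omega>(1)]])
    also have "\<dots> \<le> Lp_norm \<Omega> 2 (\<lambda>x. 1::real) * (real CARD('n) * (sqrt (measure lebesgue \<Omega> + 1) * W1p_norm \<Omega> 3 a))"
      by (intro mult_left_mono order_trans[OF wdiv_L2(2)[OF a2 \<Omega>(1)]] L2_norm_le_W13_norm(2)[OF \<Omega> Xspace_W1p[OF a]]) auto
    finally show "\<bar>LINT x|lebesgue_on \<Omega>. wdiv \<Omega> a x\<bar> \<le> (Lp_norm \<Omega> 2 (\<lambda>x. 1::real) * real CARD('n) * sqrt (measure lebesgue \<Omega> + 1)) * W1p_norm \<Omega> 3 a"
      by (simp only: mult.assoc)
  next
    fix \<psi> :: "real^'n \<Rightarrow> real^'n" assume "\<psi> \<in> C1c \<Omega>"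
    then show "(LINT x|lebesgue_on \<Omega>. wdiv \<Omega> \<psi> x) = 0" by (rule integral_wdiv_C1c[OF _ \<Omega>(1)])
  qed
qed

text \<open>The divergence of a field in \<open>X\<close> has mean value zero, so it is an admissible pressure, and the weak
  incompressibility condition can be tested with it.\<close>

lemma wdiv_zero_if_weakly_divergence_free:
  fixes v :: "real^'n \<Rightarrow> real^'n"
  assumes \<Omega>: "open \<Omega>" "bounded \<Omega>" and v: "v \<in> Xspace \<Omega>"
    and q: "\<And>q. q \<in> Qspace \<Omega> \<Longrightarrow> L2_inner \<Omega> q (wdiv \<Omega> v) = 0"
  shows "AE x in lebesgue_on \<Omega>. wdiv \<Omega> v x = 0"
proof -
  have L: "wdiv \<Omega> v \<in> Lp \<Omega> 2" by (rule wdiv_L2(1)[OF W1p3_imp_W1p2[OF \<Omega> Xspace_W1p[OF v]] \<Omega>(1)])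
  have "wdiv \<Omega> v \<in> Qspace \<Omega>"
    using L integral_wdiv_Xspace[OF \<Omega> v] by (simp add: Qspace_def)
  from q[OF this] have "(LINT x|lebesgue_on \<Omega>. (norm (wdiv \<Omega> v x))\<^sup>2) = 0"
    by (simp add: L2_inner_self Lp_norm_power2)
  then have "AE x in lebesgue_on \<Omega>. (norm (wdiv \<Omega> v x))\<^sup>2 = 0"
    using integral_nonneg_eq_0_iff_AE[OF Lp2_integrable[OF L]] by simp
  then show ?thesis by simp
qed

text \<open>For divergence free \<open>u\<close> the transport term does no work: \<open>((u \<cdot> \<nabla>) v, v) = \<integral> u \<cdot> \<nabla>\<bar>v\<bar>\<^sup>2 / 2\<close>, which is the pairing of
  \<open>u\<close> with a gradient of a test function when \<open>v\<close> is a test field.\<close>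

lemma convective_skew_C1c:
  fixes u \<psi> :: "real^'n \<Rightarrow> real^'n"
  assumes \<Omega>: "open \<Omega>" and u: "u \<in> W1p \<Omega> 3" and div: "AE x in lebesgue_on \<Omega>. wdiv \<Omega> u x = 0"
    and \<psi>: "\<psi> \<in> C1c \<Omega>"
  shows "(LINT x|lebesgue_on \<Omega>. (wgrad \<Omega> \<psi> x *v u x) \<bullet> \<psi> x) = 0"
proof -
  let ?M = "lebesgue_on \<Omega>"
  have C1: "C1_fun \<psi>" using \<psi> by (simp add: C1c_iff)
  define \<eta> where "\<eta> x = \<psi> x \<bullet> \<psi> x" for x
  have \<eta>: "\<eta> \<in> C1c \<Omega>"
    by (rule C1c_smaller_support[OF _ _ \<psi>]) (auto simp: \<eta>_def[abs_def] intro: C1_fun_inner(1)[OF C1 C1])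
  have wu: "has_weak_grad \<Omega> u (wgrad \<Omega> u)" by (rule W1p_wgrad(3)[OF u \<Omega>])
  have loc: "locally_integrable \<Omega> (\<lambda>x. u x $ j)" "locally_integrable \<Omega> (\<lambda>x. wgrad \<Omega> u x $ j $ j)" for j
    using wu by (auto simp: has_weak_grad_def
        intro: locally_integrable_bounded_linear[OF _ bounded_linear_vec_nth] locally_integrable_bounded_linear[OF _ bounded_linear_entry])
  note int = weak_grad_integrable(2)[OF \<Omega> loc(1) \<eta>] weak_grad_integrable(1)[OF \<Omega> loc(2) \<eta>]
  have pt: "(classical_grad \<psi> x *v u x) \<bullet> \<psi> x = (1/2) * (\<Sum>j\<in>UNIV. u x $ j * frechet_derivative \<eta> (at x) (axis j 1))" for x
  proof -
    have "frechet_derivative \<eta> (at x) (axis j 1) = 2 * (\<Sum>i\<in>UNIV. classical_grad \<psi> x $ i $ j * \<psi> x $ i)" for j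
    proof -
      have "frechet_derivative \<eta> (at x) (axis j 1) = 2 * (frechet_derivative \<psi> (at x) (axis j 1) \<bullet> \<psi> x)"
        unfolding \<eta>_def[abs_def] C1_fun_inner(2)[OF C1 C1] by (simp add: inner_commute)
      then show ?thesis by (simp add: inner_vec_def classical_grad_def)
    qed
    then have "(1/2) * (\<Sum>j\<in>UNIV. u x $ j * frechet_derivative \<eta> (at x) (axis j 1))
      = (\<Sum>j\<in>UNIV. \<Sum>i\<in>UNIV. u x $ j * (classical_grad \<psi> x $ i $ j * \<psi> x $ i))"
      by (simp add: sum_distrib_left)
    also have "\<dots> = (\<Sum>i\<in>UNIV. \<Sum>j\<in>UNIV. u x $ j * (classical_grad \<psi> x $ i $ j * \<psi> x $ i))"
      by (rule sum.swap)
    also have "\<dots> = (classical_grad \<psi> x *v u x) \<bullet> \<psi> x"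
      by (simp add: inner_vec_def matrix_vector_mult_def sum_distrib_left sum_distrib_right mult_ac)
    finally show ?thesis by simp
  qed
  have W: "\<psi> \<in> W1p \<Omega> 3" using C1c_imp_W1p[OF \<psi> \<Omega>] by simp
  have AE: "AE x in ?M. (wgrad \<Omega> \<psi> x *v u x) \<bullet> \<psi> x = (1/2) * (\<Sum>j\<in>UNIV. u x $ j * frechet_derivative \<eta> (at x) (axis j 1))"
    using wgrad_C1[OF C1 \<Omega>] by eventually_elim (simp add: pt)
  have "(LINT x|?M. (wgrad \<Omega> \<psi> x *v u x) \<bullet> \<psi> x) = (LINT x|?M. (1/2) * (\<Sum>j\<in>UNIV. u x $ j * frechet_derivative \<eta> (at x) (axis j 1)))"
    by (rule integral_cong_AE[OF _ _ AE])
      (use convective_holder(1)[OF W1p_wgrad(2)[OF W \<Omega>] W1p_wgrad(1)[OF u \<Omega>] W1p_wgrad(1)[OF W \<Omega>]] int(1) in auto)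
  also have "\<dots> = (1/2) * (\<Sum>j\<in>UNIV. (LINT x|?M. u x $ j * frechet_derivative \<eta> (at x) (axis j 1)))"
    using int(1) by simp
  also have "\<dots> = (1/2) * (\<Sum>j\<in>UNIV. - (LINT x|?M. wgrad \<Omega> u x $ j $ j * \<eta> x))"
    using wu \<eta> by (simp add: has_weak_grad_def)
  also have "\<dots> = - (1/2) * (LINT x|?M. (\<Sum>j\<in>UNIV. wgrad \<Omega> u x $ j $ j * \<eta> x))"
    using int(2) by (simp add: sum_negf)
  also have "(LINT x|?M. (\<Sum>j\<in>UNIV. wgrad \<Omega> u x $ j $ j * \<eta> x)) = 0"
    by (rule integral_eq_zero_AE, use div in eventually_elim) (simp add: wdiv_def trace_def sum_distrib_right[symmetric])
  finally show ?thesis by simp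
qed

lemma convective_skew:
  fixes u v :: "real^'n \<Rightarrow> real^'n"
  assumes \<Omega>: "open \<Omega>" and u: "u \<in> W1p \<Omega> 3" and div: "AE x in lebesgue_on \<Omega>. wdiv \<Omega> u x = 0"
    and v: "v \<in> Xspace \<Omega>"
  shows "(LINT x|lebesgue_on \<Omega>. (wgrad \<Omega> v x *v u x) \<bullet> v x) = 0"
proof -
  let ?M = "lebesgue_on \<Omega>"
  define T where "T a = (LINT x|?M. (wgrad \<Omega> a x *v u x) \<bullet> a x)" for a
  obtain \<psi> where \<psi>: "\<And>k. \<psi> k \<in> C1c \<Omega>" "(\<lambda>k. W1p_norm \<Omega> 3 (\<lambda>x. \<psi> k x - v x)) \<longlonglongrightarrow> 0"
    using Xspace_approx[OF v] by blast
  define d where "d k = W1p_norm \<Omega> 3 (\<lambda>x. \<psi> k x - v x)" for k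
  let ?u = "Lp_norm \<Omega> 3 u" and ?v = "W1p_norm \<Omega> 3 v"
  have Wv: "v \<in> W1p \<Omega> 3" by (rule Xspace_W1p[OF v])
  have W\<psi>: "\<psi> k \<in> W1p \<Omega> 3" for k using C1c_imp_W1p[OF \<psi>(1) \<Omega>] by simp
  have Wd: "(\<lambda>x. \<psi> k x - v x) \<in> W1p \<Omega> 3" for k using W1p_diff[OF W\<psi> Wv \<Omega>] by simp
  note Lu = W1p_wgrad(1)[OF u \<Omega>]
  have key: "\<bar>T (\<psi> k) - T v\<bar> \<le> d k * ?u * (?v + d k) + ?v * ?u * d k" for k
  proof -
    note i1 = convective_holder[OF W1p_wgrad(2)[OF Wd[of k] \<Omega>] Lu W1p_wgrad(1)[OF W\<psi>[of k] \<Omega>]]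
    note i2 = convective_holder[OF W1p_wgrad(2)[OF Wv \<Omega>] Lu W1p_wgrad(1)[OF Wd[of k] \<Omega>]]
    note i3 = convective_holder(1)[OF W1p_wgrad(2)[OF W\<psi>[of k] \<Omega>] Lu W1p_wgrad(1)[OF W\<psi>[of k] \<Omega>]]
    note i4 = convective_holder(1)[OF W1p_wgrad(2)[OF Wv \<Omega>] Lu W1p_wgrad(1)[OF Wv \<Omega>]]
    have "T (\<psi> k) - T v = (LINT x|?M. (wgrad \<Omega> (\<psi> k) x *v u x) \<bullet> \<psi> k x - (wgrad \<Omega> v x *v u x) \<bullet> v x)"
      unfolding T_def using i3 i4 by simp
    also have "\<dots> = (LINT x|?M. (wgrad \<Omega> (\<lambda>x. \<psi> k x - v x) x *v u x) \<bullet> \<psi> k x + (wgrad \<Omega> v x *v u x) \<bullet> (\<psi> k x - v x))"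
    proof (rule integral_cong_AE)
      show "AE x in ?M. (wgrad \<Omega> (\<psi> k) x *v u x) \<bullet> \<psi> k x - (wgrad \<Omega> v x *v u x) \<bullet> v x
        = (wgrad \<Omega> (\<lambda>x. \<psi> k x - v x) x *v u x) \<bullet> \<psi> k x + (wgrad \<Omega> v x *v u x) \<bullet> (\<psi> k x - v x)"
        using wgrad_diff[OF W\<psi>[of k] Wv \<Omega>]
        by eventually_elim (simp add: matrix_vector_mult_diff_rdistrib inner_diff_left inner_diff_right)
    qed (use i1(1) i2(1) i3 i4 in auto)
    also have "\<dots> = (LINT x|?M. (wgrad \<Omega> (\<lambda>x. \<psi> k x - v x) x *v u x) \<bullet> \<psi> k x) + (LINT x|?M. (wgrad \<Omega> v x *v u x) \<bullet> (\<psi> k x - v x))"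
      using i1(1) i2(1) by simp
    finally have "\<bar>T (\<psi> k) - T v\<bar> \<le> Lp_norm \<Omega> 3 (wgrad \<Omega> (\<lambda>x. \<psi> k x - v x)) * ?u * Lp_norm \<Omega> 3 (\<psi> k)
        + Lp_norm \<Omega> 3 (wgrad \<Omega> v) * ?u * Lp_norm \<Omega> 3 (\<lambda>x. \<psi> k x - v x)"
      using i1(2) i2(2) by linarith
    also have "\<dots> \<le> d k * ?u * (?v + d k) + ?v * ?u * d k"
    proof -
      have "Lp_norm \<Omega> 3 (\<psi> k) \<le> ?v + d k"
        using W1p_norm_diff_le[OF W\<psi>[of k] Wv \<Omega>] Lp_norm_le_W1p_norm(1)[of \<Omega> 3 "\<psi> k"] by (simp add: d_def)
      then show ?thesis
        unfolding d_def by (intro add_mono mult_mono Lp_norm_le_W1p_norm) auto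
    qed
    finally show ?thesis .
  qed
  have "(\<lambda>k. T (\<psi> k) - T v) \<longlonglongrightarrow> 0"
  proof (rule Lim_null_comparison)
    show "\<forall>\<^sub>F k in sequentially. norm (T (\<psi> k) - T v) \<le> d k * ?u * (?v + d k) + ?v * ?u * d k"
      using key by simp
    have "(\<lambda>k. d k * ?u * (?v + d k) + ?v * ?u * d k) \<longlonglongrightarrow> 0 * ?u * (?v + 0) + ?v * ?u * 0"
      using \<psi>(2) unfolding d_def by (intro tendsto_intros)
    then show "(\<lambda>k. d k * ?u * (?v + d k) + ?v * ?u * d k) \<longlonglongrightarrow> 0" by simp
  qed
  moreover have "T (\<psi> k) = 0" for k
    unfolding T_def by (rule convective_skew_C1c[OF \<Omega> u div \<psi>(1)])
  ultimately have "T v = 0" by (simp add: LIMSEQ_const_iff)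
  then show ?thesis by (simp add: T_def)
qed

text \<open>All terms of the Navier-Stokes equations are bounded on \<open>X\<close>, so the equation extends from test fields to \<open>X\<close>.\<close>

lemma nse_tested_in_Xspace:
  fixes u ut v f :: "real^'n \<Rightarrow> real^'n"
  assumes \<Omega>: "open \<Omega>" "bounded \<Omega>" and f: "body_force \<Omega> f"
    and u: "u \<in> W1p \<Omega> 3" and ut: "ut \<in> Lp \<Omega> 2" and p: "p \<in> Lp \<Omega> 2" and v: "v \<in> Xspace \<Omega>"
    and nse: "\<And>\<psi>. \<psi> \<in> C1c \<Omega> \<Longrightarrow> L2_inner \<Omega> ut \<psi> + L2_inner \<Omega> (convect \<Omega> u) \<psi>
           + \<nu> * L2_inner \<Omega> (wgrad \<Omega> u) (wgrad \<Omega> \<psi>) - L2_inner \<Omega> p (wdiv \<Omega> \<psi>) = L2_inner \<Omega> f \<psi>"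
  shows "L2_inner \<Omega> ut v + L2_inner \<Omega> (convect \<Omega> u) v
           + \<nu> * L2_inner \<Omega> (wgrad \<Omega> u) (wgrad \<Omega> v) - L2_inner \<Omega> p (wdiv \<Omega> v) = L2_inner \<Omega> f v"
proof -
  obtain cf where cf: "\<And>v. v \<in> Xspace \<Omega> \<Longrightarrow> \<bar>L2_inner \<Omega> f v\<bar> \<le> cf * W1p_norm \<Omega> 3 v"
    and fi: "\<And>v. v \<in> Xspace \<Omega> \<Longrightarrow> integrable (lebesgue_on \<Omega>) (\<lambda>x. f x \<bullet> v x)"
    using f by (auto simp: body_force_def)
  have u2: "u \<in> W1p \<Omega> 2" by (rule W1p3_imp_W1p2[OF \<Omega> u])
  note gu2 = W1p_wgrad(2)[OF u2 \<Omega>(1)] and gu3 = W1p_wgrad(2)[OF u \<Omega>(1)] and u3 = W1p_wgrad(1)[OF u \<Omega>(1)]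
  let ?s = "sqrt (measure lebesgue \<Omega> + 1)"
  define L where "L v = L2_inner \<Omega> ut v + L2_inner \<Omega> (convect \<Omega> u) v
           + \<nu> * L2_inner \<Omega> (wgrad \<Omega> u) (wgrad \<Omega> v) - L2_inner \<Omega> p (wdiv \<Omega> v) - L2_inner \<Omega> f v" for v
  define c where "c = Lp_norm \<Omega> 2 ut * ?s + Lp_norm \<Omega> 3 (wgrad \<Omega> u) * Lp_norm \<Omega> 3 u
    + \<bar>\<nu>\<bar> * (Lp_norm \<Omega> 2 (wgrad \<Omega> u) * ?s) + Lp_norm \<Omega> 2 p * (real CARD('n) * ?s) + cf"
  have "L v = 0"
  proof (rule Xspace_functional_zero[OF \<Omega>(1) v])
    fix a b :: "real^'n \<Rightarrow> real^'n" assume a: "a \<in> Xspace \<Omega>" and b: "b \<in> Xspace \<Omega>"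
    note a3 = Xspace_W1p[OF a] and b3 = Xspace_W1p[OF b]
    note a2 = W1p3_imp_W1p2[OF \<Omega> a3] and b2 = W1p3_imp_W1p2[OF \<Omega> b3]
    have e1: "L2_inner \<Omega> (convect \<Omega> u) (\<lambda>x. a x - b x) = L2_inner \<Omega> (convect \<Omega> u) a - L2_inner \<Omega> (convect \<Omega> u) b"
      using convective_holder(1)[OF gu3 u3 W1p_wgrad(1)[OF a3 \<Omega>(1)]] convective_holder(1)[OF gu3 u3 W1p_wgrad(1)[OF b3 \<Omega>(1)]]
      by (simp add: L2_inner_def convect_def inner_diff_right)
    have e2: "L2_inner \<Omega> f (\<lambda>x. a x - b x) = L2_inner \<Omega> f a - L2_inner \<Omega> f b"
      using fi[OF a] fi[OF b] by (simp add: L2_inner_def inner_diff_right)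
    show "L (\<lambda>x. a x - b x) = L a - L b"
      unfolding L_def e1 e2 L2_inner_diff_right[OF ut W1p_wgrad(1)[OF a2 \<Omega>(1)] W1p_wgrad(1)[OF b2 \<Omega>(1)]]
        L2_inner_wgrad_diff[OF gu2 a2 b2 \<Omega>(1)] L2_inner_wdiv_diff[OF p a2 b2 \<Omega>(1)]
      by (simp add: right_diff_distrib)
  next
    fix a :: "real^'n \<Rightarrow> real^'n" assume a: "a \<in> Xspace \<Omega>"
    note a3 = Xspace_W1p[OF a]
    note a2 = W1p3_imp_W1p2[OF \<Omega> a3]
    let ?w = "W1p_norm \<Omega> 3 a"
    have 1: "\<bar>L2_inner \<Omega> ut a\<bar> \<le> Lp_norm \<Omega> 2 ut * (?s * ?w)"
      by (rule order_trans[OF L2_inner_le[OF ut W1p_wgrad(1)[OF a2 \<Omega>(1)]] mult_left_mono[OF L2_norm_le_W13_norm(1)[OF \<Omega> a3]]]) simp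
    have 2: "\<bar>L2_inner \<Omega> (convect \<Omega> u) a\<bar> \<le> Lp_norm \<Omega> 3 (wgrad \<Omega> u) * Lp_norm \<Omega> 3 u * ?w"
      unfolding L2_inner_def convect_def
      by (rule order_trans[OF convective_holder(2)[OF gu3 u3 W1p_wgrad(1)[OF a3 \<Omega>(1)]] mult_left_mono[OF Lp_norm_le_W1p_norm(1)]]) simp
    have 3: "\<bar>\<nu> * L2_inner \<Omega> (wgrad \<Omega> u) (wgrad \<Omega> a)\<bar> \<le> \<bar>\<nu>\<bar> * (Lp_norm \<Omega> 2 (wgrad \<Omega> u) * (?s * ?w))"
      unfolding abs_mult
      by (intro mult_left_mono order_trans[OF L2_inner_le[OF gu2 W1p_wgrad(2)[OF a2 \<Omega>(1)]] mult_left_mono[OF L2_norm_le_W13_norm(2)[OF \<Omega> a3]]]) auto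
    have 4: "\<bar>L2_inner \<Omega> p (wdiv \<Omega> a)\<bar> \<le> Lp_norm \<Omega> 2 p * (real CARD('n) * (?s * ?w))"
      by (rule order_trans[OF L2_inner_le[OF p wdiv_L2(1)[OF a2 \<Omega>(1)]]],
          intro mult_left_mono order_trans[OF wdiv_L2(2)[OF a2 \<Omega>(1)]] L2_norm_le_W13_norm(2)[OF \<Omega> a3]) auto
    have "\<bar>L a\<bar> \<le> Lp_norm \<Omega> 2 ut * (?s * ?w) + Lp_norm \<Omega> 3 (wgrad \<Omega> u) * Lp_norm \<Omega> 3 u * ?w
      + \<bar>\<nu>\<bar> * (Lp_norm \<Omega> 2 (wgrad \<Omega> u) * (?s * ?w)) + Lp_norm \<Omega> 2 p * (real CARD('n) * (?s * ?w)) + cf * ?w"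
      unfolding L_def using 1 2 3 4 cf[OF a] by linarith
    also have "\<dots> = c * ?w" by (simp add: c_def algebra_simps)
    finally show "\<bar>L a\<bar> \<le> c * ?w" .
  next
    fix \<psi> :: "real^'n \<Rightarrow> real^'n" assume "\<psi> \<in> C1c \<Omega>"
    from nse[OF this] show "L \<psi> = 0" by (simp add: L_def)
  qed
  then show ?thesis by (simp add: L_def)
qed

lemma smag_holder:
  fixes u v :: "real^'n \<Rightarrow> real^'n"
  assumes u: "u \<in> W1p \<Omega> 3" and v: "v \<in> W1p \<Omega> 3" and \<Omega>: "open \<Omega>"
  shows "integrable (lebesgue_on \<Omega>) (\<lambda>x. smag \<Omega> u x \<bullet> wgrad \<Omega> v x)"
    and "\<bar>L2_inner \<Omega> (smag \<Omega> u) (wgrad \<Omega> v)\<bar> \<le> (Lp_norm \<Omega> 3 (wgrad \<Omega> u))\<^sup>2 * Lp_norm \<Omega> 3 (wgrad \<Omega> v)"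
proof -
  note gu = W1p_wgrad(2)[OF u \<Omega>] and gv = W1p_wgrad(2)[OF v \<Omega>]
  have m: "(\<lambda>x. smag \<Omega> u x \<bullet> wgrad \<Omega> v x) \<in> borel_measurable (lebesgue_on \<Omega>)"
    using Lp_measurable[OF gu] Lp_measurable[OF gv] unfolding smag_def by measurable
  have le: "\<bar>smag \<Omega> u x \<bullet> wgrad \<Omega> v x\<bar> \<le> norm (wgrad \<Omega> u x) * norm (wgrad \<Omega> u x) * norm (wgrad \<Omega> v x)" for x
    by (rule order_trans[OF Cauchy_Schwarz_ineq2]) (simp add: smag_def)
  show "integrable (lebesgue_on \<Omega>) (\<lambda>x. smag \<Omega> u x \<bullet> wgrad \<Omega> v x)"
    by (rule holder3(1)[OF gu gu gv m le])
  show "\<bar>L2_inner \<Omega> (smag \<Omega> u) (wgrad \<Omega> v)\<bar> \<le> (Lp_norm \<Omega> 3 (wgrad \<Omega> u))\<^sup>2 * Lp_norm \<Omega> 3 (wgrad \<Omega> v)"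
    using holder3(2)[OF gu gu gv m le] by (simp add: L2_inner_def power2_eq_square)
qed

text \<open>Both pressure terms vanish because \<open>\<phi>\<close> is divergence free, and the difference of the convective terms is
  \<open>(u \<cdot> \<nabla>) \<phi> + (\<phi> \<cdot> \<nabla>) w\<close>, whose first part does no work.\<close>

lemma error_energy_identity:
  fixes u w ut wt f :: "real^'n \<Rightarrow> real^'n"
  assumes \<Omega>: "open \<Omega>" "bounded \<Omega>" and f: "body_force \<Omega> f"
    and u: "u \<in> Xspace \<Omega>" and w: "w \<in> Xspace \<Omega>"
    and ut: "ut \<in> W1p \<Omega> 2" and wt: "wt \<in> W1p \<Omega> 2" and p: "p \<in> Lp \<Omega> 2" and q: "q \<in> Qspace \<Omega>"
    and nse: "\<And>\<psi>. \<psi> \<in> C1c \<Omega> \<Longrightarrow> L2_inner \<Omega> ut \<psi> + L2_inner \<Omega> (convect \<Omega> u) \<psi>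
           + \<nu> * L2_inner \<Omega> (wgrad \<Omega> u) (wgrad \<Omega> \<psi>) - L2_inner \<Omega> p (wdiv \<Omega> \<psi>) = L2_inner \<Omega> f \<psi>"
    and divu: "AE x in lebesgue_on \<Omega>. wdiv \<Omega> u x = 0"
    and divw: "\<And>q. q \<in> Qspace \<Omega> \<Longrightarrow> L2_inner \<Omega> q (wdiv \<Omega> w) = 0"
    and csm: "csm_weak_form \<Omega> \<nu> Cs \<delta> \<mu> f w wt q (\<lambda>x. u x - w x)"
  defines "\<phi> \<equiv> \<lambda>x. u x - w x"
  shows "L2_inner \<Omega> ut \<phi> - L2_inner \<Omega> wt \<phi> - Cs^4 / \<mu>^2 * \<delta>^2 * L2_inner \<Omega> (wgrad \<Omega> wt) (wgrad \<Omega> \<phi>)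
      + \<nu> * (Lp_norm \<Omega> 2 (wgrad \<Omega> \<phi>))\<^sup>2 + (LINT x|lebesgue_on \<Omega>. (wgrad \<Omega> w x *v \<phi> x) \<bullet> \<phi> x)
      = (Cs * \<delta>)\<^sup>2 * L2_inner \<Omega> (smag \<Omega> w) (wgrad \<Omega> \<phi>)"
proof -
  let ?M = "lebesgue_on \<Omega>"
  have \<phi>: "\<phi> \<in> Xspace \<Omega>" unfolding \<phi>_def by (rule Xspace_diff[OF u w \<Omega>(1)])
  note u3 = Xspace_W1p[OF u] and w3 = Xspace_W1p[OF w] and \<phi>3 = Xspace_W1p[OF \<phi>]
  note u2 = W1p3_imp_W1p2[OF \<Omega> u3] and w2 = W1p3_imp_W1p2[OF \<Omega> w3] and \<phi>2 = W1p3_imp_W1p2[OF \<Omega> \<phi>3]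
  have nse\<phi>: "L2_inner \<Omega> ut \<phi> + L2_inner \<Omega> (convect \<Omega> u) \<phi>
           + \<nu> * L2_inner \<Omega> (wgrad \<Omega> u) (wgrad \<Omega> \<phi>) - L2_inner \<Omega> p (wdiv \<Omega> \<phi>) = L2_inner \<Omega> f \<phi>"
    by (rule nse_tested_in_Xspace[OF \<Omega> f u3 W1p_wgrad(1)[OF ut \<Omega>(1)] p \<phi> nse])
  have divw0: "AE x in ?M. wdiv \<Omega> w x = 0"
    by (rule wdiv_zero_if_weakly_divergence_free[OF \<Omega> w divw])
  have div\<phi>: "AE x in ?M. wdiv \<Omega> \<phi> x = 0"
    using wdiv_diff[OF u3 w3 \<Omega>(1)] divu divw0 unfolding \<phi>_def by eventually_elim simp
  have pressure: "L2_inner \<Omega> r (wdiv \<Omega> \<phi>) = 0" for r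
    unfolding L2_inner_def by (rule integral_eq_zero_AE, use div\<phi> in eventually_elim) simp
  have visc: "L2_inner \<Omega> (wgrad \<Omega> u) (wgrad \<Omega> \<phi>) - L2_inner \<Omega> (wgrad \<Omega> w) (wgrad \<Omega> \<phi>) = (Lp_norm \<Omega> 2 (wgrad \<Omega> \<phi>))\<^sup>2"
    using L2_inner_wgrad_diff[OF W1p_wgrad(2)[OF \<phi>2 \<Omega>(1)] u2 w2 \<Omega>(1), folded \<phi>_def]
      L2_inner_self[of \<Omega> "wgrad \<Omega> \<phi>"] L2_inner_commute[of \<Omega> "wgrad \<Omega> u" "wgrad \<Omega> \<phi>"]
      L2_inner_commute[of \<Omega> "wgrad \<Omega> w" "wgrad \<Omega> \<phi>"] by linarith
  have conv: "L2_inner \<Omega> (convect \<Omega> u) \<phi> - L2_inner \<Omega> (convect \<Omega> w) \<phi> = (LINT x|?M. (wgrad \<Omega> w x *v \<phi> x) \<bullet> \<phi> x)"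
  proof -
    note g = W1p_wgrad(2)[OF _ \<Omega>(1)] and l = W1p_wgrad(1)[OF _ \<Omega>(1)]
    note i1 = convective_holder(1)[OF g[OF u3] l[OF u3] l[OF \<phi>3]]
    note i2 = convective_holder(1)[OF g[OF w3] l[OF w3] l[OF \<phi>3]]
    note i3 = convective_holder(1)[OF g[OF \<phi>3] l[OF u3] l[OF \<phi>3]]
    note i4 = convective_holder(1)[OF g[OF w3] l[OF \<phi>3] l[OF \<phi>3]]
    have "L2_inner \<Omega> (convect \<Omega> u) \<phi> - L2_inner \<Omega> (convect \<Omega> w) \<phi>
      = (LINT x|?M. (wgrad \<Omega> u x *v u x) \<bullet> \<phi> x - (wgrad \<Omega> w x *v w x) \<bullet> \<phi> x)"
      unfolding L2_inner_def convect_def using i1 i2 by simp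
    also have "\<dots> = (LINT x|?M. (wgrad \<Omega> \<phi> x *v u x) \<bullet> \<phi> x + (wgrad \<Omega> w x *v \<phi> x) \<bullet> \<phi> x)"
    proof (rule integral_cong_AE)
      show "AE x in ?M. (wgrad \<Omega> u x *v u x) \<bullet> \<phi> x - (wgrad \<Omega> w x *v w x) \<bullet> \<phi> x
        = (wgrad \<Omega> \<phi> x *v u x) \<bullet> \<phi> x + (wgrad \<Omega> w x *v \<phi> x) \<bullet> \<phi> x"
        using wgrad_diff[OF u3 w3 \<Omega>(1)]
        by eventually_elim
          (simp add: \<phi>_def matrix_vector_mult_diff_rdistrib matrix_vector_mult_diff_distrib inner_diff_left)
    qed (use i1 i2 i3 i4 in auto)
    also have "\<dots> = (LINT x|?M. (wgrad \<Omega> \<phi> x *v u x) \<bullet> \<phi> x) + (LINT x|?M. (wgrad \<Omega> w x *v \<phi> x) \<bullet> \<phi> x)"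
      using i3 i4 by simp
    finally show ?thesis by (simp add: convective_skew[OF \<Omega>(1) u3 divu \<phi>])
  qed
  have sm: "L2_inner \<Omega> (\<lambda>x. (Cs * \<delta>)\<^sup>2 *\<^sub>R smag \<Omega> w x) (wgrad \<Omega> \<phi>) = (Cs * \<delta>)\<^sup>2 * L2_inner \<Omega> (smag \<Omega> w) (wgrad \<Omega> \<phi>)"
    by (simp add: L2_inner_def)
  have "\<nu> * L2_inner \<Omega> (wgrad \<Omega> u) (wgrad \<Omega> \<phi>) - \<nu> * L2_inner \<Omega> (wgrad \<Omega> w) (wgrad \<Omega> \<phi>) = \<nu> * (Lp_norm \<Omega> 2 (wgrad \<Omega> \<phi>))\<^sup>2"
    by (simp add: visc[symmetric] right_diff_distrib)
  then show ?thesis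
    using csm[folded \<phi>_def] nse\<phi> conv unfolding csm_weak_form_def sm pressure by linarith
qed

text \<open>A form of Young's inequality in which the share \<open>c b\<^sup>3\<close> to be absorbed is prescribed: distinguish whether \<open>b\<close> exceeds \<open>a / sqrt c\<close>.\<close>

lemma young_cubic:
  fixes a b c :: real
  assumes "a \<ge> 0" "b \<ge> 0" "c > 0"
  shows "a\<^sup>2 * b \<le> a ^ 3 / sqrt c + c * b ^ 3"
proof (cases "b \<le> a / sqrt c")
  case True
  then have "a\<^sup>2 * b \<le> a\<^sup>2 * (a / sqrt c)" by (intro mult_left_mono) auto
  then have "a\<^sup>2 * b \<le> a ^ 3 / sqrt c" by (simp add: power2_eq_square power3_eq_cube mult.assoc)
  moreover have "0 \<le> c * b ^ 3" using assms by simp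
  ultimately show ?thesis by linarith
next
  case False
  then have "a \<le> sqrt c * b" using assms by (simp add: field_simps)
  then have "a\<^sup>2 \<le> (sqrt c * b)\<^sup>2" using assms by (intro power_mono) auto
  then have "a\<^sup>2 * b \<le> (sqrt c * b)\<^sup>2 * b" using assms by (intro mult_right_mono) auto
  also have "\<dots> = c * b ^ 3" using assms by (simp add: power_mult_distrib power2_eq_square power3_eq_cube)
  finally show ?thesis using assms by (simp add: add_increasing)
qed

text \<open>Absorbing: the convective term into the viscous one, the Smagorinsky term of \<open>u\<close> into the monotone part, and the
  consistency error of the time derivative into the energy.\<close>

lemma error_energy_inequality:
  fixes u w ut wt f :: "real^'n \<Rightarrow> real^'n"
  assumes n: "CARD('n) = 2 \<or> CARD('n) = 3"
    and \<Omega>: "open \<Omega>" "bounded \<Omega>" and f: "body_force \<Omega> f"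
    and mono: "strong_monotonicity \<Omega> C1" and C1: "C1 > 0" and \<nu>: "\<nu> > 0"
    and u: "u \<in> Xspace \<Omega>" and w: "w \<in> Xspace \<Omega>"
    and ut: "ut \<in> W1p \<Omega> 2" and wt: "wt \<in> W1p \<Omega> 2" and p: "p \<in> Lp \<Omega> 2" and q: "q \<in> Qspace \<Omega>"
    and nse: "\<And>\<psi>. \<psi> \<in> C1c \<Omega> \<Longrightarrow> L2_inner \<Omega> ut \<psi> + L2_inner \<Omega> (convect \<Omega> u) \<psi>
           + \<nu> * L2_inner \<Omega> (wgrad \<Omega> u) (wgrad \<Omega> \<psi>) - L2_inner \<Omega> p (wdiv \<Omega> \<psi>) = L2_inner \<Omega> f \<psi>"
    and divu: "AE x in lebesgue_on \<Omega>. wdiv \<Omega> u x = 0"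
    and divw: "\<And>q. q \<in> Qspace \<Omega> \<Longrightarrow> L2_inner \<Omega> q (wdiv \<Omega> w) = 0"
    and csm: "csm_weak_form \<Omega> \<nu> Cs \<delta> \<mu> f w wt q (\<lambda>x. u x - w x)"
  defines "\<phi> \<equiv> \<lambda>x. u x - w x"
  defines "K \<equiv> Cs^4 / \<mu>^2 * \<delta>^2"
  defines "S \<equiv> 2 * (measure lebesgue \<Omega> + 1)\<^sup>2"
  shows "L2_inner \<Omega> ut \<phi> - L2_inner \<Omega> wt \<phi>
      + K * (L2_inner \<Omega> (wgrad \<Omega> ut) (wgrad \<Omega> \<phi>) - L2_inner \<Omega> (wgrad \<Omega> wt) (wgrad \<Omega> \<phi>))
      + (\<nu> / 2 * (Lp_norm \<Omega> 2 (wgrad \<Omega> \<phi>))\<^sup>2 + C1 / 2 * (Cs * \<delta>)\<^sup>2 * Lp_norm \<Omega> 3 (wgrad \<Omega> \<phi>) ^ 3)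
      \<le> (1 + S\<^sup>2 / \<nu> * (Lp_norm \<Omega> 3 (wgrad \<Omega> w))\<^sup>2) * (1 / 2 * ((Lp_norm \<Omega> 2 \<phi>)\<^sup>2 + K * (Lp_norm \<Omega> 2 (wgrad \<Omega> \<phi>))\<^sup>2))
        + (1 + 1 / sqrt (C1 / 2)) * ((Cs * \<delta>)\<^sup>2 * Lp_norm \<Omega> 3 (wgrad \<Omega> u) ^ 3 + K * (Lp_norm \<Omega> 2 (wgrad \<Omega> ut))\<^sup>2)"
proof -
  have \<phi>: "\<phi> \<in> Xspace \<Omega>" unfolding \<phi>_def by (rule Xspace_diff[OF u w \<Omega>(1)])
  note u3 = Xspace_W1p[OF u] and w3 = Xspace_W1p[OF w] and \<phi>3 = Xspace_W1p[OF \<phi>]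
  note \<phi>2 = W1p3_imp_W1p2[OF \<Omega> \<phi>3]
  have K0: "K \<ge> 0" by (simp add: K_def)
  let ?g = "Lp_norm \<Omega> 2 (wgrad \<Omega> \<phi>)" and ?h = "Lp_norm \<Omega> 3 (wgrad \<Omega> \<phi>)" and ?f = "Lp_norm \<Omega> 2 \<phi>"
    and ?a = "Lp_norm \<Omega> 3 (wgrad \<Omega> u)" and ?W = "Lp_norm \<Omega> 3 (wgrad \<Omega> w)" and ?d = "Lp_norm \<Omega> 2 (wgrad \<Omega> ut)"
    and ?s = "(Cs * \<delta>)\<^sup>2"
  have id: "L2_inner \<Omega> ut \<phi> - L2_inner \<Omega> wt \<phi> - K * L2_inner \<Omega> (wgrad \<Omega> wt) (wgrad \<Omega> \<phi>)
      + \<nu> * ?g\<^sup>2 + (LINT x|lebesgue_on \<Omega>. (wgrad \<Omega> w x *v \<phi> x) \<bullet> \<phi> x)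
      = ?s * L2_inner \<Omega> (smag \<Omega> w) (wgrad \<Omega> \<phi>)"
    unfolding \<phi>_def K_def
    by (rule error_energy_identity[OF \<Omega> f u w ut wt p q nse divu divw csm])
  have mon: "C1 * ?h ^ 3 \<le> L2_inner \<Omega> (smag \<Omega> u) (wgrad \<Omega> \<phi>) - L2_inner \<Omega> (smag \<Omega> w) (wgrad \<Omega> \<phi>)"
  proof -
    have "C1 * ?h ^ 3 \<le> L2_inner \<Omega> (\<lambda>x. smag \<Omega> u x - smag \<Omega> w x) (wgrad \<Omega> \<phi>)"
      using mono u3 w3 unfolding strong_monotonicity_def \<phi>_def by blast
    also have "\<dots> = L2_inner \<Omega> (smag \<Omega> u) (wgrad \<Omega> \<phi>) - L2_inner \<Omega> (smag \<Omega> w) (wgrad \<Omega> \<phi>)"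
      using smag_holder(1)[OF u3 \<phi>3 \<Omega>(1)] smag_holder(1)[OF w3 \<phi>3 \<Omega>(1)]
      by (simp add: L2_inner_def inner_diff_left)
    finally show ?thesis .
  qed
  have smagu: "L2_inner \<Omega> (smag \<Omega> u) (wgrad \<Omega> \<phi>) \<le> ?a ^ 3 / sqrt (C1 / 2) + C1 / 2 * ?h ^ 3"
    using smag_holder(2)[OF u3 \<phi>3 \<Omega>(1)] young_cubic[of ?a ?h "C1 / 2"] C1 by simp
  have conv: "- (LINT x|lebesgue_on \<Omega>. (wgrad \<Omega> w x *v \<phi> x) \<bullet> \<phi> x) \<le> \<nu> / 2 * ?g\<^sup>2 + S\<^sup>2 / (2 * \<nu>) * ?W\<^sup>2 * ?f\<^sup>2"
  proof -
    have "- (LINT x|lebesgue_on \<Omega>. (wgrad \<Omega> w x *v \<phi> x) \<bullet> \<phi> x) \<le> ?W * Lp_norm \<Omega> 3 \<phi> * Lp_norm \<Omega> 3 \<phi>"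
      using convective_holder(2)[OF W1p_wgrad(2)[OF w3 \<Omega>(1)] W1p_wgrad(1)[OF \<phi>3 \<Omega>(1)] W1p_wgrad(1)[OF \<phi>3 \<Omega>(1)]]
      by linarith
    also have "\<dots> = ?W * (Lp_norm \<Omega> 3 \<phi>)\<^sup>2" by (simp add: power2_eq_square mult.assoc)
    also have "\<dots> \<le> ?W * (S * ?f * ?g)"
      unfolding S_def by (intro mult_left_mono gagliardo_nirenberg_Xspace[OF n \<Omega> \<phi>]) simp
    also have "\<dots> \<le> \<nu> / 2 * ?g\<^sup>2 + S\<^sup>2 / (2 * \<nu>) * ?W\<^sup>2 * ?f\<^sup>2"
    proof -
      have "2 * \<nu> * (?W * (S * ?f * ?g)) = 2 * (\<nu> * ?g) * (S * ?W * ?f)" by (simp add: mult_ac)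
      also have "\<dots> \<le> (\<nu> * ?g)\<^sup>2 + (S * ?W * ?f)\<^sup>2" by (rule sum_squares_bound)
      also have "\<dots> = 2 * \<nu> * (\<nu> / 2 * ?g\<^sup>2 + S\<^sup>2 / (2 * \<nu>) * ?W\<^sup>2 * ?f\<^sup>2)"
        using \<nu> by (simp add: power_mult_distrib distrib_left power2_eq_square[of \<nu>])
      finally show ?thesis by (rule mult_left_le_imp_le) (use \<nu> in simp)
    qed
    finally show ?thesis .
  qed
  have cons: "L2_inner \<Omega> (wgrad \<Omega> ut) (wgrad \<Omega> \<phi>) \<le> ?d\<^sup>2 / 2 + ?g\<^sup>2 / 2"
    using L2_inner_le[OF W1p_wgrad(2)[OF ut \<Omega>(1)] W1p_wgrad(2)[OF \<phi>2 \<Omega>(1)]] sum_squares_bound[of ?d ?g] by linarith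
  have Kcons: "K * L2_inner \<Omega> (wgrad \<Omega> ut) (wgrad \<Omega> \<phi>) \<le> K * (?d\<^sup>2 / 2 + ?g\<^sup>2 / 2)"
    by (rule mult_left_mono[OF cons K0])
  have "?s * (C1 * ?h ^ 3 + L2_inner \<Omega> (smag \<Omega> w) (wgrad \<Omega> \<phi>)) \<le> ?s * (?a ^ 3 / sqrt (C1 / 2) + C1 / 2 * ?h ^ 3)"
    using mon smagu by (intro mult_left_mono) auto
  then have sm: "C1 / 2 * ?s * ?h ^ 3 + ?s * L2_inner \<Omega> (smag \<Omega> w) (wgrad \<Omega> \<phi>) \<le> 1 / sqrt (C1 / 2) * (?s * ?a ^ 3)"
    by (simp add: algebra_simps)
  have c1: "1 / sqrt (C1 / 2) * (?s * ?a ^ 3) + K * (?d\<^sup>2 / 2) \<le> (1 + 1 / sqrt (C1 / 2)) * (?s * ?a ^ 3 + K * ?d\<^sup>2)"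
  proof -
    have "0 \<le> ?s * ?a ^ 3" "0 \<le> K * ?d\<^sup>2" "0 \<le> 1 / sqrt (C1 / 2) * (K * ?d\<^sup>2)" using C1 K0 by simp_all
    then show ?thesis unfolding distrib_left distrib_right by linarith
  qed
  have c2: "S\<^sup>2 / (2 * \<nu>) * ?W\<^sup>2 * ?f\<^sup>2 + K * (?g\<^sup>2 / 2) \<le> (1 + S\<^sup>2 / \<nu> * ?W\<^sup>2) * (1 / 2 * (?f\<^sup>2 + K * ?g\<^sup>2))"
  proof -
    have gen: "X * F / 2 + k * (G / 2) \<le> (1 + X) * (1 / 2 * (F + k * G))"
      if "X \<ge> 0" "F \<ge> 0" "G \<ge> 0" "k \<ge> 0" for X F G k :: real
    proof -
      have "(1 + X) * (1 / 2 * (F + k * G)) - (X * F / 2 + k * (G / 2)) = F / 2 + X * (k * G) / 2"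
        by (simp add: field_simps)
      moreover have "0 \<le> F / 2 + X * (k * G) / 2" using that by simp
      ultimately show ?thesis by linarith
    qed
    show ?thesis using gen[of "S\<^sup>2 / \<nu> * ?W\<^sup>2" "?f\<^sup>2" "?g\<^sup>2" K] \<nu> K0 by simp
  qed
  have "K * (L2_inner \<Omega> (wgrad \<Omega> ut) (wgrad \<Omega> \<phi>) - L2_inner \<Omega> (wgrad \<Omega> wt) (wgrad \<Omega> \<phi>))
    = K * L2_inner \<Omega> (wgrad \<Omega> ut) (wgrad \<Omega> \<phi>) - K * L2_inner \<Omega> (wgrad \<Omega> wt) (wgrad \<Omega> \<phi>)"
    by (rule right_diff_distrib)
  moreover have "K * (?d\<^sup>2 / 2 + ?g\<^sup>2 / 2) = K * (?d\<^sup>2 / 2) + K * (?g\<^sup>2 / 2)" by (rule distrib_left)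
  ultimately show ?thesis
    using id conv Kcons sm c1 c2 by linarith
qed

section \<open>Calculus of absolutely continuous functions of time\<close>

abbreviation (input) time_integral :: "real \<Rightarrow> real \<Rightarrow> (real \<Rightarrow> real) \<Rightarrow> real" where
  "time_integral s t f \<equiv> (LINT r|lebesgue_on {s..t}. f r)"

lemma integrable_subinterval_time:
  fixes f :: "real \<Rightarrow> real"
  assumes f: "integrable (lebesgue_on {0..T}) f" and st: "0 \<le> s" "t \<le> T"
  shows "integrable (lebesgue_on {s..t}) f"
proof -
  have "integrable lebesgue (\<lambda>x. indicator {0..T} x *\<^sub>R f x)"
    using f by (simp add: integrable_restrict_space)
  from integrable_mult_indicator[OF _ this, of "{s..t}"]
  have "integrable lebesgue (\<lambda>x. indicator {s..t} x *\<^sub>R (indicator {0..T} x *\<^sub>R f x))" by simp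
  also have "(\<lambda>x. indicator {s..t} x *\<^sub>R (indicator {0..T} x *\<^sub>R f x)) = (\<lambda>x. indicator {s..t} x *\<^sub>R f x)"
    using st by (auto simp: fun_eq_iff indicator_def)
  finally show ?thesis by (simp add: integrable_restrict_space)
qed

lemma AE_subinterval_time:
  assumes "AE r in lebesgue_on {0..T}. P r" and st: "0 \<le> s" "t \<le> (T::real)"
  shows "AE r in lebesgue_on {s..t}. P r"
proof -
  have "AE r in lebesgue. r \<in> {0..T} \<longrightarrow> P r"
    using assms(1) by (simp add: AE_restrict_space_iff)
  then have "AE r in lebesgue. r \<in> {s..t} \<longrightarrow> P r"
    by eventually_elim (use st in auto)
  then show ?thesis by (simp add: AE_restrict_space_iff)
qed

lemma time_integral_eq_HK:
  fixes f :: "real \<Rightarrow> real"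
  assumes "integrable (lebesgue_on {0..T}) f" "0 \<le> s" "t \<le> T"
  shows "time_integral s t f = integral {s..t} f"
  using lebesgue_integral_eq_integral[OF integrable_subinterval_time[OF assms]] by simp

lemma integrable_time_HK:
  fixes f :: "real \<Rightarrow> real"
  assumes "integrable (lebesgue_on {0..T}) f" "0 \<le> s" "t \<le> T"
  shows "f integrable_on {s..t}"
  using integrable_on_lebesgue_on[OF integrable_subinterval_time[OF assms]] by simp

lemma time_integral_combine:
  fixes f :: "real \<Rightarrow> real"
  assumes f: "integrable (lebesgue_on {0..T}) f" and st: "0 \<le> s" "s \<le> t" "t \<le> r" "r \<le> T"
  shows "time_integral s t f + time_integral t r f = time_integral s r f"
proof -
  have eq: "time_integral s t f = integral {s..t} f" "time_integral t r f = integral {t..r} f" "time_integral s r f = integral {s..r} f"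
    using st by (intro time_integral_eq_HK[OF f]; simp)+
  show ?thesis
    unfolding eq using st by (intro Henstock_Kurzweil_Integration.integral_combine integrable_time_HK[OF f]) auto
qed

lemma time_integral_continuous:
  fixes f :: "real \<Rightarrow> real"
  assumes f: "integrable (lebesgue_on {0..T}) f"
  shows "continuous_on {0..T} (\<lambda>t. time_integral 0 t f)"
proof (cases "0 \<le> T")
  case True
  then have "continuous_on {0..T} (\<lambda>t. integral {0..t} f)"
    by (intro indefinite_integral_continuous_1 integrable_time_HK[OF f]) auto
  then show ?thesis
    by (rule continuous_on_eq) (simp add: time_integral_eq_HK[OF f])
qed simp

lemma time_integral_nonneg:
  fixes f :: "real \<Rightarrow> real"
  assumes "\<And>r. 0 \<le> f r" shows "0 \<le> time_integral s t f"
  using assms by (intro integral_nonneg_AE) auto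

lemma time_integral_mono_interval:
  fixes f :: "real \<Rightarrow> real"
  assumes f: "integrable (lebesgue_on {0..T}) f" "\<And>r. 0 \<le> f r" and st: "0 \<le> s" "s \<le> t" "t \<le> T"
  shows "time_integral s t f \<le> time_integral 0 T f"
  using time_integral_combine[OF f(1), of 0 s t] time_integral_combine[OF f(1), of 0 t T] st
    time_integral_nonneg[of f 0 s, OF f(2)] time_integral_nonneg[of f t T, OF f(2)] by linarith

text \<open>The chain rule for \<open>t \<mapsto> a t t\<close>, where \<open>a\<close> is a symmetric form along a curve and \<open>b r \<tau>\<close> is the derivative of \<open>a r \<tau>\<close>
  in \<open>r\<close>. Over a short interval the increment of \<open>a t t\<close> is the integral of \<open>b r t + b r s\<close>, which is close to
  \<open>2 b r r\<close>; only continuity of the curve is used, so the derivative may be merely integrable.\<close>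

lemma quadratic_increment:
  fixes a b D :: "real \<Rightarrow> real \<Rightarrow> real" and m :: "real \<Rightarrow> real"
  assumes sym: "\<And>s t. s \<in> {0..T} \<Longrightarrow> t \<in> {0..T} \<Longrightarrow> a s t = a t s"
    and inc: "\<And>s t \<tau>. 0 \<le> s \<Longrightarrow> s \<le> t \<Longrightarrow> t \<le> T \<Longrightarrow> \<tau> \<in> {0..T} \<Longrightarrow> a t \<tau> - a s \<tau> = time_integral s t (\<lambda>r. b r \<tau>)"
    and b: "\<And>\<tau>. \<tau> \<in> {0..T} \<Longrightarrow> integrable (lebesgue_on {0..T}) (\<lambda>r. b r \<tau>)"
    and bb: "integrable (lebesgue_on {0..T}) (\<lambda>r. b r r)"
    and m: "integrable (lebesgue_on {0..T}) m" and m0: "\<And>r. 0 \<le> m r"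
    and lip: "AE r in lebesgue_on {0..T}. \<forall>\<tau>\<in>{0..T}. \<forall>\<sigma>\<in>{0..T}. \<bar>b r \<tau> - b r \<sigma>\<bar> \<le> m r * D \<tau> \<sigma>"
    and D: "\<And>e. e > 0 \<Longrightarrow> \<exists>d>0. \<forall>\<tau>\<in>{0..T}. \<forall>\<sigma>\<in>{0..T}. \<bar>\<tau> - \<sigma>\<bar> \<le> d \<longrightarrow> D \<tau> \<sigma> \<le> e"
    and t: "t \<in> {0..T}"
  shows "a t t = a 0 0 + 2 * time_integral 0 t (\<lambda>r. b r r)"
proof -
  have step: "\<bar>a v v - a s s - 2 * time_integral s v (\<lambda>r. b r r)\<bar> \<le> 2 * e * time_integral s v m"
    if sv: "0 \<le> s" "s \<le> v" "v \<le> T" and e: "\<And>\<tau> \<sigma>. \<tau> \<in> {s..v} \<Longrightarrow> \<sigma> \<in> {s..v} \<Longrightarrow> D \<tau> \<sigma> \<le> e" for s v e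
  proof -
    have in0: "s \<in> {0..T}" "v \<in> {0..T}" using sv by auto
    note I = integrable_subinterval_time[OF b[OF in0(1)] sv(1,3)] integrable_subinterval_time[OF b[OF in0(2)] sv(1,3)]
      integrable_subinterval_time[OF bb sv(1,3)] integrable_subinterval_time[OF m sv(1,3)]
    have "a v v - a s s = (a v v - a s v) + (a v s - a s s)" using sym[OF in0] by simp
    also have "\<dots> = time_integral s v (\<lambda>r. b r v) + time_integral s v (\<lambda>r. b r s)"
      using inc[OF sv in0(2)] inc[OF sv in0(1)] by simp
    finally have "a v v - a s s - 2 * time_integral s v (\<lambda>r. b r r) = time_integral s v (\<lambda>r. (b r v - b r r) + (b r s - b r r))"
      using I by simp
    then have "\<bar>a v v - a s s - 2 * time_integral s v (\<lambda>r. b r r)\<bar> \<le> time_integral s v (\<lambda>r. \<bar>(b r v - b r r) + (b r s - b r r)\<bar>)"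
      by (simp only: integral_abs_bound)
    also have "\<dots> \<le> time_integral s v (\<lambda>r. 2 * e * m r)"
    proof (rule integral_mono_AE)
      show "AE r in lebesgue_on {s..v}. \<bar>(b r v - b r r) + (b r s - b r r)\<bar> \<le> 2 * e * m r"
        using AE_subinterval_time[OF lip sv(1,3)] AE_space[of "lebesgue_on {s..v}"]
      proof eventually_elim
        case (elim r)
        then have r: "r \<in> {s..v}" "r \<in> {0..T}" using sv by auto
        have "\<bar>b r v - b r r\<bar> \<le> m r * D v r" "\<bar>b r s - b r r\<bar> \<le> m r * D s r"
          using elim(1) in0 r by auto
        moreover have "m r * D v r \<le> m r * e" "m r * D s r \<le> m r * e"
          using r sv by (auto intro!: mult_left_mono e m0)
        moreover have "m r * e + m r * e = 2 * e * m r" by simp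
        ultimately show ?case by linarith
      qed
    qed (use I in auto)
    finally show ?thesis by simp
  qed
  have "\<bar>a t t - a 0 0 - 2 * time_integral 0 t (\<lambda>r. b r r)\<bar> \<le> e * (2 * time_integral 0 T m)" if e: "e > 0" for e
  proof -
    obtain d where d: "d > 0" "\<And>\<tau> \<sigma>. \<tau> \<in> {0..T} \<Longrightarrow> \<sigma> \<in> {0..T} \<Longrightarrow> \<bar>\<tau> - \<sigma>\<bar> \<le> d \<Longrightarrow> D \<tau> \<sigma> \<le> e"
      using D[OF e] by blast
    \<comment> \<open>partition points with mesh \<open>d\<close>, eventually constant\<close>
    define p where "p k = min t (real k * d)" for k
    have "\<bar>a (p k) (p k) - a 0 0 - 2 * time_integral 0 (p k) (\<lambda>r. b r r)\<bar> \<le> 2 * e * time_integral 0 (p k) m" for k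
    proof (induction k)
      case 0
      have p0: "p 0 = 0" using t by (simp add: p_def)
      have T0: "0 \<le> T" using t by simp
      have "time_integral 0 0 (\<lambda>r. b r r) = 0" "time_integral 0 0 m = 0"
        using time_integral_combine[OF bb order_refl order_refl order_refl T0]
          time_integral_combine[OF m order_refl order_refl order_refl T0] by simp_all
      then show ?case by (simp add: p0)
    next
      case (Suc k)
      have pk: "0 \<le> p k" "p k \<le> p (Suc k)" "p (Suc k) \<le> T" "p (Suc k) - p k \<le> d"
        using t d(1) by (auto simp: p_def algebra_simps min_def)
      have "\<bar>a (p (Suc k)) (p (Suc k)) - a (p k) (p k) - 2 * time_integral (p k) (p (Suc k)) (\<lambda>r. b r r)\<bar>
        \<le> 2 * e * time_integral (p k) (p (Suc k)) m"
        by (rule step[OF pk(1-3)], rule d(2)) (use pk in auto)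
      moreover have "2 * e * time_integral 0 (p (Suc k)) m
        = 2 * e * time_integral 0 (p k) m + 2 * e * time_integral (p k) (p (Suc k)) m"
        unfolding time_integral_combine[OF m order_refl pk(1-3), symmetric] by (rule distrib_left)
      ultimately show ?case
        using Suc time_integral_combine[OF bb order_refl pk(1-3)] by linarith
    qed
    moreover obtain k where k: "t \<le> real k * d"
      using reals_Archimedean3[OF d(1)] less_imp_le by metis
    moreover have "p k = t" using k by (simp add: p_def)
    ultimately have "\<bar>a t t - a 0 0 - 2 * time_integral 0 t (\<lambda>r. b r r)\<bar> \<le> 2 * e * time_integral 0 t m"
      by metis
    also have "\<dots> \<le> 2 * e * time_integral 0 T m"
      using t e by (intro mult_left_mono time_integral_mono_interval[OF m m0]) auto
    finally show ?thesis by (simp add: mult_ac)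
  qed
  from le_at_zero_if_le_pos[of "\<lambda>e. e * (2 * time_integral 0 T m)", OF _ this]
  show ?thesis by (simp add: continuous_intros)
qed

text \<open>Gronwall's inequality for an integrable rate \<open>k\<close>. Time is cut into pieces on which \<open>k\<close> has integral at most \<open>1/2\<close>, so that
  the maximum over a piece absorbs its own contribution; the constant is exponential in the total integral of \<open>k\<close>.\<close>

lemma gronwall_integral:
  fixes y \<beta> k R G :: "real \<Rightarrow> real"
  assumes T: "T \<ge> 0" and \<beta>: "integrable (lebesgue_on {0..T}) \<beta>" and k: "integrable (lebesgue_on {0..T}) k"
    and R: "integrable (lebesgue_on {0..T}) R" and G: "G \<in> borel_measurable (lebesgue_on {0..T})"
    and pos: "\<And>t. 0 \<le> k t" "\<And>t. 0 \<le> R t" "\<And>t. 0 \<le> G t" "\<And>t. 0 \<le> y t"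
    and y: "\<And>t. t \<in> {0..T} \<Longrightarrow> y t = y 0 + time_integral 0 t \<beta>"
    and le: "AE t in lebesgue_on {0..T}. \<beta> t + G t \<le> k t * y t + R t"
  defines "\<kappa> \<equiv> time_integral 0 T k"
  shows "integrable (lebesgue_on {0..T}) G"
    and "y T + time_integral 0 T G \<le> (1 + \<kappa> * 4 ^ (nat \<lceil>2 * \<kappa>\<rceil> + 1)) * (y 0 + time_integral 0 T R)"
proof -
  have ycont: "continuous_on {0..T} y"
  proof (rule continuous_on_eq)
    show "continuous_on {0..T} (\<lambda>t. y 0 + time_integral 0 t \<beta>)"
      by (intro continuous_intros time_integral_continuous[OF \<beta>])
  qed (simp add: y[symmetric])
  have ymeas: "y \<in> borel_measurable (lebesgue_on {0..T})"
    by (rule continuous_imp_measurable_on_sets_lebesgue[OF ycont]) simp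
  have "bounded (y ` {0..T})"
    by (rule compact_imp_bounded[OF compact_continuous_image[OF ycont compact_Icc]])
  then obtain B where "\<forall>z\<in>y ` {0..T}. norm z \<le> B"
    unfolding bounded_iff by blast
  then have B: "\<bar>y t\<bar> \<le> B" if "t \<in> {0..T}" for t using that by auto
  have ky: "integrable (lebesgue_on {0..T}) (\<lambda>t. k t * y t)"
  proof (rule Bochner_Integration.integrable_bound)
    show "integrable (lebesgue_on {0..T}) (\<lambda>t. B * k t)" using k by simp
    show "(\<lambda>t. k t * y t) \<in> borel_measurable (lebesgue_on {0..T})"
      using borel_measurable_integrable[OF k] ymeas by measurable
    show "AE t in lebesgue_on {0..T}. norm (k t * y t) \<le> norm (B * k t)"
    proof (rule AE_I2)
      fix t assume "t \<in> space (lebesgue_on {0..T})"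
      then have "\<bar>y t\<bar> \<le> \<bar>B\<bar>" using B[of t] by simp
      from mult_left_mono[OF this abs_ge_zero[of "k t"]] show "norm (k t * y t) \<le> norm (B * k t)"
        by (simp add: abs_mult mult.commute)
    qed
  qed
  show Gi: "integrable (lebesgue_on {0..T}) G"
  proof (rule Bochner_Integration.integrable_bound[OF _ G])
    show "integrable (lebesgue_on {0..T}) (\<lambda>t. k t * y t + R t - \<beta> t)" using ky R \<beta> by simp
    show "AE t in lebesgue_on {0..T}. norm (G t) \<le> norm (k t * y t + R t - \<beta> t)"
      using le
    proof eventually_elim
      case (elim t)
      then show ?case using pos(3)[of t] by simp
    qed
  qed
  define \<rho> where "\<rho> = time_integral 0 T R"
  define \<alpha> where "\<alpha> = y 0 + \<rho>"
  have \<rho>0: "0 \<le> \<rho>" unfolding \<rho>_def by (rule time_integral_nonneg[OF pos(2)])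
  have \<alpha>0: "0 \<le> \<alpha>" using \<rho>0 pos(4)[of 0] by (simp add: \<alpha>_def)
  have incr: "y t + time_integral s t G \<le> y s + \<rho> + time_integral s t k * Y"
    if st: "0 \<le> s" "s \<le> t" "t \<le> T" and Y: "\<And>r. r \<in> {s..t} \<Longrightarrow> y r \<le> Y" for s t Y
  proof -
    note I = integrable_subinterval_time[OF _ st(1,3)]
    have "y t - y s = time_integral s t \<beta>"
      using time_integral_combine[OF \<beta> order_refl st] y[of s] y[of t] st by simp
    then have "y t - y s + time_integral s t G = time_integral s t (\<lambda>r. \<beta> r + G r)"
      using I[OF \<beta>] I[OF Gi] by simp
    also have "\<dots> \<le> time_integral s t (\<lambda>r. k r * Y + R r)"
    proof (rule integral_mono_AE)
      show "AE r in lebesgue_on {s..t}. \<beta> r + G r \<le> k r * Y + R r"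
        using AE_subinterval_time[OF le st(1,3)] AE_space[of "lebesgue_on {s..t}"]
      proof eventually_elim
        case (elim r)
        then have "y r \<le> Y" using Y[of r] by simp
        then have "k r * y r \<le> k r * Y" by (rule mult_left_mono[OF _ pos(1)])
        then show ?case using elim(1) by linarith
      qed
    qed (use I[OF \<beta>] I[OF Gi] I[OF k] I[OF R] in auto)
    also have "\<dots> = time_integral s t k * Y + time_integral s t R"
      using I[OF k] I[OF R] by simp
    also have "time_integral s t R \<le> \<rho>"
      unfolding \<rho>_def by (rule time_integral_mono_interval[OF R pos(2) st])
    finally show ?thesis by simp
  qed
  define K where "K t = time_integral 0 t k" for t
  have Kcont: "continuous_on {0..T} K"
    unfolding K_def by (rule time_integral_continuous[OF k])
  have K0: "K 0 = 0"
  proof -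
    have "K 0 + K 0 = K 0"
      unfolding K_def using T by (intro time_integral_combine[OF k]) auto
    then show ?thesis by simp
  qed
  have maxy: "\<exists>r\<in>{s..t}. \<forall>r'\<in>{s..t}. y r' \<le> y r" if "0 \<le> s" "s \<le> t" "t \<le> T" for s t
    using that by (intro continuous_attains_sup continuous_on_subset[OF ycont]) auto
  \<comment> \<open>induction over the pieces: each one at most doubles the bound and adds \<open>2 \<alpha>\<close>, which powers of 4 majorise\<close>
  have bound: "\<forall>t\<in>{0..T}. K t \<le> real n / 2 \<longrightarrow> y t \<le> 4 ^ (n + 1) * \<alpha>" for n
  proof (induction n)
    case 0
    show ?case
    proof (intro ballI impI)
      fix t assume t: "t \<in> {0..T}" and Kt: "K t \<le> real 0 / 2"
      obtain r where r: "r \<in> {0..t}" "\<And>r'. r' \<in> {0..t} \<Longrightarrow> y r' \<le> y r"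
        using maxy[of 0 t] t by auto
      have "K r \<le> K t"
        using time_integral_combine[OF k, of 0 r t] time_integral_nonneg[of k r t, OF pos(1)] r(1) t
        by (simp add: K_def)
      then have "K r * y r \<le> 0" using Kt pos(4)[of r] by (simp add: mult_nonpos_nonneg)
      moreover have "y r + time_integral 0 r G \<le> y 0 + \<rho> + K r * y r"
        unfolding K_def using r t by (intro incr) auto
      moreover have "0 \<le> time_integral 0 r G" by (rule time_integral_nonneg[OF pos(3)])
      ultimately have "y r \<le> \<alpha>" by (simp add: \<alpha>_def)
      moreover have "y t \<le> y r" using r(2)[of t] t by simp
      ultimately show "y t \<le> 4 ^ (0 + 1) * \<alpha>" using \<alpha>0 by simp
    qed
  next
    case (Suc n)
    show ?case
    proof (intro ballI impI)
      fix t assume t: "t \<in> {0..T}" and Kt: "K t \<le> real (Suc n) / 2"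
      show "y t \<le> 4 ^ (Suc n + 1) * \<alpha>"
      proof (cases "K t \<le> real n / 2")
        case True
        then have "y t \<le> 4 ^ (n + 1) * \<alpha>" using Suc t by blast
        also have "\<dots> \<le> 4 ^ (Suc n + 1) * \<alpha>" using \<alpha>0 by (intro mult_right_mono power_increasing) auto
        finally show ?thesis .
      next
        case False
        obtain s where s: "0 \<le> s" "s \<le> t" "K s = real n / 2"
          using IVT'[of K 0 "real n / 2" t] K0 False t continuous_on_subset[OF Kcont, of "{0..t}"] by auto
        have ys: "y s \<le> 4 ^ (n + 1) * \<alpha>" using Suc s t by auto
        obtain r where r: "r \<in> {s..t}" "\<And>r'. r' \<in> {s..t} \<Longrightarrow> y r' \<le> y r"
          using maxy[of s t] s t by auto
        have "K s + time_integral s r k = K r" "K r + time_integral r t k = K t"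
          unfolding K_def using s r t by (auto intro!: time_integral_combine[OF k])
        then have half: "time_integral s r k \<le> 1 / 2"
          using s(3) Kt time_integral_nonneg[of k r t, OF pos(1)] by simp
        have "y r + time_integral s r G \<le> y s + \<rho> + time_integral s r k * y r"
          using r s t by (intro incr) auto
        also have "\<dots> \<le> y s + \<rho> + 1 / 2 * y r"
          using half pos(4)[of r] by (intro add_left_mono mult_right_mono)
        finally have "y r \<le> 2 * (y s + \<rho>)"
          using time_integral_nonneg[of G s r, OF pos(3)] by simp
        also have "\<dots> \<le> 2 * (4 ^ (n + 1) * \<alpha> + 4 ^ (n + 1) * \<alpha>)"
        proof -
          have "\<rho> \<le> \<alpha>" using pos(4)[of 0] by (simp add: \<alpha>_def)
          also have "\<alpha> \<le> 4 ^ (n + 1) * \<alpha>"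
            using \<alpha>0 mult_right_mono[of 1 "4 ^ (n + 1)" \<alpha>] by (simp only: one_le_power one_le_numeral mult_1)
          finally show ?thesis using ys by (intro mult_left_mono add_mono) auto
        qed
        also have "\<dots> = 4 ^ (Suc n + 1) * \<alpha>" by simp
        finally show ?thesis using r(2)[of t] s by simp
      qed
    qed
  qed
  have \<kappa>0: "0 \<le> \<kappa>" unfolding \<kappa>_def by (rule time_integral_nonneg[OF pos(1)])
  have "y t \<le> 4 ^ (nat \<lceil>2 * \<kappa>\<rceil> + 1) * \<alpha>" if t: "t \<in> {0..T}" for t
  proof -
    have "K t \<le> \<kappa>" unfolding K_def \<kappa>_def using t by (intro time_integral_mono_interval[OF k pos(1)]) auto
    also have "\<kappa> \<le> real (nat \<lceil>2 * \<kappa>\<rceil>) / 2" using \<kappa>0 by linarith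
    finally show ?thesis using bound t by blast
  qed
  then have "y T + time_integral 0 T G \<le> y 0 + \<rho> + \<kappa> * (4 ^ (nat \<lceil>2 * \<kappa>\<rceil> + 1) * \<alpha>)"
    unfolding \<kappa>_def using T by (intro incr) auto
  then show "y T + time_integral 0 T G \<le> (1 + \<kappa> * 4 ^ (nat \<lceil>2 * \<kappa>\<rceil> + 1)) * (y 0 + time_integral 0 T R)"
    by (simp add: \<alpha>_def \<rho>_def distrib_right mult.assoc)
qed

section \<open>Functions of time with values in a normed space of functions\<close>

lemma borel_measurable_AE_LIMSEQ_time:
  fixes f :: "nat \<Rightarrow> real \<Rightarrow> real"
  assumes f: "\<And>k. f k \<in> borel_measurable (lebesgue_on {0..T})"
    and lim: "AE t in lebesgue_on {0..T}. (\<lambda>k. f k t) \<longlonglongrightarrow> g t"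
  shows "g \<in> borel_measurable (lebesgue_on {0..T})"
proof (rule lebesgue_on_measurable_cong_AE)
  show "(\<lambda>t. lim (\<lambda>k. f k t)) \<in> borel_measurable (lebesgue_on {0..T})"
    by (rule borel_measurable_lim_metric[OF f])
  show "AE t in lebesgue_on {0..T}. lim (\<lambda>k. f k t) = g t"
    using lim by eventually_elim (rule limI)
qed simp

text \<open>Along the approximating simple functions \<open>F\<close> takes finitely many values; Lipschitz continuity passes to the limit.\<close>

lemma strongly_measurable_lipschitz:
  fixes F :: "('x \<Rightarrow> 'b::euclidean_space) \<Rightarrow> real"
  assumes x: "strongly_measurable B N T x"
    and lip: "\<And>a b. a \<in> B \<Longrightarrow> b \<in> B \<Longrightarrow> \<bar>F a - F b\<bar> \<le> C * N (\<lambda>z. a z - b z)"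
  shows "(\<lambda>t. F (x t)) \<in> borel_measurable (lebesgue_on {0..T})"
proof -
  obtain s where s: "\<And>k. simple_function (lebesgue_on {0..T}) (s k)" "\<And>k. s k ` {0..T} \<subseteq> B"
    and lim: "AE t in lebesgue_on {0..T}. (\<lambda>k. N (\<lambda>z. s k t z - x t z)) \<longlonglongrightarrow> 0"
    and xB: "AE t in lebesgue_on {0..T}. x t \<in> B"
    using x by (auto simp: strongly_measurable_def)
  show ?thesis
  proof (rule borel_measurable_AE_LIMSEQ_time)
    show "(\<lambda>t. F (s k t)) \<in> borel_measurable (lebesgue_on {0..T})" for k
      by (rule borel_measurable_simple_function[OF simple_function_compose1[OF s(1)]])
    show "AE t in lebesgue_on {0..T}. (\<lambda>k. F (s k t)) \<longlonglongrightarrow> F (x t)"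
      using lim xB AE_space[of "lebesgue_on {0..T}"]
    proof eventually_elim
      case (elim t)
      have "s k t \<in> B" for k using s(2)[of k] elim(3) by auto
      then have "\<And>k. norm (F (s k t) - F (x t)) \<le> C * N (\<lambda>z. s k t z - x t z)"
        using lip elim(2) by simp
      then have "(\<lambda>k. F (s k t) - F (x t)) \<longlonglongrightarrow> 0"
        by (intro Lim_null_comparison[OF always_eventually tendsto_mult_right_zero[OF elim(1)]] allI)
      then show ?case by (simp add: LIM_zero_iff)
    qed
  qed
qed

text \<open>The axioms of a normed space that the spaces \<open>W\<^sup>1\<^sup>,\<^sup>p\<close> and \<open>L\<^sup>p\<close> of functions satisfy; the norms are only
  seminorms on functions, since functions are not identified almost everywhere.\<close>

definition seminormed_space :: "('x \<Rightarrow> 'b::euclidean_space) set \<Rightarrow> (('x \<Rightarrow> 'b) \<Rightarrow> real) \<Rightarrow> bool" where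
  "seminormed_space B N \<longleftrightarrow>
     (\<forall>a\<in>B. \<forall>b\<in>B. (\<lambda>z. a z - b z) \<in> B \<and> N (\<lambda>z. a z - b z) \<le> N a + N b \<and> \<bar>N a - N b\<bar> \<le> N (\<lambda>z. a z - b z)) \<and>
     (\<forall>a. 0 \<le> N a)"

lemma seminormed_space_Lp: "p \<ge> 1 \<Longrightarrow> seminormed_space (Lp \<Omega> p) (Lp_norm \<Omega> p)"
  by (simp add: seminormed_space_def Lp_diff Lp_norm_diff_triangle Lp_norm_diff_le)

lemma seminormed_space_W1p: "open \<Omega> \<Longrightarrow> p \<ge> 1 \<Longrightarrow> seminormed_space (W1p \<Omega> p) (W1p_norm \<Omega> p)"
  by (simp add: seminormed_space_def W1p_diff W1p_norm_diff_triangle W1p_norm_diff_le)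

lemma strongly_measurable_norm:
  assumes "strongly_measurable B N T x" "seminormed_space B N"
  shows "(\<lambda>t. N (x t)) \<in> borel_measurable (lebesgue_on {0..T})"
  by (rule strongly_measurable_lipschitz[OF assms(1), where C=1]) (use assms(2) in \<open>simp add: seminormed_space_def\<close>)

lemma strongly_measurable_diff:
  assumes x: "strongly_measurable B N T x" and y: "strongly_measurable B N T y" and B: "seminormed_space B N"
  shows "strongly_measurable B N T (\<lambda>t z. x t z - y t z)"
proof -
  have diff: "(\<lambda>z. a z - b z) \<in> B" "N (\<lambda>z. a z - b z) \<le> N a + N b" if "a \<in> B" "b \<in> B" for a b
    using B that by (auto simp: seminormed_space_def)
  have pos: "0 \<le> N a" for a using B by (simp add: seminormed_space_def)
  obtain s where s: "\<And>k. simple_function (lebesgue_on {0..T}) (s k)" "\<And>k. s k ` {0..T} \<subseteq> B"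
    and lims: "AE t in lebesgue_on {0..T}. (\<lambda>k. N (\<lambda>z. s k t z - x t z)) \<longlonglongrightarrow> 0"
    and xB: "AE t in lebesgue_on {0..T}. x t \<in> B"
    using x by (auto simp: strongly_measurable_def)
  obtain r where r: "\<And>k. simple_function (lebesgue_on {0..T}) (r k)" "\<And>k. r k ` {0..T} \<subseteq> B"
    and limr: "AE t in lebesgue_on {0..T}. (\<lambda>k. N (\<lambda>z. r k t z - y t z)) \<longlonglongrightarrow> 0"
    and yB: "AE t in lebesgue_on {0..T}. y t \<in> B"
    using y by (auto simp: strongly_measurable_def)
  show ?thesis
    unfolding strongly_measurable_def
  proof (intro conjI exI[of _ "\<lambda>k t z. s k t z - r k t z"] allI)
    show "AE t in lebesgue_on {0..T}. (\<lambda>z. x t z - y t z) \<in> B"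
      using xB yB by eventually_elim (rule diff(1))
    show "simple_function (lebesgue_on {0..T}) (\<lambda>t z. s k t z - r k t z)" for k
      by (rule simple_function_compose2[OF s(1) r(1)])
    show "(\<lambda>t z. s k t z - r k t z) ` {0..T} \<subseteq> B" for k
      using s(2)[of k] r(2)[of k] by (auto intro!: diff(1))
    show "AE t in lebesgue_on {0..T}. (\<lambda>k. N (\<lambda>z. s k t z - r k t z - (x t z - y t z))) \<longlonglongrightarrow> 0"
      using lims limr xB yB AE_space[of "lebesgue_on {0..T}"]
    proof eventually_elim
      case (elim t)
      have sr: "s k t \<in> B" "r k t \<in> B" for k using s(2)[of k] r(2)[of k] elim(5) by auto
      show ?case
      proof (rule Lim_null_comparison[OF always_eventually])
        show "(\<lambda>k. N (\<lambda>z. s k t z - x t z) + N (\<lambda>z. r k t z - y t z)) \<longlonglongrightarrow> 0"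
          using tendsto_add[OF elim(1,2)] by simp
        show "\<forall>k. norm (N (\<lambda>z. s k t z - r k t z - (x t z - y t z))) \<le> N (\<lambda>z. s k t z - x t z) + N (\<lambda>z. r k t z - y t z)"
        proof
          fix k
          have eq: "(\<lambda>z. s k t z - r k t z - (x t z - y t z)) = (\<lambda>z. (s k t z - x t z) - (r k t z - y t z))"
            by (simp add: fun_eq_iff)
          show "norm (N (\<lambda>z. s k t z - r k t z - (x t z - y t z))) \<le> N (\<lambda>z. s k t z - x t z) + N (\<lambda>z. r k t z - y t z)"
            unfolding eq using pos diff(2)[OF diff(1)[OF sr(1) elim(3)] diff(1)[OF sr(2) elim(4)]] by simp
        qed
      qed
    qed
  qed
qed

lemma bochner_Linf_diff:
  assumes x: "x \<in> bochner_Linf T B N" and y: "y \<in> bochner_Linf T B N" and B: "seminormed_space B N"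
  shows "(\<lambda>t z. x t z - y t z) \<in> bochner_Linf T B N"
proof -
  have sx: "strongly_measurable B N T x" and sy: "strongly_measurable B N T y"
    using x y by (auto simp: bochner_Linf_def)
  obtain C D where C: "AE t in lebesgue_on {0..T}. N (x t) \<le> C" and D: "AE t in lebesgue_on {0..T}. N (y t) \<le> D"
    using x y by (auto simp: bochner_Linf_def)
  have xB: "AE t in lebesgue_on {0..T}. x t \<in> B" "AE t in lebesgue_on {0..T}. y t \<in> B"
    using sx sy by (auto simp: strongly_measurable_def)
  have "AE t in lebesgue_on {0..T}. N (\<lambda>z. x t z - y t z) \<le> C + D"
    using C D xB
  proof eventually_elim
    case (elim t)
    have "N (\<lambda>z. x t z - y t z) \<le> N (x t) + N (y t)"
      using B elim(3,4) by (simp add: seminormed_space_def)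
    then show ?case using elim(1,2) by linarith
  qed
  with strongly_measurable_diff[OF sx sy B] show ?thesis by (auto simp: bochner_Linf_def)
qed

lemma bochner_Lp_diff:
  assumes p: "p \<ge> 1"
    and x: "x \<in> bochner_Lp p T B N" and y: "y \<in> bochner_Lp p T B N" and B: "seminormed_space B N"
  shows "(\<lambda>t z. x t z - y t z) \<in> bochner_Lp p T B N"
proof -
  have sx: "strongly_measurable B N T x" and sy: "strongly_measurable B N T y"
    and ix: "integrable (lebesgue_on {0..T}) (\<lambda>t. N (x t) powr p)" and iy: "integrable (lebesgue_on {0..T}) (\<lambda>t. N (y t) powr p)"
    using x y by (auto simp: bochner_Lp_def)
  have xB: "AE t in lebesgue_on {0..T}. x t \<in> B" "AE t in lebesgue_on {0..T}. y t \<in> B"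
    using sx sy by (auto simp: strongly_measurable_def)
  note sd = strongly_measurable_diff[OF sx sy B]
  have "integrable (lebesgue_on {0..T}) (\<lambda>t. N (\<lambda>z. x t z - y t z) powr p)"
  proof (rule Bochner_Integration.integrable_bound)
    show "integrable (lebesgue_on {0..T}) (\<lambda>t. 2 powr (p - 1) * (N (x t) powr p + N (y t) powr p))"
      using ix iy by simp
    show "(\<lambda>t. N (\<lambda>z. x t z - y t z) powr p) \<in> borel_measurable (lebesgue_on {0..T})"
      using strongly_measurable_norm[OF sd B] by measurable
    show "AE t in lebesgue_on {0..T}. norm (N (\<lambda>z. x t z - y t z) powr p) \<le> norm (2 powr (p - 1) * (N (x t) powr p + N (y t) powr p))"
      using xB
    proof eventually_elim
      case (elim t)
      have le: "N (\<lambda>z. x t z - y t z) \<le> N (x t) + N (y t)" and pos: "0 \<le> N a" for a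
        using B elim by (auto simp: seminormed_space_def)
      have "N (\<lambda>z. x t z - y t z) powr p \<le> (N (x t) + N (y t)) powr p"
        using p le pos by (intro powr_mono2) auto
      also have "\<dots> \<le> 2 powr (p - 1) * (N (x t) powr p + N (y t) powr p)"
        using powr_sum_le_weighted[OF p, of 1 1 "N (x t)" "N (y t)"] pos by simp
      finally show ?case by simp
    qed
  qed
  with sd show ?thesis by (simp add: bochner_Lp_def)
qed

lemma strong_class_diff:
  assumes \<Omega>: "open \<Omega>" and u: "u \<in> strong_class \<Omega> T" and w: "w \<in> strong_class \<Omega> T"
  shows "(\<lambda>t x. u t x - w t x) \<in> strong_class \<Omega> T"
  using u w unfolding strong_class_def
  by (auto intro!: bochner_Linf_diff bochner_Lp_diff seminormed_space_W1p[OF \<Omega>] seminormed_space_Lp)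

lemma bochner_W1p_norm_wgrad_measurable:
  assumes \<Omega>: "open \<Omega>" and p: "p \<ge> 1" and x: "strongly_measurable (W1p \<Omega> p) (W1p_norm \<Omega> p) T x"
  shows "(\<lambda>t. Lp_norm \<Omega> p (wgrad \<Omega> (x t))) \<in> borel_measurable (lebesgue_on {0..T})"
  by (rule strongly_measurable_lipschitz[OF x, where C=1 and F="\<lambda>a. Lp_norm \<Omega> p (wgrad \<Omega> a)"])
    (use wgrad_norm_diff_le[OF _ _ \<Omega> p] in simp)

section \<open>The energy identity for curves in \<open>H\<^sup>1\<close>\<close>

text \<open>For \<open>K = C\<^sub>s\<^sup>4 \<delta>\<^sup>2 / \<mu>\<^sup>2\<close> this pairs the time derivative terms of the corrected model with a test field, and half its
  diagonal is the energy of the modelling error.\<close>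

definition energy_form :: "(real^'n) set \<Rightarrow> real \<Rightarrow> (real^'n \<Rightarrow> real^'n) \<Rightarrow> (real^'n \<Rightarrow> real^'n) \<Rightarrow> real" where
  "energy_form \<Omega> K a b = L2_inner \<Omega> a b + K * L2_inner \<Omega> (wgrad \<Omega> a) (wgrad \<Omega> b)"

lemma energy_form_commute: "energy_form \<Omega> K a b = energy_form \<Omega> K b a"
  unfolding energy_form_def by (metis L2_inner_commute)

lemma energy_form_self: "energy_form \<Omega> K a a = (Lp_norm \<Omega> 2 a)\<^sup>2 + K * (Lp_norm \<Omega> 2 (wgrad \<Omega> a))\<^sup>2"
  by (simp add: energy_form_def L2_inner_self)

lemma energy_form_diff_right:
  assumes "a \<in> W1p \<Omega> 2" "b \<in> W1p \<Omega> 2" "c \<in> W1p \<Omega> 2" "open \<Omega>"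
  shows "energy_form \<Omega> K a (\<lambda>x. b x - c x) = energy_form \<Omega> K a b - energy_form \<Omega> K a c"
  unfolding energy_form_def
    L2_inner_diff_right[OF W1p_wgrad(1)[OF assms(1,4)] W1p_wgrad(1)[OF assms(2,4)] W1p_wgrad(1)[OF assms(3,4)]]
    L2_inner_wgrad_diff[OF W1p_wgrad(2)[OF assms(1,4)] assms(2-4)]
  by (simp add: right_diff_distrib)

lemma energy_form_diff_left:
  assumes "a \<in> W1p \<Omega> 2" "b \<in> W1p \<Omega> 2" "c \<in> W1p \<Omega> 2" "open \<Omega>"
  shows "energy_form \<Omega> K (\<lambda>x. b x - c x) a = energy_form \<Omega> K b a - energy_form \<Omega> K c a"
  unfolding energy_form_commute[of \<Omega> K _ a] by (rule energy_form_diff_right[OF assms])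

lemma energy_form_le:
  assumes a: "a \<in> W1p \<Omega> 2" and b: "b \<in> W1p \<Omega> 2" and \<Omega>: "open \<Omega>" and K: "K \<ge> 0"
  shows "\<bar>energy_form \<Omega> K a b\<bar> \<le> (1 + K) * (W1p_norm \<Omega> 2 a * W1p_norm \<Omega> 2 b)"
proof -
  have 1: "\<bar>L2_inner \<Omega> a b\<bar> \<le> W1p_norm \<Omega> 2 a * W1p_norm \<Omega> 2 b"
    by (rule order_trans[OF L2_inner_le[OF W1p_wgrad(1)[OF a \<Omega>] W1p_wgrad(1)[OF b \<Omega>]]])
      (intro mult_mono Lp_norm_le_W1p_norm; simp)
  have 2: "\<bar>L2_inner \<Omega> (wgrad \<Omega> a) (wgrad \<Omega> b)\<bar> \<le> W1p_norm \<Omega> 2 a * W1p_norm \<Omega> 2 b"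
    by (rule order_trans[OF L2_inner_le[OF W1p_wgrad(2)[OF a \<Omega>] W1p_wgrad(2)[OF b \<Omega>]]])
      (intro mult_mono Lp_norm_le_W1p_norm; simp)
  have "\<bar>energy_form \<Omega> K a b\<bar> \<le> \<bar>L2_inner \<Omega> a b\<bar> + K * \<bar>L2_inner \<Omega> (wgrad \<Omega> a) (wgrad \<Omega> b)\<bar>"
    unfolding energy_form_def using K by (simp add: abs_mult order_trans[OF abs_triangle_ineq])
  also have "\<dots> \<le> W1p_norm \<Omega> 2 a * W1p_norm \<Omega> 2 b + K * (W1p_norm \<Omega> 2 a * W1p_norm \<Omega> 2 b)"
    by (intro add_mono 1 mult_left_mono 2 K)
  finally show ?thesis by (simp add: distrib_right)
qed

lemma energy_form_measurable:
  assumes \<Omega>: "open \<Omega>" and K: "K \<ge> 0"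
    and x: "strongly_measurable (W1p \<Omega> 2) (W1p_norm \<Omega> 2) T x" and y: "strongly_measurable (W1p \<Omega> 2) (W1p_norm \<Omega> 2) T y"
  shows "(\<lambda>t. energy_form \<Omega> K (x t) (y t)) \<in> borel_measurable (lebesgue_on {0..T})"
proof -
  let ?N = "W1p_norm \<Omega> 2" and ?B = "W1p \<Omega> 2" and ?E = "energy_form \<Omega> K"
  obtain s where s: "\<And>k. simple_function (lebesgue_on {0..T}) (s k)" "\<And>k. s k ` {0..T} \<subseteq> ?B"
    and lims: "AE t in lebesgue_on {0..T}. (\<lambda>k. ?N (\<lambda>z. s k t z - x t z)) \<longlonglongrightarrow> 0"
    and xB: "AE t in lebesgue_on {0..T}. x t \<in> ?B"
    using x by (auto simp: strongly_measurable_def)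
  obtain r where r: "\<And>k. simple_function (lebesgue_on {0..T}) (r k)" "\<And>k. r k ` {0..T} \<subseteq> ?B"
    and limr: "AE t in lebesgue_on {0..T}. (\<lambda>k. ?N (\<lambda>z. r k t z - y t z)) \<longlonglongrightarrow> 0"
    and yB: "AE t in lebesgue_on {0..T}. y t \<in> ?B"
    using y by (auto simp: strongly_measurable_def)
  show ?thesis
  proof (rule borel_measurable_AE_LIMSEQ_time)
    show "(\<lambda>t. ?E (s k t) (r k t)) \<in> borel_measurable (lebesgue_on {0..T})" for k
      by (rule borel_measurable_simple_function[OF simple_function_compose2[OF s(1) r(1)]])
    show "AE t in lebesgue_on {0..T}. (\<lambda>k. ?E (s k t) (r k t)) \<longlonglongrightarrow> ?E (x t) (y t)"
      using lims limr xB yB AE_space[of "lebesgue_on {0..T}"]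
    proof eventually_elim
      case (elim t)
      have sr: "s k t \<in> ?B" "r k t \<in> ?B" for k using s(2)[of k] r(2)[of k] elim(5) by auto
      define d where "d k = ?N (\<lambda>z. s k t z - x t z)" for k
      define e where "e k = ?N (\<lambda>z. r k t z - y t z)" for k
      have key: "\<bar>?E (s k t) (r k t) - ?E (x t) (y t)\<bar> \<le> (1 + K) * (d k * (?N (y t) + e k)) + (1 + K) * (?N (x t) * e k)" for k
      proof -
        have dB: "(\<lambda>z. s k t z - x t z) \<in> ?B" "(\<lambda>z. r k t z - y t z) \<in> ?B"
          using W1p_diff[OF sr(1)[of k] elim(3) \<Omega>] W1p_diff[OF sr(2)[of k] elim(4) \<Omega>] by simp_all
        have "?E (s k t) (r k t) - ?E (x t) (y t) = ?E (\<lambda>z. s k t z - x t z) (r k t) + ?E (x t) (\<lambda>z. r k t z - y t z)"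
          using energy_form_diff_left[OF sr(2)[of k] sr(1)[of k] elim(3) \<Omega>] energy_form_diff_right[OF elim(3) sr(2)[of k] elim(4) \<Omega>]
          by simp
        moreover have "\<bar>?E (\<lambda>z. s k t z - x t z) (r k t)\<bar> \<le> (1 + K) * (d k * (?N (y t) + e k))"
        proof -
          have "?N (r k t) \<le> ?N (y t) + e k"
            using W1p_norm_diff_le[OF sr(2)[of k] elim(4) \<Omega>] by (simp add: e_def)
          then show ?thesis
            unfolding d_def using K
            by (intro order_trans[OF energy_form_le[OF dB(1) sr(2) \<Omega> K]] mult_left_mono) auto
        qed
        moreover have "\<bar>?E (x t) (\<lambda>z. r k t z - y t z)\<bar> \<le> (1 + K) * (?N (x t) * e k)"
          unfolding e_def by (rule energy_form_le[OF elim(3) dB(2) \<Omega> K])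
        ultimately show ?thesis by linarith
      qed
      have "(\<lambda>k. ?E (s k t) (r k t) - ?E (x t) (y t)) \<longlonglongrightarrow> 0"
      proof (rule Lim_null_comparison[OF always_eventually])
        show "\<forall>k. norm (?E (s k t) (r k t) - ?E (x t) (y t)) \<le> (1 + K) * (d k * (?N (y t) + e k)) + (1 + K) * (?N (x t) * e k)"
          using key by simp
        have "(\<lambda>k. (1 + K) * (d k * (?N (y t) + e k)) + (1 + K) * (?N (x t) * e k)) \<longlonglongrightarrow> (1 + K) * (0 * (?N (y t) + 0)) + (1 + K) * (?N (x t) * 0)"
          using elim(1,2) unfolding d_def e_def by (intro tendsto_intros)
        then show "(\<lambda>k. (1 + K) * (d k * (?N (y t) + e k)) + (1 + K) * (?N (x t) * e k)) \<longlonglongrightarrow> 0" by simp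
      qed
      then show ?case by (simp add: LIM_zero_iff)
    qed
  qed
qed

lemma H1_time_derivative_bochner:
  assumes "H1_time_derivative \<Omega> T x xt"
  shows "strongly_measurable (W1p \<Omega> 2) (W1p_norm \<Omega> 2) T xt"
    and "integrable (lebesgue_on {0..T}) (\<lambda>t. W1p_norm \<Omega> 2 (xt t))"
    and "AE t in lebesgue_on {0..T}. xt t \<in> W1p \<Omega> 2"
  using assms by (auto simp: H1_time_derivative_def bochner_Lp_def strongly_measurable_def)

lemma H1_time_derivative_integral:
  assumes "H1_time_derivative \<Omega> T x xt" "t \<in> {0..T}"
  shows "g \<in> Lp \<Omega> 2 \<Longrightarrow> L2_inner \<Omega> (x t) g = L2_inner \<Omega> (x 0) g + time_integral 0 t (\<lambda>s. L2_inner \<Omega> (xt s) g)"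
    and "G \<in> Lp \<Omega> 2 \<Longrightarrow> L2_inner \<Omega> (wgrad \<Omega> (x t)) G
      = L2_inner \<Omega> (wgrad \<Omega> (x 0)) G + time_integral 0 t (\<lambda>s. L2_inner \<Omega> (wgrad \<Omega> (xt s)) G)"
  using assms unfolding H1_time_derivative_def by blast+

text \<open>Functionals on \<open>H\<^sup>1\<close> that commute with the Bochner integral; linearity enters only through differences.\<close>

definition H1_functional :: "(real^'n) set \<Rightarrow> ((real^'n \<Rightarrow> real^'n) \<Rightarrow> real) \<Rightarrow> bool" where
  "H1_functional \<Omega> \<Phi> \<longleftrightarrow>
     (\<forall>a\<in>W1p \<Omega> 2. \<forall>b\<in>W1p \<Omega> 2. \<Phi> (\<lambda>z. a z - b z) = \<Phi> a - \<Phi> b) \<and>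
     (\<exists>C. \<forall>a\<in>W1p \<Omega> 2. \<bar>\<Phi> a\<bar> \<le> C * W1p_norm \<Omega> 2 a)"

lemma H1_functional_L2_inner:
  assumes \<Omega>: "open \<Omega>" and g: "g \<in> Lp \<Omega> 2"
  shows "H1_functional \<Omega> (\<lambda>a. L2_inner \<Omega> a g)"
  unfolding H1_functional_def
proof (intro conjI ballI exI[of _ "Lp_norm \<Omega> 2 g"])
  fix a assume a: "a \<in> W1p \<Omega> 2"
  have "\<bar>L2_inner \<Omega> a g\<bar> \<le> Lp_norm \<Omega> 2 a * Lp_norm \<Omega> 2 g" by (rule L2_inner_le[OF W1p_wgrad(1)[OF a \<Omega>] g])
  also have "\<dots> \<le> W1p_norm \<Omega> 2 a * Lp_norm \<Omega> 2 g" by (intro mult_right_mono Lp_norm_le_W1p_norm) simp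
  finally show "\<bar>L2_inner \<Omega> a g\<bar> \<le> Lp_norm \<Omega> 2 g * W1p_norm \<Omega> 2 a" by (simp add: mult.commute)
qed (simp add: L2_inner_diff_left[OF g] W1p_wgrad(1)[OF _ \<Omega>])

lemma H1_functional_wgrad:
  assumes \<Omega>: "open \<Omega>" and G: "G \<in> Lp \<Omega> 2"
  shows "H1_functional \<Omega> (\<lambda>a. L2_inner \<Omega> (wgrad \<Omega> a) G)"
  unfolding H1_functional_def
proof (intro conjI ballI exI[of _ "Lp_norm \<Omega> 2 G"])
  fix a assume a: "a \<in> W1p \<Omega> 2"
  have "\<bar>L2_inner \<Omega> (wgrad \<Omega> a) G\<bar> \<le> Lp_norm \<Omega> 2 (wgrad \<Omega> a) * Lp_norm \<Omega> 2 G" by (rule L2_inner_le[OF W1p_wgrad(2)[OF a \<Omega>] G])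
  also have "\<dots> \<le> W1p_norm \<Omega> 2 a * Lp_norm \<Omega> 2 G" by (intro mult_right_mono Lp_norm_le_W1p_norm) simp
  finally show "\<bar>L2_inner \<Omega> (wgrad \<Omega> a) G\<bar> \<le> Lp_norm \<Omega> 2 G * W1p_norm \<Omega> 2 a" by (simp add: mult.commute)
next
  fix a b assume "a \<in> W1p \<Omega> 2" "b \<in> W1p \<Omega> 2"
  then show "L2_inner \<Omega> (wgrad \<Omega> (\<lambda>z. a z - b z)) G = L2_inner \<Omega> (wgrad \<Omega> a) G - L2_inner \<Omega> (wgrad \<Omega> b) G"
    unfolding L2_inner_commute[of \<Omega> _ G] by (rule L2_inner_wgrad_diff[OF G _ _ \<Omega>])
qed

lemma H1_functional_time_integrable:
  assumes \<Omega>: "open \<Omega>" and x: "H1_time_derivative \<Omega> T x xt" and \<Phi>: "H1_functional \<Omega> \<Phi>"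
  shows "integrable (lebesgue_on {0..T}) (\<lambda>t. \<Phi> (xt t))"
proof -
  note B = H1_time_derivative_bochner[OF x]
  obtain C where C: "\<And>a. a \<in> W1p \<Omega> 2 \<Longrightarrow> \<bar>\<Phi> a\<bar> \<le> C * W1p_norm \<Omega> 2 a"
    and diff: "\<And>a b. a \<in> W1p \<Omega> 2 \<Longrightarrow> b \<in> W1p \<Omega> 2 \<Longrightarrow> \<Phi> (\<lambda>z. a z - b z) = \<Phi> a - \<Phi> b"
    using \<Phi> unfolding H1_functional_def by blast
  show ?thesis
  proof (rule Bochner_Integration.integrable_bound)
    show "integrable (lebesgue_on {0..T}) (\<lambda>t. C * W1p_norm \<Omega> 2 (xt t))" using B(2) by simp
    show "(\<lambda>t. \<Phi> (xt t)) \<in> borel_measurable (lebesgue_on {0..T})"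
    proof (rule strongly_measurable_lipschitz[OF B(1)])
      fix a b assume ab: "a \<in> W1p \<Omega> 2" "b \<in> W1p \<Omega> 2"
      have "(\<lambda>z. a z - b z) \<in> W1p \<Omega> 2" by (rule W1p_diff[OF ab \<Omega>]) simp
      from C[OF this] show "\<bar>\<Phi> a - \<Phi> b\<bar> \<le> C * W1p_norm \<Omega> 2 (\<lambda>z. a z - b z)" by (simp only: diff[OF ab])
    qed
    show "AE t in lebesgue_on {0..T}. norm (\<Phi> (xt t)) \<le> norm (C * W1p_norm \<Omega> 2 (xt t))"
      using B(3)
    proof eventually_elim
      case (elim t)
      show ?case using C[OF elim] by simp
    qed
  qed
qed

lemma H1_functional_time_integral_diff:
  assumes \<Omega>: "open \<Omega>" and x: "H1_time_derivative \<Omega> T x xt" and y: "H1_time_derivative \<Omega> T y yt"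
    and \<Phi>: "H1_functional \<Omega> \<Phi>" and t: "t \<le> T"
  shows "time_integral 0 t (\<lambda>s. \<Phi> (\<lambda>z. xt s z - yt s z)) = time_integral 0 t (\<lambda>s. \<Phi> (xt s)) - time_integral 0 t (\<lambda>s. \<Phi> (yt s))"
proof -
  note I = integrable_subinterval_time[OF H1_functional_time_integrable[OF \<Omega> x \<Phi>] order_refl t]
    integrable_subinterval_time[OF H1_functional_time_integrable[OF \<Omega> y \<Phi>] order_refl t]
  have J: "integrable (lebesgue_on {0..t}) (\<lambda>s. \<Phi> (xt s) - \<Phi> (yt s))" using I by simp
  have AE: "AE s in lebesgue_on {0..t}. \<Phi> (xt s) - \<Phi> (yt s) = \<Phi> (\<lambda>z. xt s z - yt s z)"
    using AE_subinterval_time[OF H1_time_derivative_bochner(3)[OF x] order_refl t]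
      AE_subinterval_time[OF H1_time_derivative_bochner(3)[OF y] order_refl t]
    by eventually_elim (use \<Phi> in \<open>simp add: H1_functional_def\<close>)
  have "time_integral 0 t (\<lambda>s. \<Phi> (\<lambda>z. xt s z - yt s z)) = time_integral 0 t (\<lambda>s. \<Phi> (xt s) - \<Phi> (yt s))"
    using AE lebesgue_on_measurable_cong_AE[OF _ borel_measurable_integrable[OF J] AE] borel_measurable_integrable[OF J]
    by (intro integral_cong_AE) auto
  then show ?thesis using I by simp
qed

text \<open>Every bounded functional commutes with the time integral of the difference of two derivatives; the functionals in the
  definition are the pairings with \<open>L\<^sup>2\<close> fields.\<close>

lemma H1_time_derivative_diff:
  assumes \<Omega>: "open \<Omega>" and x: "H1_time_derivative \<Omega> T x xt" and y: "H1_time_derivative \<Omega> T y yt"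
  shows "H1_time_derivative \<Omega> T (\<lambda>t z. x t z - y t z) (\<lambda>t z. xt t z - yt t z)"
  unfolding H1_time_derivative_def
proof (intro conjI ballI)
  have W: "x t \<in> W1p \<Omega> 2" "y t \<in> W1p \<Omega> 2" if "t \<in> {0..T}" for t
    using x y that by (auto simp: H1_time_derivative_def)
  show "(\<lambda>z. x t z - y t z) \<in> W1p \<Omega> 2" if "t \<in> {0..T}" for t
    using W1p_diff[OF W[OF that] \<Omega>] by simp
  show "(\<lambda>t z. xt t z - yt t z) \<in> bochner_Lp 1 T (W1p \<Omega> 2) (W1p_norm \<Omega> 2)"
    using x y by (intro bochner_Lp_diff seminormed_space_W1p \<Omega>) (auto simp: H1_time_derivative_def)
  fix t assume t: "t \<in> {0..T}"
  then have t0: "0 \<in> {0..T}" "t \<le> T" by auto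
  have functional: "\<Phi> (\<lambda>z. x t z - y t z) = \<Phi> (\<lambda>z. x 0 z - y 0 z) + time_integral 0 t (\<lambda>s. \<Phi> (\<lambda>z. xt s z - yt s z))"
    if \<Phi>: "H1_functional \<Omega> \<Phi>" and xy: "\<Phi> (x t) = \<Phi> (x 0) + time_integral 0 t (\<lambda>s. \<Phi> (xt s))"
      "\<Phi> (y t) = \<Phi> (y 0) + time_integral 0 t (\<lambda>s. \<Phi> (yt s))" for \<Phi>
  proof -
    have "\<Phi> (\<lambda>z. x s z - y s z) = \<Phi> (x s) - \<Phi> (y s)" if "s \<in> {0..T}" for s
      using \<Phi> W[OF that] by (simp add: H1_functional_def)
    from this[OF t] this[OF t0(1)] show ?thesis
      using xy H1_functional_time_integral_diff[OF \<Omega> x y \<Phi> t0(2)] by linarith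
  qed
  show "L2_inner \<Omega> (\<lambda>z. x t z - y t z) g = L2_inner \<Omega> (\<lambda>z. x 0 z - y 0 z) g
      + (LINT s|lebesgue_on {0..t}. L2_inner \<Omega> (\<lambda>z. xt s z - yt s z) g)" if g: "g \<in> Lp \<Omega> 2" for g
    by (rule functional[OF H1_functional_L2_inner[OF \<Omega> g] H1_time_derivative_integral(1)[OF x t g] H1_time_derivative_integral(1)[OF y t g]])
  show "L2_inner \<Omega> (wgrad \<Omega> (\<lambda>z. x t z - y t z)) G = L2_inner \<Omega> (wgrad \<Omega> (\<lambda>z. x 0 z - y 0 z)) G
      + (LINT s|lebesgue_on {0..t}. L2_inner \<Omega> (wgrad \<Omega> (\<lambda>z. xt s z - yt s z)) G)" if G: "G \<in> Lp \<Omega> 2" for G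
    by (rule functional[OF H1_functional_wgrad[OF \<Omega> G] H1_time_derivative_integral(2)[OF x t G] H1_time_derivative_integral(2)[OF y t G]])
qed

lemma energy_form_time_integral:
  assumes \<Omega>: "open \<Omega>" and x: "H1_time_derivative \<Omega> T x xt" and v: "v \<in> W1p \<Omega> 2"
  shows "integrable (lebesgue_on {0..T}) (\<lambda>r. energy_form \<Omega> K (xt r) v)"
    and "t \<in> {0..T} \<Longrightarrow> energy_form \<Omega> K (x t) v = energy_form \<Omega> K (x 0) v + time_integral 0 t (\<lambda>r. energy_form \<Omega> K (xt r) v)"
proof -
  note I = H1_functional_time_integrable[OF \<Omega> x H1_functional_L2_inner[OF \<Omega> W1p_wgrad(1)[OF v \<Omega>]]]
    H1_functional_time_integrable[OF \<Omega> x H1_functional_wgrad[OF \<Omega> W1p_wgrad(2)[OF v \<Omega>]]]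
  show "integrable (lebesgue_on {0..T}) (\<lambda>r. energy_form \<Omega> K (xt r) v)"
    using I by (simp add: energy_form_def)
  assume t: "t \<in> {0..T}"
  then have T: "0 \<le> (0::real)" "t \<le> T" by auto
  have "time_integral 0 t (\<lambda>r. energy_form \<Omega> K (xt r) v) = time_integral 0 t (\<lambda>r. L2_inner \<Omega> (xt r) v)
    + K * time_integral 0 t (\<lambda>r. L2_inner \<Omega> (wgrad \<Omega> (xt r)) (wgrad \<Omega> v))"
    unfolding energy_form_def
    using integrable_subinterval_time[OF I(1) T] integrable_subinterval_time[OF I(2) T] by simp
  then show "energy_form \<Omega> K (x t) v = energy_form \<Omega> K (x 0) v + time_integral 0 t (\<lambda>r. energy_form \<Omega> K (xt r) v)"
    unfolding energy_form_def[of \<Omega> K "x _"] H1_time_derivative_integral(1)[OF x t W1p_wgrad(1)[OF v \<Omega>]]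
      H1_time_derivative_integral(2)[OF x t W1p_wgrad(2)[OF v \<Omega>]]
    by (simp add: distrib_left)
qed

text \<open>Pair the increment with itself. The factor 4 arises since the norm of \<open>H\<^sup>1\<close> used here is the sum of two \<open>L\<^sup>2\<close> norms and not
  the root of the sum of their squares.\<close>

lemma H1_increment_bound:
  assumes \<Omega>: "open \<Omega>" and x: "H1_time_derivative \<Omega> T x xt" and st: "0 \<le> s" "s \<le> t" "t \<le> T"
  shows "W1p_norm \<Omega> 2 (\<lambda>z. x t z - x s z) \<le> 4 * time_integral s t (\<lambda>r. W1p_norm \<Omega> 2 (xt r))"
proof -
  note B = H1_time_derivative_bochner[OF x]
  have in0: "s \<in> {0..T}" "t \<in> {0..T}" using st by auto
  have W: "x s \<in> W1p \<Omega> 2" "x t \<in> W1p \<Omega> 2"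
    using x in0 by (auto simp: H1_time_derivative_def)
  define g where "g = (\<lambda>z. x t z - x s z)"
  have g: "g \<in> W1p \<Omega> 2" unfolding g_def using W1p_diff[OF W(2,1) \<Omega>] by simp
  let ?E = "energy_form \<Omega> 1" and ?N = "W1p_norm \<Omega> 2"
  let ?I = "time_integral s t (\<lambda>r. ?N (xt r))"
  note I = energy_form_time_integral[OF \<Omega> x g, where K=1]
  have "(?N g)\<^sup>2 \<le> 2 * ?E g g"
    unfolding energy_form_self W1p_norm_def power2_sum
    using sum_squares_bound[of "Lp_norm \<Omega> 2 g" "Lp_norm \<Omega> 2 (wgrad \<Omega> g)"] by simp
  also have "?E g g = ?E (x t) g - ?E (x s) g"
    using energy_form_diff_left[OF g W(2,1) \<Omega>, of 1] by (simp only: g_def)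
  also have "\<dots> = time_integral s t (\<lambda>r. ?E (xt r) g)"
    using I(2)[OF in0(1)] I(2)[OF in0(2)] time_integral_combine[OF I(1) order_refl st] by linarith
  also have "\<dots> \<le> time_integral s t (\<lambda>r. 2 * (?N (xt r) * ?N g))"
  proof (rule integral_mono_AE)
    show "AE r in lebesgue_on {s..t}. ?E (xt r) g \<le> 2 * (?N (xt r) * ?N g)"
      using AE_subinterval_time[OF B(3) st(1,3)]
    proof eventually_elim
      case (elim r)
      show ?case using energy_form_le[OF elim g \<Omega>, of 1] by simp
    qed
  qed (use integrable_subinterval_time[OF I(1) st(1,3)] integrable_subinterval_time[OF B(2) st(1,3)] in auto)
  also have "\<dots> = 2 * (?I * ?N g)" by simp
  finally have le: "(?N g)\<^sup>2 \<le> 4 * ?I * ?N g" by simp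
  have "?N g \<le> 4 * ?I"
  proof (cases "?N g = 0")
    case True
    then show ?thesis using time_integral_nonneg[of "\<lambda>r. ?N (xt r)" s t] by simp
  next
    case False
    then show ?thesis using le W1p_norm_nonneg[of \<Omega> 2 g] by (simp add: power2_eq_square)
  qed
  then show ?thesis by (simp only: g_def)
qed

text \<open>The curve is continuous with values in \<open>H\<^sup>1\<close>, with modulus of continuity given by four times the integral of the norm of its
  derivative, so the chain rule for symmetric forms applies to \<open>a s t = E (x s) (x t)\<close>.\<close>

theorem H1_energy_identity:
  assumes \<Omega>: "open \<Omega>" and K: "K \<ge> 0" and x: "H1_time_derivative \<Omega> T x xt"
    and sx: "strongly_measurable (W1p \<Omega> 2) (W1p_norm \<Omega> 2) T x"
  shows "integrable (lebesgue_on {0..T}) (\<lambda>r. energy_form \<Omega> K (xt r) (x r))"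
    and "t \<in> {0..T} \<Longrightarrow> energy_form \<Omega> K (x t) (x t)
      = energy_form \<Omega> K (x 0) (x 0) + 2 * time_integral 0 t (\<lambda>r. energy_form \<Omega> K (xt r) (x r))"
proof -
  note B = H1_time_derivative_bochner[OF x]
  let ?N = "W1p_norm \<Omega> 2" and ?E = "energy_form \<Omega> K"
  have W: "x t \<in> W1p \<Omega> 2" if "t \<in> {0..T}" for t
    using x that by (auto simp: H1_time_derivative_def)
  have Wd: "(\<lambda>z. x t z - x s z) \<in> W1p \<Omega> 2" if "t \<in> {0..T}" "s \<in> {0..T}" for t s
    using W1p_diff[OF W[OF that(1)] W[OF that(2)] \<Omega>] by simp
  define F where "F t = time_integral 0 t (\<lambda>r. ?N (xt r))" for t
  define D where "D \<tau> \<sigma> = 4 * \<bar>F \<tau> - F \<sigma>\<bar>" for \<tau> \<sigma>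
  have ND': "?N (\<lambda>z. x \<tau> z - x \<sigma> z) \<le> D \<tau> \<sigma>" if "0 \<le> \<sigma>" "\<sigma> \<le> \<tau>" "\<tau> \<le> T" for \<tau> \<sigma>
  proof -
    have "F \<tau> - F \<sigma> = time_integral \<sigma> \<tau> (\<lambda>r. ?N (xt r))"
      using time_integral_combine[OF B(2) order_refl that] unfolding F_def by simp
    then show ?thesis
      using H1_increment_bound[OF \<Omega> x that] abs_ge_self[of "F \<tau> - F \<sigma>"] unfolding D_def by simp
  qed
  have ND: "?N (\<lambda>z. x \<tau> z - x \<sigma> z) \<le> D \<tau> \<sigma>" if "\<tau> \<in> {0..T}" "\<sigma> \<in> {0..T}" for \<tau> \<sigma>
  proof (cases "\<sigma> \<le> \<tau>")
    case True
    then show ?thesis using that by (intro ND') auto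
  next
    case False
    have "?N (\<lambda>z. x \<tau> z - x \<sigma> z) \<le> ?N (\<lambda>z. x \<sigma> z - x \<tau> z)"
      using W1p_norm_diff_triangle[OF W1p_diff[OF W[OF that(1)] W[OF that(1)] \<Omega>] Wd[OF that(2,1)] \<Omega>] W1p_norm_zero[OF \<Omega>, of 2]
      by simp
    also have "\<dots> \<le> D \<sigma> \<tau>" using False that by (intro ND') auto
    also have "\<dots> = D \<tau> \<sigma>" by (simp add: D_def abs_minus_commute)
    finally show ?thesis .
  qed
  have Fcont: "continuous_on {0..T} F"
    unfolding F_def by (rule time_integral_continuous[OF B(2)])
  note b = energy_form_time_integral(1)[OF \<Omega> x, of _ K]
  obtain M where M: "M \<ge> 0" "\<And>t. t \<in> {0..T} \<Longrightarrow> ?N (x t) \<le> M"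
  proof (cases "0 \<le> T")
    case True
    have "bounded (F ` {0..T})"
      by (rule compact_imp_bounded[OF compact_continuous_image[OF Fcont compact_Icc]])
    then obtain C where "\<forall>z\<in>F ` {0..T}. norm z \<le> C" unfolding bounded_iff by blast
    then have C: "\<bar>F t\<bar> \<le> C" if "t \<in> {0..T}" for t using that by auto
    have "?N (x t) \<le> ?N (x 0) + 8 * C" if t: "t \<in> {0..T}" for t
    proof -
      have 0: "0 \<in> {0..T}" using True by simp
      have "?N (x t) \<le> ?N (x 0) + ?N (\<lambda>z. x t z - x 0 z)"
        using W1p_norm_diff_le[OF W[OF t] W[OF 0] \<Omega>] by simp
      then show ?thesis using ND[OF t 0] C[OF t] C[OF 0] abs_triangle_ineq4[of "F t" "F 0"] by (simp add: D_def)
    qed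
    moreover have "0 \<le> ?N (x 0) + 8 * C" using C[of 0] True by (simp add: add_nonneg_nonneg)
    ultimately show ?thesis by (rule that[rotated])
  qed (auto intro: that[of 0])
  show bb: "integrable (lebesgue_on {0..T}) (\<lambda>r. ?E (xt r) (x r))"
  proof (rule Bochner_Integration.integrable_bound)
    show "integrable (lebesgue_on {0..T}) (\<lambda>r. (1 + K) * (?N (xt r) * M))" using B(2) by simp
    show "(\<lambda>r. ?E (xt r) (x r)) \<in> borel_measurable (lebesgue_on {0..T})"
      by (rule energy_form_measurable[OF \<Omega> K B(1) sx])
    show "AE r in lebesgue_on {0..T}. norm (?E (xt r) (x r)) \<le> norm ((1 + K) * (?N (xt r) * M))"
      using B(3) AE_space[of "lebesgue_on {0..T}"]
    proof eventually_elim
      case (elim r)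
      then have r: "r \<in> {0..T}" by simp
      have "\<bar>?E (xt r) (x r)\<bar> \<le> (1 + K) * (?N (xt r) * ?N (x r))" by (rule energy_form_le[OF elim(1) W[OF r] \<Omega> K])
      also have "\<dots> \<le> (1 + K) * (?N (xt r) * M)" using K M(2)[OF r] by (intro mult_left_mono) auto
      finally show ?case using K M(1) by simp
    qed
  qed
  show "?E (x t) (x t) = ?E (x 0) (x 0) + 2 * time_integral 0 t (\<lambda>r. ?E (xt r) (x r))" if t: "t \<in> {0..T}"
  proof (rule quadratic_increment[where a="\<lambda>s t. ?E (x s) (x t)" and b="\<lambda>r \<tau>. ?E (xt r) (x \<tau>)"
        and m="\<lambda>r. (1 + K) * ?N (xt r)" and D=D and T=T])
    show "?E (x s) (x t) = ?E (x t) (x s)" for s t by (rule energy_form_commute)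
    show "?E (x t) (x \<tau>) - ?E (x s) (x \<tau>) = time_integral s t (\<lambda>r. ?E (xt r) (x \<tau>))"
      if st: "0 \<le> s" "s \<le> t" "t \<le> T" and \<tau>: "\<tau> \<in> {0..T}" for s t \<tau>
      using energy_form_time_integral(2)[OF \<Omega> x W[OF \<tau>], of s K] energy_form_time_integral(2)[OF \<Omega> x W[OF \<tau>], of t K] time_integral_combine[OF b[OF W[OF \<tau>]] order_refl st] st by simp
    show "integrable (lebesgue_on {0..T}) (\<lambda>r. ?E (xt r) (x \<tau>))" if "\<tau> \<in> {0..T}" for \<tau> by (rule b[OF W[OF that]])
    show "integrable (lebesgue_on {0..T}) (\<lambda>r. ?E (xt r) (x r))" by (rule bb)
    show "integrable (lebesgue_on {0..T}) (\<lambda>r. (1 + K) * ?N (xt r))" using B(2) by simp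
    show "0 \<le> (1 + K) * ?N (xt r)" for r using K by simp
    show "AE r in lebesgue_on {0..T}. \<forall>\<tau>\<in>{0..T}. \<forall>\<sigma>\<in>{0..T}. \<bar>?E (xt r) (x \<tau>) - ?E (xt r) (x \<sigma>)\<bar> \<le> (1 + K) * ?N (xt r) * D \<tau> \<sigma>"
      using B(3)
    proof eventually_elim
      case (elim r)
      show ?case
      proof (intro ballI)
        fix \<tau> \<sigma> assume ts: "\<tau> \<in> {0..T}" "\<sigma> \<in> {0..T}"
        have "\<bar>?E (xt r) (x \<tau>) - ?E (xt r) (x \<sigma>)\<bar> = \<bar>?E (xt r) (\<lambda>z. x \<tau> z - x \<sigma> z)\<bar>"
          by (simp add: energy_form_diff_right[OF elim W[OF ts(1)] W[OF ts(2)] \<Omega>])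
        also have "\<dots> \<le> (1 + K) * (?N (xt r) * ?N (\<lambda>z. x \<tau> z - x \<sigma> z))"
          by (rule energy_form_le[OF elim Wd[OF ts] \<Omega> K])
        also have "\<dots> \<le> (1 + K) * (?N (xt r) * D \<tau> \<sigma>)"
          using K by (intro mult_left_mono ND[OF ts]) auto
        finally show "\<bar>?E (xt r) (x \<tau>) - ?E (xt r) (x \<sigma>)\<bar> \<le> (1 + K) * ?N (xt r) * D \<tau> \<sigma>" by (simp add: mult.assoc)
      qed
    qed
    show "\<exists>d>0. \<forall>\<tau>\<in>{0..T}. \<forall>\<sigma>\<in>{0..T}. \<bar>\<tau> - \<sigma>\<bar> \<le> d \<longrightarrow> D \<tau> \<sigma> \<le> e" if e: "e > 0" for e
    proof -
      have "uniformly_continuous_on {0..T} F"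
        by (rule compact_uniformly_continuous[OF Fcont compact_Icc])
      then obtain d where d: "d > 0" "\<And>\<tau> \<sigma>. \<tau> \<in> {0..T} \<Longrightarrow> \<sigma> \<in> {0..T} \<Longrightarrow> dist \<sigma> \<tau> < d \<Longrightarrow> dist (F \<sigma>) (F \<tau>) < e / 4"
        using e unfolding uniformly_continuous_on_def by (metis divide_pos_pos zero_less_numeral)
      show ?thesis
      proof (intro exI[of _ "d / 2"] conjI ballI impI)
        show "0 < d / 2" using d(1) by simp
        fix \<tau> \<sigma> assume ts: "\<tau> \<in> {0..T}" "\<sigma> \<in> {0..T}" "\<bar>\<tau> - \<sigma>\<bar> \<le> d / 2"
        then have "dist \<sigma> \<tau> < d" using d(1) by (simp add: dist_real_def abs_minus_commute[of \<sigma>])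
        from d(2)[OF ts(1,2) this] show "D \<tau> \<sigma> \<le> e" by (simp add: D_def dist_real_def abs_minus_commute[of "F \<sigma>"])
      qed
    qed
    show "t \<in> {0..T}" by (rule t)
  qed
qed

section \<open>The estimate of the modelling error\<close>

theorem theorem4p5:
  fixes \<Omega> :: "(real^'n) set" and C1 :: real
  assumes "CARD('n) = 2 \<or> CARD('n) = 3"
    and "regular_domain \<Omega>"
    and "C1 > 0" and "strong_monotonicity \<Omega> C1"
  shows "\<exists>Cstar :: real \<Rightarrow> real \<Rightarrow> real \<Rightarrow> real.
    \<forall>(\<nu>::real) (Cs::real) (\<delta>::real) (\<mu>::real) (T::real) (f :: real^'n \<Rightarrow> real^'n)
      (u :: real \<Rightarrow> real^'n \<Rightarrow> real^'n) ut p w wt q w0.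
      \<nu> > 0 \<and> Cs > 0 \<and> \<delta> > 0 \<and> \<mu> > 0 \<and> T > 0 \<and> body_force \<Omega> f \<and>
      nse_solution \<Omega> T \<nu> f u ut p \<and>
      csm_strong_solution \<Omega> T \<nu> Cs \<delta> \<mu> f w wt q w0 \<and>
      (AE t in lebesgue_on {0..T}. wgrad \<Omega> (ut t) \<in> Lp \<Omega> 2) \<and>
      (\<lambda>t. wgrad \<Omega> (w t)) \<in> bochner_Lp 2 T (Lp \<Omega> 3) (Lp_norm \<Omega> 3)
      \<longrightarrow>
      (let \<phi> = (\<lambda>t x. u t x - w t x);
           K = Cs^4 / \<mu>^2 * \<delta>^2;
           C = Cstar \<nu> T (LINT t|lebesgue_on {0..T}. Lp_norm \<Omega> 3 (wgrad \<Omega> (w t)) ^ 2)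
       in C > 0 \<and>
          ennreal (1/2 * (Lp_norm \<Omega> 2 (\<phi> T) ^ 2 + K * Lp_norm \<Omega> 2 (wgrad \<Omega> (\<phi> T)) ^ 2))
          + (\<integral>\<^sup>+ t. ennreal (\<nu>/2 * Lp_norm \<Omega> 2 (wgrad \<Omega> (\<phi> t)) ^ 2
                    + C1/2 * (Cs * \<delta>)^2 * Lp_norm \<Omega> 3 (wgrad \<Omega> (\<phi> t)) ^ 3) \<partial>lebesgue_on {0..T})
          \<le> ennreal C *
             (ennreal (1/2 * (Lp_norm \<Omega> 2 (\<phi> 0) ^ 2 + K * Lp_norm \<Omega> 2 (wgrad \<Omega> (\<phi> 0)) ^ 2))
              + (\<integral>\<^sup>+ t. ennreal ((Cs * \<delta>)^2 * Lp_norm \<Omega> 3 (wgrad \<Omega> (u t)) ^ 3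
                        + K * Lp_norm \<Omega> 2 (wgrad \<Omega> (ut t)) ^ 2) \<partial>lebesgue_on {0..T})))"
proof -
  have \<Omega>: "open \<Omega>" "bounded \<Omega>" using assms(2) by (auto simp: regular_domain_def)
  \<comment> \<open>\<open>S\<close> is the Gagliardo-Nirenberg constant, \<open>M\<close> the constant from Young's inequality in front of the data, and \<open>rate \<nu> T I\<close> the
    integral over \<open>[0,T]\<close> of the Gronwall rate \<open>1 + S\<^sup>2 / \<nu> \<parallel>\<nabla>w\<parallel>\<^sup>2\<close>.\<close>
  define S where "S = 2 * (measure lebesgue \<Omega> + 1)\<^sup>2"
  define M where "M = 1 + 1 / sqrt (C1 / 2)"
  define rate where "rate \<nu> T I = T + S\<^sup>2 / \<nu> * I" for \<nu> T I :: real
  define Cstar where "Cstar \<nu> T I = (1 + rate \<nu> T I * 4 ^ (nat \<lceil>2 * rate \<nu> T I\<rceil> + 1)) * M" for \<nu> T I :: real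
  have M1: "M \<ge> 1" using assms(3) by (simp add: M_def)
  show ?thesis
  proof (rule exI[of _ Cstar], intro allI impI, elim conjE)
    fix \<nu> Cs \<delta> \<mu> T :: real and f :: "real^'n \<Rightarrow> real^'n" and u ut p w wt q w0
    assume \<nu>: "\<nu> > 0" and T: "T > 0" and f: "body_force \<Omega> f"
      and nse: "nse_solution \<Omega> T \<nu> f u ut p" and csm: "csm_strong_solution \<Omega> T \<nu> Cs \<delta> \<mu> f w wt q w0"
      and gw: "(\<lambda>t. wgrad \<Omega> (w t)) \<in> bochner_Lp 2 T (Lp \<Omega> 3) (Lp_norm \<Omega> 3)"
    define \<phi> where "\<phi> = (\<lambda>t x. u t x - w t x)"
    define \<phi>t where "\<phi>t = (\<lambda>t x. ut t x - wt t x)"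
    define K where "K = Cs^4 / \<mu>^2 * \<delta>^2"
    define I where "I = (LINT t|lebesgue_on {0..T}. Lp_norm \<Omega> 3 (wgrad \<Omega> (w t)) ^ 2)"
    define s where "s = (Cs * \<delta>)\<^sup>2"
    define R where "R t = s * Lp_norm \<Omega> 3 (wgrad \<Omega> (u t)) ^ 3 + K * Lp_norm \<Omega> 2 (wgrad \<Omega> (ut t)) ^ 2" for t
    define G where "G t = \<nu>/2 * Lp_norm \<Omega> 2 (wgrad \<Omega> (\<phi> t)) ^ 2 + C1/2 * s * Lp_norm \<Omega> 3 (wgrad \<Omega> (\<phi> t)) ^ 3" for t
    define y where "y t = 1/2 * (Lp_norm \<Omega> 2 (\<phi> t) ^ 2 + K * Lp_norm \<Omega> 2 (wgrad \<Omega> (\<phi> t)) ^ 2)" for t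
    define k where "k t = 1 + S\<^sup>2 / \<nu> * (Lp_norm \<Omega> 3 (wgrad \<Omega> (w t)))\<^sup>2" for t
    have K0: "K \<ge> 0" and s0: "s \<ge> 0" by (simp_all add: K_def s_def)
    have pos: "0 \<le> k t" "0 \<le> R t" "0 \<le> G t" "0 \<le> y t" for t
      using \<nu> K0 s0 assms(3) by (simp_all add: k_def R_def G_def y_def)
    have uS: "u \<in> strong_class \<Omega> T" and uH: "H1_time_derivative \<Omega> T u ut"
      and uAE: "AE t in lebesgue_on {0..T}. u t \<in> Xspace \<Omega> \<and> p t \<in> Lp \<Omega> 2 \<and>
        (\<forall>\<psi>\<in>C1c \<Omega>.
           L2_inner \<Omega> (ut t) \<psi> + L2_inner \<Omega> (convect \<Omega> (u t)) \<psi>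
           + \<nu> * L2_inner \<Omega> (wgrad \<Omega> (u t)) (wgrad \<Omega> \<psi>) - L2_inner \<Omega> (p t) (wdiv \<Omega> \<psi>)
           = L2_inner \<Omega> f \<psi>) \<and>
        (AE x in lebesgue_on \<Omega>. wdiv \<Omega> (u t) x = 0)"
      using nse unfolding nse_solution_def by blast+
    have wS: "w \<in> strong_class \<Omega> T" and wH: "H1_time_derivative \<Omega> T w wt"
      and wAE: "AE t in lebesgue_on {0..T}. w t \<in> Xspace \<Omega> \<and> q t \<in> Qspace \<Omega> \<and>
        (\<forall>q\<in>Qspace \<Omega>. L2_inner \<Omega> q (wdiv \<Omega> (w t)) = 0)"
      and wT: "\<And>v. v \<in> strong_class \<Omega> T \<Longrightarrow> AE t in lebesgue_on {0..T}. v t \<in> Xspace \<Omega> \<Longrightarrow>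
        AE t in lebesgue_on {0..T}. csm_weak_form \<Omega> \<nu> Cs \<delta> \<mu> f (w t) (wt t) (q t) (v t)"
      using csm unfolding csm_strong_solution_def by blast+
    have \<phi>S: "\<phi> \<in> strong_class \<Omega> T" unfolding \<phi>_def by (rule strong_class_diff[OF \<Omega>(1) uS wS])
    have \<phi>H: "H1_time_derivative \<Omega> T \<phi> \<phi>t"
      unfolding \<phi>_def \<phi>t_def by (rule H1_time_derivative_diff[OF \<Omega>(1) uH wH])
    have \<phi>X: "AE t in lebesgue_on {0..T}. \<phi> t \<in> Xspace \<Omega>"
      using uAE wAE unfolding \<phi>_def by eventually_elim (simp add: Xspace_diff[OF _ _ \<Omega>(1)])
    have sm: "strongly_measurable (W1p \<Omega> 2) (W1p_norm \<Omega> 2) T \<phi>" "strongly_measurable (W1p \<Omega> 3) (W1p_norm \<Omega> 3) T \<phi>"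
      "strongly_measurable (W1p \<Omega> 3) (W1p_norm \<Omega> 3) T u"
      using \<phi>S uS by (auto simp: strong_class_def bochner_Linf_def bochner_Lp_def)
    note utB = H1_time_derivative_bochner[OF uH] and wtB = H1_time_derivative_bochner[OF wH]
    have Rm: "R \<in> borel_measurable (lebesgue_on {0..T})"
      using bochner_W1p_norm_wgrad_measurable[OF \<Omega>(1) _ sm(3)] bochner_W1p_norm_wgrad_measurable[OF \<Omega>(1) _ utB(1)]
      unfolding R_def[abs_def] by measurable
    have Gm: "G \<in> borel_measurable (lebesgue_on {0..T})"
      using bochner_W1p_norm_wgrad_measurable[OF \<Omega>(1) _ sm(1)] bochner_W1p_norm_wgrad_measurable[OF \<Omega>(1) _ sm(2)]
      unfolding G_def[abs_def] by measurable
    have gwi: "integrable (lebesgue_on {0..T}) (\<lambda>t. (Lp_norm \<Omega> 3 (wgrad \<Omega> (w t)))\<^sup>2)"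
      using gw by (simp add: bochner_Lp_def)
    have ki: "integrable (lebesgue_on {0..T}) k"
      unfolding k_def[abs_def] using gwi by simp
    have kI: "time_integral 0 T k = rate \<nu> T I"
      unfolding k_def[abs_def] using gwi T by (simp add: rate_def I_def measure_restrict_space)
    define \<beta> where "\<beta> t = energy_form \<Omega> K (\<phi>t t) (\<phi> t)" for t
    note EI = H1_energy_identity[OF \<Omega>(1) K0 \<phi>H sm(1)]
    have \<beta>i: "integrable (lebesgue_on {0..T}) \<beta>" unfolding \<beta>_def[abs_def] by (rule EI(1))
    have yE: "y t = 1/2 * energy_form \<Omega> K (\<phi> t) (\<phi> t)" for t
      by (simp add: y_def energy_form_self)
    have y\<beta>: "y t = y 0 + time_integral 0 t \<beta>" if "t \<in> {0..T}" for t
      using EI(2)[OF that] by (simp add: yE \<beta>_def[abs_def])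
    have le: "AE t in lebesgue_on {0..T}. \<beta> t + G t \<le> k t * y t + M * R t"
      using uAE wAE wT[OF \<phi>S \<phi>X] utB(3) wtB(3)
    proof eventually_elim
      case (elim t)
      have \<phi>2: "\<phi> t \<in> W1p \<Omega> 2"
        unfolding \<phi>_def using elim(1,2) by (intro W1p3_imp_W1p2[OF \<Omega>] Xspace_W1p Xspace_diff[OF _ _ \<Omega>(1)]) auto
      have "\<beta> t = energy_form \<Omega> K (ut t) (\<phi> t) - energy_form \<Omega> K (wt t) (\<phi> t)"
        unfolding \<beta>_def \<phi>t_def by (rule energy_form_diff_left[OF \<phi>2 elim(4,5) \<Omega>(1)])
      then have "\<beta> t = L2_inner \<Omega> (ut t) (\<phi> t) - L2_inner \<Omega> (wt t) (\<phi> t)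
        + K * (L2_inner \<Omega> (wgrad \<Omega> (ut t)) (wgrad \<Omega> (\<phi> t)) - L2_inner \<Omega> (wgrad \<Omega> (wt t)) (wgrad \<Omega> (\<phi> t)))"
        by (simp add: energy_form_def right_diff_distrib)
      then show ?case
        unfolding G_def k_def y_def R_def M_def
        using error_energy_inequality[OF assms(1) \<Omega> f assms(4,3) \<nu>, of "u t" "w t" "ut t" "wt t" "p t" "q t" Cs \<delta> \<mu>]
          elim unfolding \<phi>_def K_def S_def s_def by simp
    qed
    have "I \<ge> 0" unfolding I_def by (intro integral_nonneg_AE) auto
    then have rate0: "rate \<nu> T I \<ge> 0" using \<nu> T by (simp add: rate_def)
    define c where "c = 1 + rate \<nu> T I * 4 ^ (nat \<lceil>2 * rate \<nu> T I\<rceil> + 1)"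
    have c1: "c \<ge> 1" using rate0 by (simp add: c_def)
    have C: "Cstar \<nu> T I = c * M" by (simp add: Cstar_def c_def)
    have Cpos: "Cstar \<nu> T I > 0" unfolding C using c1 M1 by simp
    have main: "ennreal (y T) + (\<integral>\<^sup>+ t. ennreal (G t) \<partial>lebesgue_on {0..T})
      \<le> ennreal (Cstar \<nu> T I) * (ennreal (y 0) + (\<integral>\<^sup>+ t. ennreal (R t) \<partial>lebesgue_on {0..T}))"
    proof (cases "(\<integral>\<^sup>+ t. ennreal (R t) \<partial>lebesgue_on {0..T}) = \<infinity>")
      \<comment> \<open>the spaces for \<open>u\<close> do not make the cube of \<open>\<parallel>\<nabla>u\<parallel>\<close> or the square of \<open>\<parallel>\<nabla>u\<^sub>t\<parallel>\<close> integrable in time\<close>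
      case True
      then show ?thesis using Cpos by (simp add: ennreal_mult_top)
    next
      case False
      have Ri: "integrable (lebesgue_on {0..T}) R"
        using Rm False pos(2) by (intro integrableI_nonneg) (auto simp: less_top)
      have MRi: "integrable (lebesgue_on {0..T}) (\<lambda>t. M * R t)" using Ri by simp
      have MR0: "0 \<le> M * R t" for t using M1 pos(2) by simp
      note gr = gronwall_integral[OF less_imp_le[OF T] \<beta>i ki MRi Gm pos(1) MR0 pos(3,4) y\<beta> le, unfolded kI]
      have "y T + time_integral 0 T G \<le> c * (y 0 + M * time_integral 0 T R)"
        using gr(2) by (simp add: c_def)
      also have "\<dots> \<le> c * (M * y 0 + M * time_integral 0 T R)"
        using c1 M1 pos(4)[of 0] mult_right_mono[OF M1 pos(4)[of 0]] by (intro mult_left_mono) auto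
      also have "\<dots> = Cstar \<nu> T I * (y 0 + time_integral 0 T R)"
        by (simp add: C algebra_simps)
      finally have fin: "y T + time_integral 0 T G \<le> Cstar \<nu> T I * (y 0 + time_integral 0 T R)" .
      have eqG: "(\<integral>\<^sup>+ t. ennreal (G t) \<partial>lebesgue_on {0..T}) = ennreal (time_integral 0 T G)"
        using gr(1) pos(3) by (intro nn_integral_eq_integral) auto
      have eqR: "(\<integral>\<^sup>+ t. ennreal (R t) \<partial>lebesgue_on {0..T}) = ennreal (time_integral 0 T R)"
        using Ri pos(2) by (intro nn_integral_eq_integral) auto
      have "ennreal (y T) + ennreal (time_integral 0 T G) = ennreal (y T + time_integral 0 T G)"
        using pos(4) time_integral_nonneg[OF pos(3)] by (intro ennreal_plus[symmetric])
      also have "\<dots> \<le> ennreal (Cstar \<nu> T I * (y 0 + time_integral 0 T R))" by (rule ennreal_leI[OF fin])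
      also have "\<dots> = ennreal (Cstar \<nu> T I) * (ennreal (y 0) + ennreal (time_integral 0 T R))"
        using Cpos pos(4) time_integral_nonneg[OF pos(2)] by (simp add: ennreal_mult)
      finally show ?thesis unfolding eqG eqR .
    qed
    show "let \<phi> = (\<lambda>t x. u t x - w t x);
           K = Cs^4 / \<mu>^2 * \<delta>^2;
           C = Cstar \<nu> T (LINT t|lebesgue_on {0..T}. Lp_norm \<Omega> 3 (wgrad \<Omega> (w t)) ^ 2)
       in C > 0 \<and>
          ennreal (1/2 * (Lp_norm \<Omega> 2 (\<phi> T) ^ 2 + K * Lp_norm \<Omega> 2 (wgrad \<Omega> (\<phi> T)) ^ 2))
          + (\<integral>\<^sup>+ t. ennreal (\<nu>/2 * Lp_norm \<Omega> 2 (wgrad \<Omega> (\<phi> t)) ^ 2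
                    + C1/2 * (Cs * \<delta>)^2 * Lp_norm \<Omega> 3 (wgrad \<Omega> (\<phi> t)) ^ 3) \<partial>lebesgue_on {0..T})
          \<le> ennreal C *
             (ennreal (1/2 * (Lp_norm \<Omega> 2 (\<phi> 0) ^ 2 + K * Lp_norm \<Omega> 2 (wgrad \<Omega> (\<phi> 0)) ^ 2))
              + (\<integral>\<^sup>+ t. ennreal ((Cs * \<delta>)^2 * Lp_norm \<Omega> 3 (wgrad \<Omega> (u t)) ^ 3
                        + K * Lp_norm \<Omega> 2 (wgrad \<Omega> (ut t)) ^ 2) \<partial>lebesgue_on {0..T}))"
      using Cpos main unfolding Let_def y_def G_def R_def I_def s_def K_def \<phi>_def by blast
  qed
qed

end
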